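(* Let $x=(u_0,\{u_k\}_{k=1}^\ell,\{\operatorname{vec}(V_k)\}_{k=1}^\ell)$ be certifiably first-order optimal for (BM-$r$) with dual multipliers $(y,z)$. Suppose $\gamma=-\lambda_{\min}[S(y,z)]>0$, $\|x\|<R$, and $$\mathbf{e}_i^T(W_ku_k+b_ku_0)\ne0,\qquad \mathbf{e}_i^TW_kV_k\ne0\qquad\text{for all }k\in\{1,\dots,\ell-1\},\ i\in\{1,\dots,n_{k+1}\}.$$ Let $\xi=(\xi_0,\xi_1,\dots,\xi_\ell)$ ($\xi_0\in\mathbb{R}$, $\xi_k\in\mathbb{R}^{n_k}$) be an eigenvector with $\|\xi\|=1$ and $\xi^TS(y,z)\xi=-\gamma\|\xi\|^2$. Then $\xi$ implicitly defines an escape path $x_+(t)=(u_0,\{u_{k,+}(t)\}_{k=1}^\ell,\{V_{k,+}(t)\}_{k=1}^\ell)$, with $V_{k,+}(t)\in\mathbb{R}^{n_k\times r}$, i.e. there exists a path of the form $$u_{k,+}(t)=u_k+O(t^2),\qquad V_{k,+}(t)=[V_k,0]+t\cdot[0,\ u_k\xi_0/u_0-\xi_k]+O(t^2),$$ that makes a second-order improvement to the objective while satisfying all constraints of (BM-$(r+1)$), as in $$f(x_+(t))=f(x)-t^2\gamma,\qquad g(x_+(t))\le0,\qquad h(x_+(t))=0$$ for all $t\in[0,\epsilon)$ with sufficiently small but nonzero $\epsilon>0$.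
   Context: Data: $\ell\ge 2$; layer sizes $n_1,\dots,n_\ell$ with $n=\sum_{k=1}^\ell n_k$; $W_k\in\mathbb{R}^{n_{k+1}\times n_k}$ and $b_k\in\mathbb{R}^{n_{k+1}}$ for $k=1,\dots,\ell-1$; $w_\ell\in\mathbb{R}^{n_\ell}$; $\hat x\in\mathbb{R}^{n_1}$; radius $\rho$; bound $R>0$. $\|\cdot\|$ is the Euclidean (Frobenius) norm; vector inequalities are componentwise; $\mathbf{e}_i$ is the $i$-th canonical basis vector; $\odot$ is the elementwise product; $\operatorname{diag}$ of a matrix is its diagonal as a vector and of a vector is the diagonal matrix. Problem (BM-$r$): variables $u_0\in\mathbb{R}$, $u_k\in\mathbb{R}^{n_k}$, $V_k\in\mathbb{R}^{n_k\times(r-1)}$, $k=1,\dots,\ell$, collected in $x=(u_0,\{u_k\}_{k=1}^\ell,\{\operatorname{vec}(V_k)\}_{k=1}^\ell)$. It is $\min_{\|x\|\le R}f(x)$ s.t. $g(x)\le0$, $h(x)=0$, with $f(x)=u_0\,(w_\ell^Tu_\ell)$, $g=(g_0,\{g_{k,1},g_{k,2}\}_{k=1}^{\ell-1})$, $h=(h_0,\{h_k\}_{k=1}^{\ell-1})$, $g_0(x)=\|u_1-u_0\hat x\|^2+\|V_1\|^2-\rho^2$, $g_{k,1}(x)=-u_0u_{k+1}$, $g_{k,2}(x)=u_0(W_ku_k+b_ku_0-u_{k+1})$, $h_0(x)=1-u_0^2$, $h_k(x)=\operatorname{diag}[(u_{k+1}-W_ku_k-b_ku_0)u_{k+1}^T+(V_{k+1}-W_kV_k)V_{k+1}^T]$.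 The same formulas define $f,g,h$ for the lifted problem (BM-$(r+1)$), in which each $V_k$ has $r$ columns. Certifiably first-order optimal with multipliers $y=(y_0,\{y_{k,1},y_{k,2}\}_{k=1}^{\ell-1})$, $z=(z_0,\{z_k\}_{k=1}^{\ell-1})$ ($y_0,z_0\in\mathbb{R}$, $y_{k,1},y_{k,2},z_k\in\mathbb{R}^{n_{k+1}}$) means: $g(x)\le0$, $h(x)=0$; there is no continuously differentiable path $x(t)$ with $x(0)=x$ such that, for some $\delta,\epsilon>0$, $f(x(t))\le f(x)-\delta t$, $g(x(t))\le0$, $h(x(t))=0$ for all $t\in[0,\epsilon)$; and $\nabla f(x)+\nabla g(x)y+\nabla h(x)z=0$, $y\odot g(x)=0$, $y\ge0$ ($\nabla g,\nabla h$ have gradients of components as columns). The slack matrix is the symmetric $(n+1)\times(n+1)$ matrix $$S(y,z)=\frac12\begin{bmatrix}s_0&s_1^T&s_2^T&\cdots&s_\ell^T\\ s_1&S_{1,1}&S_{1,2}&&\\ s_2&S_{1,2}^T&S_{2,2}&\ddots&\\ \vdots&&\ddots&\ddots&S_{\ell-1,\ell}\\ s_\ell&&&S_{\ell-1,\ell}^T&S_{\ell,\ell}\end{bmatrix}$$ (blank blocks zero), where, with $Z_k=\operatorname{diag}(z_k)$, $s_0=2[y_0(\|\hat x\|^2-\rho^2)+\sum_{k=1}^{\ell-1}b_k^Ty_{k,2}-z_0]$, $s_1=W_1^Ty_{1,2}-2\hat xy_0$, $s_{k+1}=W_{k+1}^Ty_{k+1,2}-(Z_kb_k+y_{k,1}+y_{k,2})$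 for $k\in\{1,\dots,\ell-2\}$, $s_\ell=w_\ell-[Z_{\ell-1}b_{\ell-1}+y_{\ell-1,1}+y_{\ell-1,2}]$, $S_{1,1}=2y_0I$, and $S_{k,k+1}=-W_k^TZ_k$, $S_{k+1,k+1}=2Z_k$ for $k\in\{1,\dots,\ell-1\}$.
   Formalization: In the slack matrix, s_0 is corrected to 2[y_0‖x̂‖² + Σ b_k^T y_{k,2} − z_0], dropping the term −2y_0ρ², because with the displayed g_0 (constant ρ²) the displayed s_0 makes the claim false when y_0ρ ≠ 0, even at some global minimizers. *)

theory Defs
  imports
    "HOL-Analysis.Derivative"
    "HOL-Library.Landau_Symbols"
    "Jordan_Normal_Form.Spectral_Radius"
begin

text \<open>Vectors and matrices are those of \<open>Jordan_Normal_Form.Matrix\<close> (dimension as a value), not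
  those of \<open>HOL-Analysis\<close> (dimension as a type).\<close>

hide_type (open) Finite_Cartesian_Product.vec
hide_const (open) Finite_Cartesian_Product.vec
no_notation Finite_Cartesian_Product.vec_nth (infixl "$" 90)
unbundle no inner_syntax

section \<open>Euclidean norms, block vectors and block matrices\<close>

definition vnorm :: "real vec \<Rightarrow> real" where
  "vnorm v = sqrt (v \<bullet> v)"

definition fnorm :: "real mat \<Rightarrow> real" where
  "fnorm A = sqrt (\<Sum>i<dim_row A. \<Sum>j<dim_col A. (A $$ (i, j))\<^sup>2)"

text \<open>\<open>outer a b\<close> is \<open>a b\<^sup>T\<close>.\<close>

definition outer :: "real vec \<Rightarrow> real vec \<Rightarrow> real mat" where
  "outer a b = mat (dim_vec a) (dim_vec b) (\<lambda>(i, j). a $ i * b $ j)"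

text \<open>The diagonal of a square matrix as a vector, and a vector as a diagonal matrix.\<close>

definition diag_of_mat :: "real mat \<Rightarrow> real vec" where
  "diag_of_mat A = vec (dim_row A) (\<lambda>i. A $$ (i, i))"

definition diag_of_vec :: "real vec \<Rightarrow> real mat" where
  "diag_of_vec v = mat_diag (dim_vec v) (\<lambda>i. v $ i)"

definition col_mat :: "real vec \<Rightarrow> real mat" where
  "col_mat v = mat_of_cols (dim_vec v) [v]"

text \<open>\<open>hcat A B\<close> is the matrix \<open>[A, B]\<close>; both arguments have the same number of rows.\<close>

definition hcat :: "real mat \<Rightarrow> real mat \<Rightarrow> real mat" where
  "hcat A B = mat (dim_row A) (dim_col A + dim_col B)
     (\<lambda>(i, j). if j < dim_col A then A $$ (i, j) else B $$ (i, j - dim_col A))"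

text \<open>Blocks are numbered \<open>0, \<dots>, m - 1\<close> and block \<open>k\<close> has size \<open>d k\<close>.  The global index
  \<open>block_start d k + i\<close> with \<open>i < d k\<close> is the \<open>i\<close>-th index of block \<open>k\<close>.\<close>

definition block_start :: "(nat \<Rightarrow> nat) \<Rightarrow> nat \<Rightarrow> nat" where
  "block_start d k = (\<Sum>j<k. d j)"

definition block_of :: "(nat \<Rightarrow> nat) \<Rightarrow> nat \<Rightarrow> nat" where
  "block_of d i = (LEAST k. i < block_start d (Suc k))"

definition block_vec :: "(nat \<Rightarrow> nat) \<Rightarrow> nat \<Rightarrow> (nat \<Rightarrow> real vec) \<Rightarrow> real vec" where
  "block_vec d m v = vec (block_start d m)
     (\<lambda>i. v (block_of d i) $ (i - block_start d (block_of d i)))"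

definition block_mat :: "(nat \<Rightarrow> nat) \<Rightarrow> nat \<Rightarrow> (nat \<Rightarrow> nat \<Rightarrow> real mat) \<Rightarrow> real mat" where
  "block_mat d m B = mat (block_start d m) (block_start d m)
     (\<lambda>(i, j). B (block_of d i) (block_of d j) $$
        (i - block_start d (block_of d i), j - block_start d (block_of d j)))"

lemma block_start_mono: "k \<le> l \<Longrightarrow> block_start d k \<le> block_start d l"
  unfolding block_start_def by (rule sum_mono2) auto

lemma block_start_Suc: "block_start d (Suc k) = block_start d k + d k"
  by (simp add: block_start_def)

lemma block_of_start:
  assumes "i < d k"
  shows "block_of d (block_start d k + i) = k"
  unfolding block_of_def
proof (rule Least_equality)
  show "block_start d k + i < block_start d (Suc k)"
    using assms by (simp add: block_start_Suc)
next
  fix l assume l: "block_start d k + i < block_start d (Suc l)"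
  show "k \<le> l"
  proof (rule ccontr)
    assume "\<not> k \<le> l"
    then have "block_start d (Suc l) \<le> block_start d k"
      by (intro block_start_mono) simp
    with l show False by simp
  qed
qed

lemma block_start_add_less:
  assumes "k < m" "i < d k"
  shows "block_start d k + i < block_start d m"
  using block_start_mono[of "Suc k" m d] assms by (simp add: block_start_Suc)

lemma block_vec_index:
  assumes "k < m" "i < d k"
  shows "block_vec d m v $ (block_start d k + i) = v k $ i"
  using assms by (simp add: block_vec_def block_of_start block_start_add_less)

lemma block_mat_index:
  assumes "k < m" "i < d k" "l < m" "j < d l"
  shows "block_mat d m B $$ (block_start d k + i, block_start d l + j) = B k l $$ (i, j)"
  using assms by (simp add: block_mat_def block_of_start block_start_add_less)

text \<open>Smallest eigenvalue of a real symmetric matrix.\<close>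

definition lambda_min :: "real mat \<Rightarrow> real" where
  "lambda_min A = Min (spectrum A)"


section \<open>The problem (BM-r)\<close>

text \<open>Layers are numbered \<open>1, \<dots>, depth D\<close>, and \<open>weight D k\<close>, \<open>bias D k\<close> lead from layer \<open>k\<close>
  to layer \<open>k + 1\<close>; components of vectors and matrices are numbered from \<open>0\<close>.  All families
  indexed by layers are functions on \<open>nat\<close> whose values outside the stated range are never used.\<close>

record bm_data =
  depth :: nat
  width :: "nat \<Rightarrow> nat"
  weight :: "nat \<Rightarrow> real mat"
  bias :: "nat \<Rightarrow> real vec"
  out_weight :: "real vec"
  center :: "real vec"
  radius :: real

definition valid_data :: "bm_data \<Rightarrow> bool" where
  "valid_data D \<longleftrightarrow>
     2 \<le> depth D \<and>
     (\<forall>k\<in>{1..depth D}. 0 < width D k) \<and>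
     (\<forall>k\<in>{1..<depth D}. weight D k \<in> carrier_mat (width D (k + 1)) (width D k) \<and>
                         bias D k \<in> carrier_vec (width D (k + 1))) \<and>
     out_weight D \<in> carrier_vec (width D (depth D)) \<and>
     center D \<in> carrier_vec (width D 1)"

text \<open>A point is \<open>x = (u\<^sub>0, u, V)\<close>; in (BM-r) each \<open>V k\<close> has \<open>r - 1\<close> columns.\<close>

type_synonym bm_point = "real \<times> (nat \<Rightarrow> real vec) \<times> (nat \<Rightarrow> real mat)"

definition bm_points :: "bm_data \<Rightarrow> nat \<Rightarrow> bm_point set" where
  "bm_points D r = {(u0, u, V). \<forall>k\<in>{1..depth D}.
     u k \<in> carrier_vec (width D k) \<and> V k \<in> carrier_mat (width D k) (r - 1)}"

fun pnorm :: "bm_data \<Rightarrow> bm_point \<Rightarrow> real" where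
  "pnorm D (u0, u, V) =
     sqrt (u0\<^sup>2 + (\<Sum>k=1..depth D. (vnorm (u k))\<^sup>2) + (\<Sum>k=1..depth D. (fnorm (V k))\<^sup>2))"

fun obj :: "bm_data \<Rightarrow> bm_point \<Rightarrow> real" where
  "obj D (u0, u, V) = u0 * (out_weight D \<bullet> u (depth D))"

fun g0 :: "bm_data \<Rightarrow> bm_point \<Rightarrow> real" where
  "g0 D (u0, u, V) =
     (vnorm (u 1 - u0 \<cdot>\<^sub>v center D))\<^sup>2 + (fnorm (V 1))\<^sup>2 - (radius D)\<^sup>2"

fun g1 :: "bm_data \<Rightarrow> nat \<Rightarrow> bm_point \<Rightarrow> real vec" where
  "g1 D k (u0, u, V) = - (u0 \<cdot>\<^sub>v u (k + 1))"

fun g2 :: "bm_data \<Rightarrow> nat \<Rightarrow> bm_point \<Rightarrow> real vec" where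
  "g2 D k (u0, u, V) = u0 \<cdot>\<^sub>v (weight D k *\<^sub>v u k + u0 \<cdot>\<^sub>v bias D k - u (k + 1))"

fun h0 :: "bm_point \<Rightarrow> real" where
  "h0 (u0, u, V) = 1 - u0\<^sup>2"

fun hk :: "bm_data \<Rightarrow> nat \<Rightarrow> bm_point \<Rightarrow> real vec" where
  "hk D k (u0, u, V) = diag_of_mat
     (outer (u (k + 1) - weight D k *\<^sub>v u k - u0 \<cdot>\<^sub>v bias D k) (u (k + 1))
      + (V (k + 1) - weight D k * V k) * transpose_mat (V (k + 1)))"

text \<open>The constraints \<open>g(x) \<le> 0\<close>, \<open>h(x) = 0\<close> (the bound on the norm of \<open>x\<close> is kept separate).\<close>

definition feasible :: "bm_data \<Rightarrow> bm_point \<Rightarrow> bool" where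
  "feasible D x \<longleftrightarrow>
     g0 D x \<le> 0 \<and>
     (\<forall>k\<in>{1..<depth D}. g1 D k x \<le> 0\<^sub>v (width D (k + 1)) \<and> g2 D k x \<le> 0\<^sub>v (width D (k + 1))) \<and>
     h0 x = 0 \<and>
     (\<forall>k\<in>{1..<depth D}. hk D k x = 0\<^sub>v (width D (k + 1)))"


section \<open>Coordinates, partial derivatives and paths\<close>

datatype coord = C0 | CU nat nat | CV nat nat nat

definition coords :: "bm_data \<Rightarrow> nat \<Rightarrow> coord set" where
  "coords D r = {C0}
     \<union> {CU k i | k i. k \<in> {1..depth D} \<and> i < width D k}
     \<union> {CV k i j | k i j. k \<in> {1..depth D} \<and> i < width D k \<and> j < r - 1}"

fun coord_val :: "bm_point \<Rightarrow> coord \<Rightarrow> real" where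
  "coord_val (u0, u, V) C0 = u0"
| "coord_val (u0, u, V) (CU k i) = u k $ i"
| "coord_val (u0, u, V) (CV k i j) = V k $$ (i, j)"

text \<open>\<open>nudge x c s\<close> adds \<open>s\<close> to coordinate \<open>c\<close> of \<open>x\<close>.\<close>

fun nudge :: "bm_point \<Rightarrow> coord \<Rightarrow> real \<Rightarrow> bm_point" where
  "nudge (u0, u, V) C0 s = (u0 + s, u, V)"
| "nudge (u0, u, V) (CU k i) s = (u0, u(k := u k + s \<cdot>\<^sub>v unit_vec (dim_vec (u k)) i), V)"
| "nudge (u0, u, V) (CV k i j) s = (u0, u, V(k := V k +
     mat (dim_row (V k)) (dim_col (V k)) (\<lambda>(a, b). if a = i \<and> b = j then s else 0)))"

text \<open>The \<open>c\<close>-component of the gradient at \<open>x\<close>.\<close>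

definition partial :: "(bm_point \<Rightarrow> real) \<Rightarrow> bm_point \<Rightarrow> coord \<Rightarrow> real" where
  "partial F x c = deriv (\<lambda>s. F (nudge x c s)) 0"

text \<open>Continuously differentiable paths \<open>[0, e) \<rightarrow>\<close> (BM-r), with one-sided derivative at \<open>0\<close>.\<close>

definition C1_path :: "bm_data \<Rightarrow> nat \<Rightarrow> real \<Rightarrow> (real \<Rightarrow> bm_point) \<Rightarrow> bool" where
  "C1_path D r e p \<longleftrightarrow>
     (\<forall>t\<in>{0..<e}. p t \<in> bm_points D r) \<and>
     (\<forall>c\<in>coords D r. \<exists>p'.
        (\<forall>t\<in>{0..<e}. ((\<lambda>s. coord_val (p s) c) has_real_derivative p' t) (at t within {0..<e})) \<and>
        continuous_on {0..<e} p')"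


section \<open>Certifiable first-order optimality\<close>

text \<open>Multipliers are \<open>y = (y\<^sub>0, y1, y2)\<close> and \<open>z = (z\<^sub>0, zs)\<close>, where \<open>y1 k\<close>, \<open>y2 k\<close>, \<open>zs k\<close>
  belong to the components \<open>g1 D k\<close>, \<open>g2 D k\<close>, \<open>hk D k\<close>.\<close>

type_synonym ineq_mult = "real \<times> (nat \<Rightarrow> real vec) \<times> (nat \<Rightarrow> real vec)"
type_synonym eq_mult = "real \<times> (nat \<Rightarrow> real vec)"

fun valid_mults :: "bm_data \<Rightarrow> ineq_mult \<Rightarrow> eq_mult \<Rightarrow> bool" where
  "valid_mults D (y0, y1, y2) (z0, zs) \<longleftrightarrow> (\<forall>k\<in>{1..<depth D}.
     y1 k \<in> carrier_vec (width D (k + 1)) \<and> y2 k \<in> carrier_vec (width D (k + 1)) \<and>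
     zs k \<in> carrier_vec (width D (k + 1)))"

fun grad_f_gy_hz :: "bm_data \<Rightarrow> ineq_mult \<Rightarrow> eq_mult \<Rightarrow> bm_point \<Rightarrow> coord \<Rightarrow> real" where
  "grad_f_gy_hz D (y0, y1, y2) (z0, zs) x c =
     partial (obj D) x c
     + (partial (g0 D) x c * y0
        + (\<Sum>k=1..<depth D. \<Sum>i<width D (k + 1).
             partial (\<lambda>x. g1 D k x $ i) x c * y1 k $ i + partial (\<lambda>x. g2 D k x $ i) x c * y2 k $ i))
     + (partial h0 x c * z0
        + (\<Sum>k=1..<depth D. \<Sum>i<width D (k + 1). partial (\<lambda>x. hk D k x $ i) x c * zs k $ i))"

fun compl_slack :: "bm_data \<Rightarrow> ineq_mult \<Rightarrow> bm_point \<Rightarrow> bool" where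
  "compl_slack D (y0, y1, y2) x \<longleftrightarrow>
     y0 * g0 D x = 0 \<and>
     (\<forall>k\<in>{1..<depth D}. \<forall>i<width D (k + 1). y1 k $ i * g1 D k x $ i = 0 \<and> y2 k $ i * g2 D k x $ i = 0)"

fun mult_nonneg :: "bm_data \<Rightarrow> ineq_mult \<Rightarrow> bool" where
  "mult_nonneg D (y0, y1, y2) \<longleftrightarrow>
     0 \<le> y0 \<and>
     (\<forall>k\<in>{1..<depth D}. 0\<^sub>v (width D (k + 1)) \<le> y1 k \<and> 0\<^sub>v (width D (k + 1)) \<le> y2 k)"

definition first_order_opt :: "bm_data \<Rightarrow> nat \<Rightarrow> bm_point \<Rightarrow> bool" where
  "first_order_opt D r x \<longleftrightarrow>
     feasible D x \<and>
     \<not> (\<exists>p \<delta> e. \<delta> > 0 \<and> e > 0 \<and> C1_path D r e p \<and> p 0 = x \<and>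
          (\<forall>t\<in>{0..<e}. obj D (p t) \<le> obj D x - \<delta> * t \<and> feasible D (p t)))"

definition cert_first_order_opt ::
  "bm_data \<Rightarrow> nat \<Rightarrow> bm_point \<Rightarrow> ineq_mult \<Rightarrow> eq_mult \<Rightarrow> bool" where
  "cert_first_order_opt D r x y z \<longleftrightarrow>
     x \<in> bm_points D r \<and> valid_mults D y z \<and>
     first_order_opt D r x \<and>
     (\<forall>c\<in>coords D r. grad_f_gy_hz D y z x c = 0) \<and>
     compl_slack D y x \<and> mult_nonneg D y"


section \<open>The slack matrix\<close>

text \<open>\<open>2 S(y, z)\<close> is the Hessian, with respect to \<open>(u\<^sub>0, u)\<close>, of the Lagrangian
  \<open>f + y\<^sup>T g + z\<^sup>T h\<close>.  The constraint \<open>g0\<close> contains \<open>radius\<^sup>2\<close> as a constant and not multiplied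
  by \<open>u\<^sub>0\<^sup>2\<close>, so the radius does not occur in \<open>s\<^sub>0\<close>.  With the homogeneous version
  \<open>g0 + radius\<^sup>2 h0\<close> in place of \<open>g0\<close>, the multiplier of \<open>h0\<close> would be
  \<open>z\<^sub>0 - y\<^sub>0 radius\<^sup>2\<close>, and in terms of that multiplier \<open>s\<^sub>0\<close> takes the form
  \<open>2 [y\<^sub>0 (\<parallel>center\<parallel>\<^sup>2 - radius\<^sup>2) + \<Sum>\<^sub>k b\<^sub>k\<^sup>T y2 k - z\<^sub>0]\<close>, the matrix being the same.
  That formula must not be combined with the multipliers of the inhomogeneous \<open>g0\<close>: the
  stationarity condition \<open>S(y, z) (u\<^sub>0, u) = 0\<close> would fail.\<close>

fun slack_s0 :: "bm_data \<Rightarrow> ineq_mult \<Rightarrow> eq_mult \<Rightarrow> real" where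
  "slack_s0 D (y0, y1, y2) (z0, zs) =
     2 * (y0 * (vnorm (center D))\<^sup>2 + (\<Sum>k=1..<depth D. bias D k \<bullet> y2 k) - z0)"

fun slack_s :: "bm_data \<Rightarrow> ineq_mult \<Rightarrow> eq_mult \<Rightarrow> nat \<Rightarrow> real vec" where
  "slack_s D (y0, y1, y2) (z0, zs) k =
     (if k = 1 then
        transpose_mat (weight D 1) *\<^sub>v y2 1 - (2 * y0) \<cdot>\<^sub>v center D
      else
        (if k < depth D then transpose_mat (weight D k) *\<^sub>v y2 k else out_weight D)
        - (diag_of_vec (zs (k - 1)) *\<^sub>v bias D (k - 1) + y1 (k - 1) + y2 (k - 1)))"

text \<open>\<open>slack_diag \<dots> k\<close> is \<open>S\<^sub>k\<^sub>,\<^sub>k\<close> and \<open>slack_off \<dots> k\<close> is \<open>S\<^sub>k\<^sub>,\<^sub>k\<^sub>+\<^sub>1\<close>.\<close>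

fun slack_diag :: "bm_data \<Rightarrow> ineq_mult \<Rightarrow> eq_mult \<Rightarrow> nat \<Rightarrow> real mat" where
  "slack_diag D (y0, y1, y2) (z0, zs) k =
     (if k = 1 then (2 * y0) \<cdot>\<^sub>m 1\<^sub>m (width D 1) else 2 \<cdot>\<^sub>m diag_of_vec (zs (k - 1)))"

fun slack_off :: "bm_data \<Rightarrow> ineq_mult \<Rightarrow> eq_mult \<Rightarrow> nat \<Rightarrow> real mat" where
  "slack_off D (y0, y1, y2) (z0, zs) k = - (transpose_mat (weight D k) * diag_of_vec (zs k))"

definition slack_block :: "bm_data \<Rightarrow> ineq_mult \<Rightarrow> eq_mult \<Rightarrow> nat \<Rightarrow> nat \<Rightarrow> real mat" where
  "slack_block D y z k l =
     (if k = 0 \<and> l = 0 then mat 1 1 (\<lambda>_. slack_s0 D y z)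
      else if l = 0 then col_mat (slack_s D y z k)
      else if k = 0 then transpose_mat (col_mat (slack_s D y z l))
      else if k = l then slack_diag D y z k
      else if l = k + 1 then slack_off D y z k
      else if k = l + 1 then transpose_mat (slack_off D y z l)
      else 0\<^sub>m (width D k) (width D l))"

text \<open>Block \<open>0\<close> is the scalar block, block \<open>k \<ge> 1\<close> is layer \<open>k\<close>.\<close>

definition block_size :: "bm_data \<Rightarrow> nat \<Rightarrow> nat" where
  "block_size D k = (if k = 0 then 1 else width D k)"

definition slack_matrix :: "bm_data \<Rightarrow> ineq_mult \<Rightarrow> eq_mult \<Rightarrow> real mat" where
  "slack_matrix D y z =
     (1 / 2) \<cdot>\<^sub>m block_mat (block_size D) (depth D + 1) (slack_block D y z)"

text \<open>The vector \<open>(\<xi>\<^sub>0, \<xi>\<^sub>1, \<dots>)\<close> of length \<open>n + 1\<close>.\<close>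

definition stack :: "bm_data \<Rightarrow> real \<Rightarrow> (nat \<Rightarrow> real vec) \<Rightarrow> real vec" where
  "stack D \<xi>0 \<xi> = block_vec (block_size D) (depth D + 1)
     (\<lambda>k. if k = 0 then vec 1 (\<lambda>_. \<xi>0) else \<xi> k)"

end

theory Submission
  imports Defs
begin

text \<open>Write a point as its columns: \<open>(u\<^sub>0, u)\<close> and the columns of the \<open>V\<^sub>k\<close>, the latter with
  zeroth entry \<open>0\<close>.  All functions of the problem are sums over the columns of one bilinear form,
  so the Lagrangian is a constant plus \<open>\<Sum> \<beta>(c, c)\<close> with \<open>\<beta>(\<xi>, \<xi>) = \<xi>\<^sup>T S \<xi>\<close>.
  Adding a new column \<open>a v\<close> with \<open>v = (\<xi>\<^sub>0 / u\<^sub>0) (u\<^sub>0, u) - \<xi>\<close> perturbs the constraints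
  only through \<open>t = a\<^sup>2\<close>, and they can be repaired layer by layer with explicit square roots that are
  smooth in \<open>t\<close>: scale \<open>V\<^sub>1\<close> to keep \<open>g\<^sub>0\<close> fixed; in each later neuron \<open>h = 0\<close> says that the row of \<open>V\<close>
  lies on a sphere, so if a bound of \<open>g\<close> is active one keeps it active and rescales the row about the
  centre of its sphere, and otherwise one solves a quadratic equation for the entry of \<open>u\<close>.  Active
  constraints stay active, so the objective equals the Lagrangian along the curve, and stationarity
  gives the change \<open>- \<gamma> t + O(t\<^sup>2)\<close>.  Reparametrizing \<open>a\<close> turns it into exactly \<open>- \<gamma> t\<^sup>2\<close>.\<close>

section \<open>Germs of continuously differentiable functions\<close>

text \<open>The gain of the new column is of first order in \<open>t = a^2\<close>, the order at
  which the constraints are disturbed. A multiplier times a constraint that leaves its bound would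
  compete with the gain, so activity has to be preserved exactly. The two bounds of one neuron
  cannot both be active, because its preactivation is nonzero; hence the bound to follow is fixed at
  the start. Nonzero rows of \<open>W_k V_k\<close> give the spheres positive radius and, at the
  first level, force \<open>V_1\<close> to be nonzero, so that it can be scaled. The vector
  \<open>(u_0, u)\<close> lies in the kernel of \<open>S\<close>, so adding a multiple of it to the
  eigenvector, or changing the sign, keeps the value of the form; this freedom is spent on the
  zeroth entry, which columns of \<open>V\<close> do not have. The claim asks for exactly
  \<open>- \<gamma> t^2\<close> along a continuously differentiable path. Hence the calculus of
  two-sided C1 germs at 0: they are closed under arithmetic, roots of positive functions and
  composition, and they suffice to invert the signed square root of the gain.\<close>

definition C1_at0 :: "(real \<Rightarrow> real) \<Rightarrow> bool" where
  "C1_at0 f \<longleftrightarrow> (\<exists>f'. (\<forall>\<^sub>F t in nhds 0. (f has_real_derivative f' t) (at t)) \<and>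
                    (\<forall>\<^sub>F t in nhds 0. isCont f' t))"

lemma C1_at0I:
  assumes "\<forall>\<^sub>F t in nhds 0. (f has_real_derivative f' t) (at t)" "\<forall>\<^sub>F t in nhds 0. isCont f' t"
  shows "C1_at0 f"
  using assms unfolding C1_at0_def by blast

lemma C1_at0E:
  assumes "C1_at0 f"
  obtains f' where "\<forall>\<^sub>F t in nhds 0. (f has_real_derivative f' t) (at t)" "\<forall>\<^sub>F t in nhds 0. isCont f' t"
  using assms unfolding C1_at0_def by blast

lemma C1_at0_eventually_isCont:
  assumes "C1_at0 f"
  shows "\<forall>\<^sub>F t in nhds 0. isCont f t"
proof -
  obtain f' where "\<forall>\<^sub>F t in nhds 0. (f has_real_derivative f' t) (at t)"
    using assms unfolding C1_at0_def by blast
  then show ?thesis by eventually_elim (rule DERIV_isCont)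
qed

lemma C1_at0_isCont: "C1_at0 f \<Longrightarrow> isCont f 0"
  using C1_at0_eventually_isCont eventually_nhds_x_imp_x by blast

lemma C1_at0_tendsto: "C1_at0 f \<Longrightarrow> (f \<longlongrightarrow> f 0) (nhds 0)"
  using C1_at0_isCont by (simp add: continuous_at tendsto_at_iff_tendsto_nhds)

lemma C1_at0_eventually_greater:
  assumes "C1_at0 f" "c < f 0"
  shows "\<forall>\<^sub>F t in nhds 0. c < f t"
  using order_tendstoD(1)[OF C1_at0_tendsto[OF assms(1)] assms(2)] .

lemma C1_at0_eventually_less:
  assumes "C1_at0 f" "f 0 < c"
  shows "\<forall>\<^sub>F t in nhds 0. f t < c"
  using order_tendstoD(2)[OF C1_at0_tendsto[OF assms(1)] assms(2)] .

lemma C1_at0_const: "C1_at0 (\<lambda>_. c)"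
  by (rule C1_at0I[where f' = "\<lambda>_. 0"]) auto

lemma C1_at0_ident: "C1_at0 (\<lambda>t. t)"
  by (rule C1_at0I[where f' = "\<lambda>_. 1"]) auto

lemma C1_at0_add:
  assumes "C1_at0 f" "C1_at0 g"
  shows "C1_at0 (\<lambda>t. f t + g t)"
proof -
  obtain f' where f': "\<forall>\<^sub>F t in nhds 0. (f has_real_derivative f' t) (at t)" "\<forall>\<^sub>F t in nhds 0. isCont f' t"
    by (rule C1_at0E[OF assms(1)])
  obtain g' where g': "\<forall>\<^sub>F t in nhds 0. (g has_real_derivative g' t) (at t)" "\<forall>\<^sub>F t in nhds 0. isCont g' t"
    by (rule C1_at0E[OF assms(2)])
  show ?thesis
  proof (rule C1_at0I)
    show "\<forall>\<^sub>F t in nhds 0. ((\<lambda>t. f t + g t) has_real_derivative f' t + g' t) (at t)"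
      using f'(1) g'(1) by eventually_elim (rule DERIV_add)
    show "\<forall>\<^sub>F t in nhds 0. isCont (\<lambda>t. f' t + g' t) t"
      using f'(2) g'(2) by eventually_elim (intro continuous_intros)
  qed
qed

lemma C1_at0_mult:
  assumes "C1_at0 f" "C1_at0 g"
  shows "C1_at0 (\<lambda>t. f t * g t)"
proof -
  obtain f' where f': "\<forall>\<^sub>F t in nhds 0. (f has_real_derivative f' t) (at t)" "\<forall>\<^sub>F t in nhds 0. isCont f' t"
    by (rule C1_at0E[OF assms(1)])
  obtain g' where g': "\<forall>\<^sub>F t in nhds 0. (g has_real_derivative g' t) (at t)" "\<forall>\<^sub>F t in nhds 0. isCont g' t"
    by (rule C1_at0E[OF assms(2)])
  show ?thesis
  proof (rule C1_at0I)
    show "\<forall>\<^sub>F t in nhds 0. ((\<lambda>t. f t * g t) has_real_derivative f' t * g t + g' t * f t) (at t)"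
      using f'(1) g'(1) by eventually_elim (rule DERIV_mult)
    show "\<forall>\<^sub>F t in nhds 0. isCont (\<lambda>t. f' t * g t + g' t * f t) t"
      using f'(2) g'(2) C1_at0_eventually_isCont[OF assms(1)] C1_at0_eventually_isCont[OF assms(2)]
      by eventually_elim (intro continuous_intros)
  qed
qed

lemma C1_at0_minus: "C1_at0 f \<Longrightarrow> C1_at0 (\<lambda>t. - f t)"
  using C1_at0_mult[of "\<lambda>_. -1" f] by (simp add: C1_at0_const)

lemma C1_at0_diff: "C1_at0 f \<Longrightarrow> C1_at0 g \<Longrightarrow> C1_at0 (\<lambda>t. f t - g t)"
  using C1_at0_add[of f "\<lambda>t. - g t"] by (simp add: C1_at0_minus)

lemma C1_at0_divide_const: "C1_at0 f \<Longrightarrow> C1_at0 (\<lambda>t. f t / c)"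
  using C1_at0_mult[of f "\<lambda>_. inverse c"] by (simp add: divide_inverse C1_at0_const)

lemma C1_at0_power: "C1_at0 f \<Longrightarrow> C1_at0 (\<lambda>t. f t ^ n)"
proof (induction n)
  case (Suc n)
  then show ?case using C1_at0_mult[of f "\<lambda>t. f t ^ n"] by simp
qed (simp add: C1_at0_const)

lemma C1_at0_sum:
  "(\<And>i. i \<in> A \<Longrightarrow> C1_at0 (f i)) \<Longrightarrow> C1_at0 (\<lambda>t. \<Sum>i\<in>A. f i t)"
proof (induction A rule: infinite_finite_induct)
  case (insert x A)
  then show ?case using C1_at0_add[of "f x" "\<lambda>t. \<Sum>i\<in>A. f i t"] by simp
qed (simp_all add: C1_at0_const)

text \<open>Germs at 0 compose only when the inner function fixes 0; the eventual properties of the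
  outer one are pulled back along the limit of \<open>g\<close> at 0.\<close>

lemma C1_at0_compose:
  assumes f: "C1_at0 f" and g: "C1_at0 g" and "g 0 = 0"
  shows "C1_at0 (\<lambda>t. f (g t))"
proof -
  obtain f' where f': "\<forall>\<^sub>F t in nhds 0. (f has_real_derivative f' t) (at t)" "\<forall>\<^sub>F t in nhds 0. isCont f' t"
    by (rule C1_at0E[OF f])
  obtain g' where g': "\<forall>\<^sub>F t in nhds 0. (g has_real_derivative g' t) (at t)" "\<forall>\<^sub>F t in nhds 0. isCont g' t"
    by (rule C1_at0E[OF g])
  have lim: "filterlim g (nhds 0) (nhds 0)"
    using C1_at0_tendsto[OF g] \<open>g 0 = 0\<close> by simp
  note f'g = eventually_compose_filterlim[OF f'(1) lim] eventually_compose_filterlim[OF f'(2) lim]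
  show ?thesis
  proof (rule C1_at0I)
    show "\<forall>\<^sub>F t in nhds 0. ((\<lambda>t. f (g t)) has_real_derivative f' (g t) * g' t) (at t)"
      using f'g(1) g'(1) by eventually_elim (rule DERIV_chain2)
    show "\<forall>\<^sub>F t in nhds 0. isCont (\<lambda>t. f' (g t) * g' t) t"
      using f'g(2) g'(2) C1_at0_eventually_isCont[OF g]
    proof eventually_elim
      case (elim t)
      then show ?case using isCont_o2[of t g f'] by (intro continuous_intros) auto
    qed
  qed
qed

lemma C1_at0_sqrt:
  assumes "C1_at0 f" "f 0 > 0"
  shows "C1_at0 (\<lambda>t. sqrt (f t))"
proof -
  obtain f' where f': "\<forall>\<^sub>F t in nhds 0. (f has_real_derivative f' t) (at t)" "\<forall>\<^sub>F t in nhds 0. isCont f' t"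
    by (rule C1_at0E[OF assms(1)])
  note pos = C1_at0_eventually_greater[OF assms]
  show ?thesis
  proof (rule C1_at0I)
    show "\<forall>\<^sub>F t in nhds 0. ((\<lambda>t. sqrt (f t)) has_real_derivative (inverse (sqrt (f t)) / 2) * f' t) (at t)"
      using f'(1) pos
    proof eventually_elim
      case (elim t)
      show ?case
        by (rule DERIV_chain2[where f = sqrt and g = f, OF DERIV_real_sqrt[OF elim(2)] elim(1)])
    qed
    show "\<forall>\<^sub>F t in nhds 0. isCont (\<lambda>t. (inverse (sqrt (f t)) / 2) * f' t) t"
      using f'(2) pos C1_at0_eventually_isCont[OF assms(1)]
    proof eventually_elim
      case (elim t)
      from elim(2) have "sqrt (f t) \<noteq> 0" by simp
      moreover have "isCont (\<lambda>t. sqrt (f t)) t"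
        by (rule isCont_o2[OF elim(3) isCont_real_sqrt])
      ultimately show ?case
        using elim(1) unfolding divide_inverse by (intro isCont_mult continuous_at_within_inverse continuous_const)
    qed
  qed
qed

text \<open>Stated on \<open>nhds 0\<close> rather than \<open>at 0\<close>: both sides vanish at 0,
  and the estimate can then be composed with inner functions that may return to 0.\<close>

lemma C1_at0_bigo:
  assumes "C1_at0 f"
  shows "(\<lambda>t. f t - f 0) \<in> O[nhds 0](\<lambda>t. t)"
proof -
  obtain f' where "\<forall>\<^sub>F t in nhds 0. (f has_real_derivative f' t) (at t)"
    using assms unfolding C1_at0_def by blast
  then have "(f has_real_derivative f' 0) (at 0)"
    by (rule eventually_nhds_x_imp_x)
  then have "((\<lambda>t. (f t - f 0) / t) \<longlongrightarrow> f' 0) (at 0)"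
    by (simp add: has_field_derivative_iff)
  then have "(\<lambda>t. f t - f 0) \<in> O[at 0](\<lambda>t. t)"
    by (intro bigoI_tendsto[where c = "f' 0"]) (auto simp: eventually_at_filter)
  then obtain c where "\<forall>\<^sub>F t in at 0. norm (f t - f 0) \<le> c * norm t"
    by (elim landau_o.bigE) 
  then have "\<forall>\<^sub>F t in nhds 0. norm (f t - f 0) \<le> c * norm t"
    unfolding eventually_at_filter 
  proof eventually_elim
    case (elim t)
    then show ?case by (cases "t = 0") auto
  qed
  then show ?thesis by (rule bigoI)
qed

section \<open>Reparametrization by the square root of the improvement\<close>

text \<open>One-dimensional inverse function theorem. A continuous derivative that is positive at 0
  is positive on an interval, where \<open>m\<close> is strictly increasing; compactness of that
  interval makes the inverse continuous, and then it is differentiable.\<close>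

lemma C1_at0_local_inverse:
  assumes m: "\<forall>\<^sub>F x in nhds 0. (m has_real_derivative m' x) (at x)" "\<forall>\<^sub>F x in nhds 0. isCont m' x"
    and "m 0 = 0" "0 < m' 0"
  obtains s where "C1_at0 s" "s 0 = 0" "\<forall>\<^sub>F t in nhds 0. m (s t) = t"
proof -
  have "isCont m' 0" using m(2) by (rule eventually_nhds_x_imp_x)
  then have "(m' \<longlongrightarrow> m' 0) (nhds 0)" by (simp add: continuous_at tendsto_at_iff_tendsto_nhds)
  then have "\<forall>\<^sub>F x in nhds 0. 0 < m' x" using \<open>0 < m' 0\<close> by (rule order_tendstoD(1))
  with m have "\<forall>\<^sub>F x in nhds 0. (m has_real_derivative m' x) (at x) \<and> isCont m' x \<and> 0 < m' x"
    by eventually_elim simp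
  then obtain d0 where "d0 > 0" and d0:
    "\<And>x. dist x 0 < d0 \<Longrightarrow> (m has_real_derivative m' x) (at x) \<and> isCont m' x \<and> 0 < m' x"
    unfolding eventually_nhds_metric by blast
  \<comment> \<open>Half the radius puts the compact interval \<open>{-d..d}\<close> inside the open
    ball on which the derivative is known.\<close>
  define d where "d = d0 / 2"
  have "d > 0" using \<open>d0 > 0\<close> by (simp add: d_def)
  have d: "(m has_real_derivative m' x) (at x)" "isCont m' x" "0 < m' x" if "x \<in> {-d..d}" for x
    using d0[of x] that \<open>d0 > 0\<close> by (auto simp: d_def)
  have mono: "m x < m y" if "x \<in> {-d..d}" "y \<in> {-d..d}" "x < y" for x y
  proof (rule DERIV_pos_imp_increasing[OF \<open>x < y\<close>])
    fix z assume "x \<le> z" "z \<le> y"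
    then have "z \<in> {-d..d}" using that by auto
    then show "\<exists>D. (m has_real_derivative D) (at z) \<and> 0 < D" using d by blast
  qed
  then have inj: "inj_on m {-d..d}"
    by (intro inj_onI) (metis less_irrefl linorder_neqE_linordered_idom)
  have cont: "continuous_on {-d..d} m"
    by (rule continuous_at_imp_continuous_on) (use d(1) DERIV_isCont in blast)
  define s where "s = inv_into {-d..d} m"
  have sm: "s (m x) = x" if "x \<in> {-d..d}" for x
    unfolding s_def using inj that by (rule inv_into_f_f)
  have cont_s: "continuous_on (m ` {-d..d}) s"
    by (rule continuous_on_inv[OF cont]) (auto simp: sm)
  \<comment> \<open>An open interval of values, so that continuity of \<open>s\<close> on it is
    continuity at each of its points.\<close>
  let ?T = "{m (-d)<..<m d}"
  have T_img: "?T \<subseteq> m ` {-d<..<d}"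
  proof
    fix t assume t: "t \<in> ?T"
    then obtain x where x: "-d \<le> x" "x \<le> d" "m x = t"
      using IVT'[of m "-d" t d] cont \<open>d > 0\<close> by auto
    moreover have "x \<noteq> -d" "x \<noteq> d" using t x(3) by auto
    ultimately show "t \<in> m ` {-d<..<d}" by auto
  qed
  have s_in: "s t \<in> {-d..d}" and ms: "m (s t) = t" if t: "t \<in> ?T" for t
  proof -
    obtain x where "x \<in> {-d<..<d}" "t = m x" using T_img t by blast
    then have "s t = x" "x \<in> {-d..d}" using sm[of x] by auto
    then show "s t \<in> {-d..d}" "m (s t) = t" using \<open>t = m x\<close> by auto
  qed
  have "continuous_on ?T s"
    by (rule continuous_on_subset[OF cont_s]) (use T_img in fastforce)
  then have cs: "isCont s t" if "t \<in> ?T" for t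
    using that by (simp add: continuous_on_eq_continuous_at)
  have "0 \<in> ?T" using mono[of "-d" 0] mono[of 0 d] \<open>d > 0\<close> \<open>m 0 = 0\<close> by auto
  then have ev: "\<forall>\<^sub>F t in nhds 0. t \<in> ?T"
    by (intro eventually_nhds_in_open) auto
  show ?thesis
  proof (rule that[of s])
    show "s 0 = 0" using sm[of 0] \<open>m 0 = 0\<close> \<open>d > 0\<close> by simp
    show "\<forall>\<^sub>F t in nhds 0. m (s t) = t" using ev by eventually_elim (rule ms)
    show "C1_at0 s"
    proof (rule C1_at0I)
      show "\<forall>\<^sub>F t in nhds 0. (s has_real_derivative inverse (m' (s t))) (at t)"
        using ev
      proof eventually_elim
        case (elim t)
        show ?case
        proof (rule DERIV_inverse_function[where f = m and a = "m (-d)" and b = "m d"])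
          show "(m has_real_derivative m' (s t)) (at (s t))" using d(1) s_in[OF elim] .
          show "m' (s t) \<noteq> 0" using d(3)[OF s_in[OF elim]] by simp
          show "m (s y) = y" if "m (-d) < y" "y < m d" for y using ms[of y] that by simp
        qed (use elim cs in auto)
      qed
      show "\<forall>\<^sub>F t in nhds 0. isCont (\<lambda>t. inverse (m' (s t))) t"
        using ev
      proof eventually_elim
        case (elim t)
        have "isCont (\<lambda>t. m' (s t)) t"
          by (rule isCont_o2[OF cs[OF elim] d(2)[OF s_in[OF elim]]])
        then show ?case
          using d(3)[OF s_in[OF elim]] by (intro continuous_at_within_inverse) auto
      qed
    qed
  qed
qed

text \<open>Here \<open>f\<close> will be the gain divided by \<gamma>, as a function of the squared
  coefficient of the new column, and \<open>s t\<close> is the coefficient at which it equals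
  \<open>t^2\<close>. The equation \<open>f (s^2) = t^2\<close> is degenerate at 0, so its signed
  square root is inverted instead.\<close>

lemma C1_at0_sqrt_reparametrization:
  assumes "C1_at0 f" and "f 0 = 0" and bigo: "(\<lambda>x. f x - x) \<in> O[nhds 0](\<lambda>x. x\<^sup>2)"
  obtains s where "C1_at0 s" "s 0 = 0" "\<forall>\<^sub>F t in nhds 0. f ((s t)\<^sup>2) = t\<^sup>2"
    "(\<lambda>t. s t - t) \<in> O[nhds 0](\<lambda>t. t\<^sup>2)"
proof -
  obtain f' where f': "\<forall>\<^sub>F t in nhds 0. (f has_real_derivative f' t) (at t)" "\<forall>\<^sub>F t in nhds 0. isCont f' t"
    by (rule C1_at0E[OF \<open>C1_at0 f\<close>])
  obtain c where c: "c > 0" "\<forall>\<^sub>F x in nhds 0. norm (f x - x) \<le> c * norm (x\<^sup>2)"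
    using bigo by (elim landau_o.bigE) 
  have sq: "filterlim (\<lambda>x::real. x\<^sup>2) (nhds 0) (nhds 0)"
    using C1_at0_tendsto[OF C1_at0_power[OF C1_at0_ident, of 2]] by simp
  have f_sq: "\<forall>\<^sub>F x in nhds 0. \<bar>f (x\<^sup>2) - x\<^sup>2\<bar> \<le> c * x ^ 4"
    using eventually_compose_filterlim[OF c(2) sq] by eventually_elim (simp flip: power_mult)
  have "\<forall>\<^sub>F x::real in nhds 0. x\<^sup>2 < min 1 (1 / (2 * c))"
    using order_tendstoD(2)[OF sq, of "min 1 (1 / (2 * c))"] \<open>c > 0\<close> by simp
  \<comment> \<open>The bound \<open>1 / (2 * c)\<close> makes the error \<open>c * x^4\<close> at
    most \<open>x^2 / 2\<close>, hence \<open>f (x^2)\<close> positive off 0; the bound 1 absorbs a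
    factor \<open>|s t|\<close> in the final estimate.\<close>
  then have small: "\<forall>\<^sub>F x::real in nhds 0. \<bar>x\<bar> \<le> 1 \<and> 2 * c * x\<^sup>2 < 1"
  proof eventually_elim
    case (elim x)
    then have "x\<^sup>2 < 1" "x\<^sup>2 < 1 / (2 * c)" by auto
    then show ?case using \<open>c > 0\<close> by (auto simp: abs_square_less_1 field_simps less_imp_le)
  qed
  have pos: "\<forall>\<^sub>F x in nhds 0. x \<noteq> 0 \<longrightarrow> 0 < f (x\<^sup>2)"
    using f_sq small
  proof eventually_elim
    case (elim x)
    have "c * x ^ 4 = (2 * c * x\<^sup>2) * x\<^sup>2 / 2" by (simp add: power_numeral_reduce)
    also have "\<dots> \<le> 1 * x\<^sup>2 / 2" using elim by (intro divide_right_mono mult_right_mono) auto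
    finally have "f (x\<^sup>2) \<ge> x\<^sup>2 / 2" using elim(1) by linarith
    moreover have "0 < x\<^sup>2" if "x \<noteq> 0" using that by simp
    ultimately show ?case by linarith
  qed
  \<comment> \<open>Without the sign the root would behave like \<open>|x|\<close> and have a corner
    at 0; with it the slope there is 1.\<close>
  define m where "m x = sgn x * sqrt (f (x\<^sup>2))" for x
  \<comment> \<open>Off 0 this is the chain rule together with \<open>sgn x * x = |x|\<close>. The
    value 1 at 0 is its limit, since \<open>f (x^2) / x^2\<close> and \<open>f' (x^2)\<close> both
    tend to 1.\<close>
  define m' where "m' x = (if x = 0 then 1 else f' (x\<^sup>2) * \<bar>x\<bar> / sqrt (f (x\<^sup>2)))" for x
  have quot: "((\<lambda>x. f (x\<^sup>2) / x\<^sup>2) \<longlongrightarrow> 1) (at 0)"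
  proof (rule Lim_transform_bound[where g = "\<lambda>x. c * x\<^sup>2" and f = "\<lambda>x. f (x\<^sup>2) / x\<^sup>2 - 1", THEN LIM_zero_cancel])
    show "\<forall>\<^sub>F x in at 0. norm (f (x\<^sup>2) / x\<^sup>2 - 1) \<le> norm (c * x\<^sup>2)"
      unfolding eventually_at_filter using f_sq
    proof eventually_elim
      case (elim x)
      show ?case
      proof
        assume "x \<noteq> 0"
        then have "norm (f (x\<^sup>2) / x\<^sup>2 - 1) = \<bar>f (x\<^sup>2) - x\<^sup>2\<bar> / x\<^sup>2"
          using abs_divide[of "f (x\<^sup>2) - x\<^sup>2" "x\<^sup>2"] by (simp add: diff_divide_distrib)
        also have "\<dots> \<le> c * x ^ 4 / x\<^sup>2" using elim by (intro divide_right_mono) auto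
        also have "\<dots> = norm (c * x\<^sup>2)" using \<open>x \<noteq> 0\<close> \<open>c > 0\<close> by (simp add: power_numeral_reduce abs_mult)
        finally show "x \<in> UNIV \<longrightarrow> norm (f (x\<^sup>2) / x\<^sup>2 - 1) \<le> norm (c * x\<^sup>2)" by simp
      qed
    qed
    show "((\<lambda>x. c * x\<^sup>2) \<longlongrightarrow> 0) (at 0)" by (auto intro!: tendsto_eq_intros)
  qed
  have sqrt_quot: "sqrt (f (x\<^sup>2) / x\<^sup>2) = sqrt (f (x\<^sup>2)) / \<bar>x\<bar>" for x
    by (simp add: real_sqrt_divide)
  have sqrt_lim: "((\<lambda>x. sqrt (f (x\<^sup>2)) / \<bar>x\<bar>) \<longlongrightarrow> 1) (at 0)"
    using tendsto_real_sqrt[OF quot] by (simp add: sqrt_quot)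
  have f'0: "f' 0 = 1"
  proof -
    have "(f has_real_derivative f' 0) (at 0)" using f'(1) by (rule eventually_nhds_x_imp_x)
    then have "((\<lambda>t. f t / t) \<longlongrightarrow> f' 0) (at 0)"
      using \<open>f 0 = 0\<close> by (simp add: has_field_derivative_iff)
    moreover have "filterlim (\<lambda>x::real. x\<^sup>2) (at 0) (at 0)"
      by (rule filterlim_atI) (auto intro!: tendsto_eq_intros simp: eventually_at_filter)
    ultimately have "((\<lambda>x. f (x\<^sup>2) / x\<^sup>2) \<longlongrightarrow> f' 0) (at 0)"
      by (rule filterlim_compose)
    with quot show ?thesis by (intro tendsto_unique[of "at 0"]) auto
  qed
  have f'lim: "((\<lambda>x. f' (x\<^sup>2)) \<longlongrightarrow> 1) (at 0)"
  proof -
    have "isCont f' 0" using f'(2) by (rule eventually_nhds_x_imp_x)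
    then have "(f' \<longlongrightarrow> f' 0) (nhds 0)"
      by (simp add: continuous_at tendsto_at_iff_tendsto_nhds)
    then have "(f' \<longlongrightarrow> 1) (nhds 0)" by (simp add: f'0)
    from filterlim_compose[OF this sq] show ?thesis
      by (rule tendsto_mono[rotated]) (simp add: at_within_def)
  qed
  have C1: "\<forall>\<^sub>F x in nhds 0. (m has_real_derivative m' x) (at x) \<and> isCont m' x"
  proof -
    have at0: "(m has_real_derivative m' 0) (at 0)" "isCont m' 0"
    proof -
      have "((\<lambda>x. (m x - m 0) / x) \<longlongrightarrow> 1) (at 0)"
        using sqrt_lim by (rule Lim_transform_eventually)
          (auto simp: eventually_at_filter m_def sgn_if)
      then show "(m has_real_derivative m' 0) (at 0)"
        by (simp add: has_field_derivative_iff m'_def)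
      have "((\<lambda>x. f' (x\<^sup>2) / (sqrt (f (x\<^sup>2)) / \<bar>x\<bar>)) \<longlongrightarrow> 1 / 1) (at 0)"
        by (rule tendsto_divide[OF f'lim sqrt_lim]) simp
      then have "(m' \<longlongrightarrow> 1 / 1) (at 0)"
        by (rule Lim_transform_eventually) (auto simp: eventually_at_filter m'_def)
      then show "isCont m' 0" by (simp add: isCont_def m'_def)
    qed
    show ?thesis
      using eventually_compose_filterlim[OF f'(1) sq] eventually_compose_filterlim[OF f'(2) sq] pos
        eventually_compose_filterlim[OF C1_at0_eventually_isCont[OF \<open>C1_at0 f\<close>] sq]
    proof eventually_elim
      case (elim x)
      show ?case
      proof (cases "x = 0")
        case False
        then have pos_x: "0 < f (x\<^sup>2)" using elim by simp
        \<comment> \<open>Away from 0 the sign is locally constant and can be frozen while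
          differentiating.\<close>
        have sgn_ev: "\<forall>\<^sub>F y in nhds x. sgn y = sgn x"
        proof (cases "x > 0")
          case True
          then have "\<forall>\<^sub>F y in nhds x. y \<in> {0<..}" by (intro eventually_nhds_in_open) auto
          then show ?thesis by eventually_elim (use True in auto)
        next
          case F: False
          with False have "\<forall>\<^sub>F y in nhds x. y \<in> {..<0}" by (intro eventually_nhds_in_open) auto
          then show ?thesis by eventually_elim (use F False in auto)
        qed
        have "((\<lambda>x::real. x\<^sup>2) has_real_derivative 2 * x) (at x)"
          by (auto intro!: derivative_eq_intros)
        from DERIV_chain2[where g = "\<lambda>x. x\<^sup>2", OF elim(1) this]
        have 1: "((\<lambda>x. f (x\<^sup>2)) has_real_derivative f' (x\<^sup>2) * (2 * x)) (at x)" .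
        have 2: "((\<lambda>x. sqrt (f (x\<^sup>2))) has_real_derivative
            inverse (sqrt (f (x\<^sup>2))) / 2 * (f' (x\<^sup>2) * (2 * x))) (at x)"
          by (rule DERIV_chain2[where f = sqrt and g = "\<lambda>x. f (x\<^sup>2)", OF DERIV_real_sqrt[OF pos_x] 1])
        have "((\<lambda>y. sgn x * sqrt (f (y\<^sup>2))) has_real_derivative
            sgn x * (inverse (sqrt (f (x\<^sup>2))) / 2 * (f' (x\<^sup>2) * (2 * x)))) (at x)"
          by (rule DERIV_cmult[OF 2])
        also have "sgn x * (inverse (sqrt (f (x\<^sup>2))) / 2 * (f' (x\<^sup>2) * (2 * x))) = m' x"
          using False by (auto simp: m'_def sgn_if field_simps)
        finally have "((\<lambda>y. sgn x * sqrt (f (y\<^sup>2))) has_real_derivative m' x) (at x)" .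
        moreover have "\<forall>\<^sub>F y in nhds x. sgn x * sqrt (f (y\<^sup>2)) = m y"
          using sgn_ev by eventually_elim (simp add: m_def)
        ultimately have d: "(m has_real_derivative m' x) (at x)"
          by (subst (asm) DERIV_cong_ev[OF refl _ refl]) 
        have c1: "isCont (\<lambda>x::real. x\<^sup>2) x" by (intro continuous_intros)
        have c2: "isCont (\<lambda>x. f' (x\<^sup>2)) x" by (rule isCont_o2[OF c1 elim(2)])
        have c3: "isCont (\<lambda>x. f (x\<^sup>2)) x" by (rule isCont_o2[OF c1 elim(4)])
        have c4: "isCont (\<lambda>x. sqrt (f (x\<^sup>2))) x" by (rule isCont_o2[OF c3 isCont_real_sqrt])
        have c5: "isCont (\<lambda>x. f' (x\<^sup>2) * \<bar>x\<bar> / sqrt (f (x\<^sup>2))) x"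
          by (intro isCont_divide isCont_mult c2 c4 isCont_rabs continuous_ident) (use pos_x in auto)
        have "\<forall>\<^sub>F y in nhds x. y \<in> -{0}" using False by (intro eventually_nhds_in_open) auto
        then have "\<forall>\<^sub>F y in nhds x. f' (y\<^sup>2) * \<bar>y\<bar> / sqrt (f (y\<^sup>2)) = m' y"
          by eventually_elim (simp add: m'_def)
        with c5 d show ?thesis by (simp add: isCont_cong)
      qed (use at0 in simp)
    qed
  qed
  have "\<forall>\<^sub>F x in nhds 0. (m has_real_derivative m' x) (at x)" "\<forall>\<^sub>F x in nhds 0. isCont m' x"
    using C1 by (auto elim: eventually_mono)
  then obtain s where s: "C1_at0 s" "s 0 = 0" "\<forall>\<^sub>F t in nhds 0. m (s t) = t"
    by (rule C1_at0_local_inverse[of m m']) (auto simp: m_def m'_def)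
  have lim_s: "filterlim s (nhds 0) (nhds 0)"
    using C1_at0_tendsto[OF s(1)] s(2) by simp
  have m_sq: "\<forall>\<^sub>F t in nhds 0. f ((s t)\<^sup>2) = t\<^sup>2 \<and> \<bar>s t - t\<bar> \<le> c * (s t)\<^sup>2"
    using s(3) eventually_compose_filterlim[OF pos lim_s] eventually_compose_filterlim[OF f_sq lim_s]
      eventually_compose_filterlim[OF small lim_s]
  proof eventually_elim
    case (elim t)
    show ?case
    proof (cases "s t = 0")
      case True
      then show ?thesis using elim(1) \<open>f 0 = 0\<close> by (auto simp: m_def)
    next
      case False
      then have p: "0 < f ((s t)\<^sup>2)" using elim by simp
      have "t\<^sup>2 = (m (s t))\<^sup>2" using elim by simp
      also have "\<dots> = f ((s t)\<^sup>2)" using False p by (auto simp: m_def sgn_if power_mult_distrib)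
      finally have sq_eq: "f ((s t)\<^sup>2) = t\<^sup>2" by simp
      have "t = sgn (s t) * sqrt (f ((s t)\<^sup>2))" using elim(1) by (simp add: m_def)
      from arg_cong[OF this, of sgn] have "sgn t = sgn (s t)" using p by (simp add: sgn_mult)
      \<comment> \<open>Equal signs keep \<open>|s t + t|\<close> at least \<open>|s t|\<close>, so
        the error bound for \<open>t^2 - (s t)^2\<close>, a product of difference and sum, can be
        divided by \<open>|s t|\<close>.\<close>
      then have "\<bar>s t\<bar> \<le> \<bar>s t + t\<bar>" using False by (auto simp: sgn_if split: if_splits)
      then have "\<bar>s t - t\<bar> * \<bar>s t\<bar> \<le> \<bar>s t - t\<bar> * \<bar>s t + t\<bar>" by (intro mult_left_mono) auto
      also have "\<dots> = \<bar>t\<^sup>2 - (s t)\<^sup>2\<bar>" by (simp add: power2_eq_square algebra_simps flip: abs_mult)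
      also have "\<dots> \<le> c * (s t) ^ 4" using elim(3) sq_eq by simp
      also have "\<dots> = (c * (s t)\<^sup>2 * \<bar>s t\<bar>) * \<bar>s t\<bar>" by (simp add: power_numeral_reduce)
      finally have "\<bar>s t - t\<bar> \<le> c * (s t)\<^sup>2 * \<bar>s t\<bar>" using False by simp
      also have "\<dots> \<le> c * (s t)\<^sup>2 * 1" using elim(4) \<open>c > 0\<close> by (intro mult_left_mono) auto
      finally show ?thesis using sq_eq by simp
    qed
  qed
  show ?thesis
  proof (rule that[OF s(1,2)])
    show "\<forall>\<^sub>F t in nhds 0. f ((s t)\<^sup>2) = t\<^sup>2" using m_sq by eventually_elim simp
    have "(\<lambda>t. s t - t) \<in> O[nhds 0](\<lambda>t. (s t)\<^sup>2)"
      using m_sq by (intro bigoI[where c = c]) (auto elim: eventually_mono)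
    also have "(\<lambda>t. (s t)\<^sup>2) \<in> O[nhds 0](\<lambda>t. t\<^sup>2)"
      using landau_o.big_power[OF C1_at0_bigo[OF s(1)], of 2] s(2) by simp
    finally show "(\<lambda>t. s t - t) \<in> O[nhds 0](\<lambda>t. t\<^sup>2)" .
  qed
qed

section \<open>Feasible curves, neuron by neuron\<close>

text \<open>The entry \<open>w 0 0\<close> plays the part of the homogenizing variable: the one
  formula gives \<open>W u + u0 b\<close> on the column \<open>(u0, u)\<close> and
  \<open>W v\<close> on a column of \<open>V\<close>, whose zeroth entry is 0.\<close>

definition preact :: "bm_data \<Rightarrow> nat \<Rightarrow> nat \<Rightarrow> (nat \<Rightarrow> nat \<Rightarrow> real) \<Rightarrow> real" where
  "preact D k i w = (\<Sum>j<width D k. weight D k $$ (i, j) * w k j) + bias D k $ i * w 0 0"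

lemma preact_cong: "w k = w' k \<Longrightarrow> w 0 = w' 0 \<Longrightarrow> preact D k i w = preact D k i w'"
  by (simp add: preact_def)

lemma C1_at0_preact:
  "(\<And>k i. C1_at0 (\<lambda>t. w t k i)) \<Longrightarrow> C1_at0 (\<lambda>t. preact D k i (w t))"
  unfolding preact_def by (intro C1_at0_add C1_at0_sum C1_at0_mult C1_at0_const)

text \<open>Here \<open>w\<close> and \<open>a\<close> are the entry of \<open>u\<close> and its
  preactivation, both multiplied by the sign \<open>u0\<close>; \<open>q\<close> and
  \<open>p\<close> are the analogous entries of the columns of \<open>V\<close>, and
  \<open>t * c\<close> is the contribution of the new column. Since \<open>a 0\<close> is nonzero,
  at most one of the bounds \<open>0 \<le> w\<close> and \<open>a \<le> w\<close> is active, and an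
  inactive one stays strict near 0.\<close>

lemma neuron_curve:
  fixes a :: "real \<Rightarrow> real" and p :: "nat \<Rightarrow> real \<Rightarrow> real"
  assumes a: "C1_at0 a" and p: "\<And>j. C1_at0 (p j)"
    and a0: "a 0 \<noteq> 0" and p0: "\<exists>j<n. p j 0 \<noteq> 0"
    and w0: "0 \<le> w0" "a 0 \<le> w0"
    and eq0: "(w0 - a 0) * w0 + (\<Sum>j<n. (q0 j - p j 0) * q0 j) = 0"
  obtains w q where "C1_at0 w" "\<And>j. C1_at0 (q j)" "w 0 = w0" "\<And>j. q j 0 = q0 j"
    "\<forall>\<^sub>F t in nhds 0. (w t - a t) * w t + (\<Sum>j<n. (q j t - p j t) * q j t) + t * c = 0 \<and>
       0 \<le> w t \<and> a t \<le> w t \<and> (w0 = 0 \<longrightarrow> w t = 0) \<and> (w0 = a 0 \<longrightarrow> w t = a t)"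
proof (cases "w0 = 0 \<or> w0 = a 0")
  case True
  \<comment> \<open>Squared radius of the sphere on which the sum of
    \<open>(q j - p j) * q j\<close> vanishes; its centre is \<open>p / 2\<close>.\<close>
  define P where "P t = (\<Sum>j<n. (p j t)\<^sup>2) / 4" for t
  have sq: "(\<Sum>j<n. (x j - p j t) * x j) = (\<Sum>j<n. (x j - p j t / 2)\<^sup>2) - P t" for x t
    unfolding P_def sum_divide_distrib sum_subtractf[symmetric]
    by (intro sum.cong refl) (simp add: power2_eq_square field_simps)
  have "0 < (\<Sum>j<n. (p j 0)\<^sup>2)"
    using p0 by (auto intro!: sum_pos2)
  then have P0: "0 < P 0" by (simp add: P_def)
  have P: "C1_at0 P" unfolding P_def by (intro C1_at0_divide_const C1_at0_sum C1_at0_power p)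
  \<comment> \<open>The sign of \<open>a 0\<close> tells which bound is active:
    \<open>w0 = 0\<close> requires \<open>a 0 \<le> 0\<close>, and \<open>w0 = a 0\<close> requires
    \<open>0 \<le> a 0\<close>.\<close>
  define w where "w = (if a 0 < 0 then (\<lambda>_. 0) else a)"
  have w_zero: "w0 = 0 \<longleftrightarrow> a 0 < 0" using True w0 a0 by auto
  have w_a: "w0 = a 0 \<longleftrightarrow> \<not> a 0 < 0" using True w0 a0 by auto
  \<comment> \<open>The squared distance from the centre has to become \<open>P t - t * c\<close>,
    and it starts at \<open>P 0\<close>; hence the root of the ratio.\<close>
  define q where "q j t = p j t / 2 + (q0 j - p j 0 / 2) * sqrt ((P t - t * c) / P 0)" for j t
  have ratio: "C1_at0 (\<lambda>t. (P t - t * c) / P 0)"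
    by (intro C1_at0_divide_const C1_at0_diff C1_at0_mult C1_at0_ident C1_at0_const P)
  have base: "(\<Sum>j<n. (q0 j - p j 0 / 2)\<^sup>2) = P 0"
    using eq0 True by (auto simp: sq)
  show ?thesis
  proof (rule that[of w q])
    show "C1_at0 w" by (simp add: w_def a C1_at0_const)
    show "C1_at0 (q j)" for j
      unfolding q_def
      by (intro C1_at0_add C1_at0_mult C1_at0_divide_const C1_at0_const C1_at0_sqrt ratio p) (use P0 in simp)
    show "w 0 = w0" using True w0 a0 by (auto simp: w_def)
    show "q j 0 = q0 j" for j using P0 by (simp add: q_def)
    have "\<forall>\<^sub>F t in nhds 0. 0 < (P t - t * c) / P 0"
      by (rule C1_at0_eventually_greater[OF ratio]) (use P0 in simp)
    moreover have "\<forall>\<^sub>F t in nhds 0. a 0 < 0 \<longrightarrow> a t < 0"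
      by (cases "a 0 < 0") (auto intro: eventually_mono[OF C1_at0_eventually_less[OF a]])
    moreover have "\<forall>\<^sub>F t in nhds 0. 0 < a 0 \<longrightarrow> 0 < a t"
      by (cases "0 < a 0") (auto intro: eventually_mono[OF C1_at0_eventually_greater[OF a]])
    ultimately show "\<forall>\<^sub>F t in nhds 0. (w t - a t) * w t + (\<Sum>j<n. (q j t - p j t) * q j t) + t * c = 0 \<and>
       0 \<le> w t \<and> a t \<le> w t \<and> (w0 = 0 \<longrightarrow> w t = 0) \<and> (w0 = a 0 \<longrightarrow> w t = a t)"
    proof eventually_elim
      case (elim t)
      have "(\<Sum>j<n. (q j t - p j t / 2)\<^sup>2) = (\<Sum>j<n. (q0 j - p j 0 / 2)\<^sup>2 * ((P t - t * c) / P 0))"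
        using elim(1) by (intro sum.cong refl) (simp add: q_def power_mult_distrib less_imp_le)
      also have "\<dots> = P t - t * c"
        unfolding sum_distrib_right[symmetric] base using P0 by simp
      finally have "(\<Sum>j<n. (q j t - p j t) * q j t) + t * c = 0" by (simp add: sq)
      moreover have "(w t - a t) * w t = 0" by (simp add: w_def)
      ultimately show ?case using elim a0 by (simp add: w_zero w_a) (auto simp: w_def)
    qed
  qed
next
  case False
  then have w0': "0 < w0" "a 0 < w0" using w0 by auto
  \<comment> \<open>With the row of \<open>V\<close> kept fixed, completing the square turns the
    equality into \<open>(w - a / 2)^2 = E\<close>.\<close>
  define E where "E t = (a t)\<^sup>2 / 4 + (\<Sum>j<n. q0 j * (p j t - q0 j)) - t * c" for t
  have E: "C1_at0 E"
    unfolding E_def by (intro C1_at0_add C1_at0_diff C1_at0_sum C1_at0_mult C1_at0_divide_const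
        C1_at0_power C1_at0_const C1_at0_ident a p)
  have "(\<Sum>j<n. q0 j * (p j 0 - q0 j)) = - (\<Sum>j<n. (q0 j - p j 0) * q0 j)"
    unfolding sum_negf[symmetric] by (intro sum.cong refl) (simp add: algebra_simps)
  then have E0: "E 0 = (w0 - a 0 / 2)\<^sup>2"
    using eq0 by (simp add: E_def power2_eq_square field_simps)
  \<comment> \<open>Both bounds are strict, so the starting value is the larger root and the
    discriminant is positive, where the square root is differentiable.\<close>
  have "w0 - a 0 / 2 > 0" using w0' by linarith
  then have E0_pos: "0 < E 0" and sqrt_E0: "sqrt (E 0) = w0 - a 0 / 2" by (simp_all add: E0)
  define w where "w t = a t / 2 + sqrt (E t)" for t
  have w: "C1_at0 w" unfolding w_def by (intro C1_at0_add C1_at0_divide_const C1_at0_sqrt a E E0_pos)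
  have w_0: "w 0 = w0" by (simp add: w_def sqrt_E0)
  show ?thesis
  proof (rule that[of w "\<lambda>j _. q0 j"])
    have "\<forall>\<^sub>F t in nhds 0. 0 < w t"
      by (rule C1_at0_eventually_greater[OF w]) (use w0' w_0 in simp)
    moreover have "\<forall>\<^sub>F t in nhds 0. 0 < w t - a t"
      by (rule C1_at0_eventually_greater[OF C1_at0_diff[OF w a]]) (use w0' w_0 in simp)
    moreover have "\<forall>\<^sub>F t in nhds 0. 0 < E t"
      by (rule C1_at0_eventually_greater[OF E E0_pos])
    ultimately show "\<forall>\<^sub>F t in nhds 0. (w t - a t) * w t + (\<Sum>j<n. (q0 j - p j t) * q0 j) + t * c = 0 \<and>
       0 \<le> w t \<and> a t \<le> w t \<and> (w0 = 0 \<longrightarrow> w t = 0) \<and> (w0 = a 0 \<longrightarrow> w t = a t)"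
    proof eventually_elim
      case (elim t)
      have "(w t - a t) * w t = (sqrt (E t))\<^sup>2 - (a t)\<^sup>2 / 4"
        by (simp add: w_def power2_eq_square field_simps)
      also have "\<dots> = E t - (a t)\<^sup>2 / 4" using elim by simp
      also have "\<dots> = - (\<Sum>j<n. (q0 j - p j t) * q0 j) - t * c"
        unfolding E_def sum_negf[symmetric] by (simp add: algebra_simps)
      finally show ?case using elim False by simp
    qed
  qed (simp_all add: w w_0 C1_at0_const)
qed

text \<open>\<open>w\<close> is the column \<open>(u\<^sub>0, u)\<close> with \<open>u\<^sub>0 = s\<close>; \<open>e\<close> stands for the contribution of
  further columns, beyond \<open>V 0, \<dots>, V (n - 1)\<close>, to the equality constraint.\<close>

definition feasible_neuron ::
  "bm_data \<Rightarrow> nat \<Rightarrow> real \<Rightarrow> (nat \<Rightarrow> nat \<Rightarrow> real) \<Rightarrow> (nat \<Rightarrow> nat \<Rightarrow> nat \<Rightarrow> real) \<Rightarrow> real \<Rightarrow> nat \<Rightarrow> nat \<Rightarrow> bool" where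
  "feasible_neuron D n s w V e k i \<longleftrightarrow>
     (w (k + 1) i - preact D k i w) * w (k + 1) i
       + (\<Sum>j<n. (V j (k + 1) i - preact D k i (V j)) * V j (k + 1) i) + e = 0 \<and>
     0 \<le> s * w (k + 1) i \<and> s * preact D k i w \<le> s * w (k + 1) i"

text \<open>This is what complementary slackness asks of a moved point: a nonzero multiplier sits
  only on an active bound, and that bound has to remain an equality.\<close>

definition keeps_active ::
  "bm_data \<Rightarrow> (nat \<Rightarrow> nat \<Rightarrow> real) \<Rightarrow> (nat \<Rightarrow> nat \<Rightarrow> real) \<Rightarrow> nat \<Rightarrow> nat \<Rightarrow> bool" where
  "keeps_active D w w' k i \<longleftrightarrow>
     (w (k + 1) i = 0 \<longrightarrow> w' (k + 1) i = 0) \<and>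
     (w (k + 1) i = preact D k i w \<longrightarrow> w' (k + 1) i = preact D k i w')"

lemma feasible_neuron_cong:
  assumes "w k = w' k" "w (k + 1) = w' (k + 1)" "w 0 = w' 0"
    "\<And>j. V j k = V' j k" "\<And>j. V j (k + 1) = V' j (k + 1)" "\<And>j. V j 0 = V' j 0"
  shows "feasible_neuron D n s w V e k i = feasible_neuron D n s w' V' e k i"
  using assms preact_cong[of w k w'] preact_cong[of "V j" k "V' j" for j]
  unfolding feasible_neuron_def by simp

lemma keeps_active_cong:
  assumes "w' k = w'' k" "w' (k + 1) = w'' (k + 1)" "w' 0 = w'' 0"
  shows "keeps_active D w w' k i = keeps_active D w w'' k i"
  using assms preact_cong[of w' k w''] unfolding keeps_active_def by simp

text \<open>Induction over the layers: layer \<open>m + 1\<close> can be repaired once its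
  preactivations, which come from layer \<open>m\<close>, are known as functions of
  \<open>t\<close>. The first layer of \<open>u\<close> stays fixed, so that \<open>g0\<close> is
  governed by the norm of \<open>V 1\<close> alone. Freezing all values outside the layers keeps
  zeroth entries constant and displacements finitely supported.\<close>

lemma network_curve:
  fixes D :: bm_data and U v :: "nat \<Rightarrow> nat \<Rightarrow> real" and V :: "nat \<Rightarrow> nat \<Rightarrow> nat \<Rightarrow> real"
  assumes s: "s * s = 1"
    and nz: "\<And>k i. k \<in> {1..<depth D} \<Longrightarrow> i < width D (k + 1) \<Longrightarrow> preact D k i U \<noteq> 0"
      "\<And>k i. k \<in> {1..<depth D} \<Longrightarrow> i < width D (k + 1) \<Longrightarrow> \<exists>j<n. preact D k i (V j) \<noteq> 0"
    and feas: "\<And>k i. k \<in> {1..<depth D} \<Longrightarrow> i < width D (k + 1) \<Longrightarrow> feasible_neuron D n s U V 0 k i"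
    and V1: "0 < (\<Sum>j<n. \<Sum>i<width D 1. (V j 1 i)\<^sup>2)"
    and "1 \<le> m" "m \<le> depth D"
  shows "\<exists>UU VV. (\<forall>k i. C1_at0 (\<lambda>t. UU t k i)) \<and> (\<forall>j k i. C1_at0 (\<lambda>t. VV t j k i)) \<and>
    UU 0 = U \<and> VV 0 = V \<and>
    (\<forall>t k i. \<not> (k \<in> {1..depth D} \<and> i < width D k) \<longrightarrow> UU t k i = U k i \<and> (\<forall>j. VV t j k i = V j k i)) \<and>
    (\<forall>t. UU t 1 = U 1) \<and>
    (\<forall>\<^sub>F t in nhds 0. (\<Sum>j<n. \<Sum>i<width D 1. (VV t j 1 i)\<^sup>2) + t * (\<Sum>i<width D 1. (v 1 i)\<^sup>2)
        = (\<Sum>j<n. \<Sum>i<width D 1. (V j 1 i)\<^sup>2)) \<and>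
    (\<forall>k\<in>{1..<m}. \<forall>i<width D (k + 1). \<forall>\<^sub>F t in nhds 0.
        feasible_neuron D n s (UU t) (VV t) (t * ((v (k + 1) i - preact D k i v) * v (k + 1) i)) k i \<and>
        keeps_active D U (UU t) k i)"
  using \<open>1 \<le> m\<close> \<open>m \<le> depth D\<close>
proof (induction m rule: nat_induct_at_least)
  case base
  note One_nat_def [simp del]
  define N where "N = (\<Sum>j<n. \<Sum>i<width D 1. (V j 1 i)\<^sup>2)"
  define M where "M = (\<Sum>i<width D 1. (v 1 i)\<^sup>2)"
  \<comment> \<open>Scaling the first layer by \<open>sqrt (1 - t * c)\<close> takes
    \<open>t * c * N = t * M\<close> off its squared norm, which is what the new column
    adds.\<close>
  define c where "c = M / N"
  define VV where "VV t j k i = (if k = 1 \<and> i < width D 1 then sqrt (1 - t * c) * V j 1 i else V j k i)" for t j k i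
  have lin: "C1_at0 (\<lambda>t. 1 - t * c)"
    by (intro C1_at0_diff C1_at0_mult C1_at0_const C1_at0_ident)
  have C1: "C1_at0 (\<lambda>t. VV t j k i)" for j k i
  proof -
    have "(\<lambda>t. VV t j k i) = (if k = 1 \<and> i < width D 1 then (\<lambda>t. sqrt (1 - t * c) * V j 1 i) else (\<lambda>_. V j k i))"
      by (auto simp: VV_def)
    moreover have "C1_at0 (\<lambda>t. sqrt (1 - t * c) * V j 1 i)"
      by (intro C1_at0_mult C1_at0_sqrt lin C1_at0_const) simp
    ultimately show ?thesis by (simp add: C1_at0_const)
  qed
  have sq: "\<forall>\<^sub>F t in nhds 0. (\<Sum>j<n. \<Sum>i<width D 1. (VV t j 1 i)\<^sup>2) + t * M = N"
    using C1_at0_eventually_greater[OF lin, of 0, simplified]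
  proof eventually_elim
    case (elim t)
    have "(\<Sum>j<n. \<Sum>i<width D 1. (VV t j 1 i)\<^sup>2) = (1 - t * c) * N"
      using elim unfolding N_def sum_distrib_left
      by (intro sum.cong refl) (simp add: VV_def power_mult_distrib)
    moreover have "t * M = t * c * N" using V1 by (simp add: c_def N_def)
    ultimately show ?case by (simp add: left_diff_distrib)
  qed
  have "VV 0 = V" by (simp add: VV_def fun_eq_iff)
  moreover have "VV t j k i = V j k i" if "\<not> (k \<in> {1..depth D} \<and> i < width D k)" for t j k i
    using that base by (auto simp: VV_def)
  ultimately show ?case
    using C1 sq unfolding M_def N_def
    by (intro exI[of _ "\<lambda>_. U"] exI[of _ VV]) (simp add: C1_at0_const)
next
  case (Suc m)
  from Suc.IH[OF Suc_leD[OF Suc.prems]] obtain UU VV where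
    UU: "\<forall>k i. C1_at0 (\<lambda>t. UU t k i)" and VV: "\<forall>j k i. C1_at0 (\<lambda>t. VV t j k i)"
    and init: "UU 0 = U" "VV 0 = V"
    and outside: "\<forall>t k i. \<not> (k \<in> {1..depth D} \<and> i < width D k) \<longrightarrow> UU t k i = U k i \<and> (\<forall>j. VV t j k i = V j k i)"
    and first: "\<forall>t. UU t 1 = U 1"
      "\<forall>\<^sub>F t in nhds 0. (\<Sum>j<n. \<Sum>i<width D 1. (VV t j 1 i)\<^sup>2) + t * (\<Sum>i<width D 1. (v 1 i)\<^sup>2)
        = (\<Sum>j<n. \<Sum>i<width D 1. (V j 1 i)\<^sup>2)"
    and prev: "\<forall>k\<in>{1..<m}. \<forall>i<width D (k + 1). \<forall>\<^sub>F t in nhds 0.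
        feasible_neuron D n s (UU t) (VV t) (t * ((v (k + 1) i - preact D k i v) * v (k + 1) i)) k i \<and>
        keeps_active D U (UU t) k i"
    by (elim exE conjE) (rule that)
  note UU = UU[rule_format] and VV = VV[rule_format] and outside = outside[rule_format]
    and first = first(1)[rule_format] first(2) and prev = prev[rule_format]
  have m: "m \<in> {1..<depth D}" using Suc by auto
  let ?c = "\<lambda>i. (v (m + 1) i - preact D m i v) * v (m + 1) i"
  \<comment> \<open>The outcome of \<open>neuron_curve\<close> in the variables multiplied by
    \<open>s\<close>, packaged so that the curves of all neurons of the layer can be chosen at
    once.\<close>
  let ?Q = "\<lambda>i w q. C1_at0 w \<and> (\<forall>j. C1_at0 (q j)) \<and> w 0 = s * U (m + 1) i \<and> (\<forall>j. q j 0 = V j (m + 1) i) \<and>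
    (\<forall>\<^sub>F t in nhds 0. (w t - s * preact D m i (UU t)) * w t
        + (\<Sum>j<n. (q j t - preact D m i (VV t j)) * q j t) + t * ?c i = 0 \<and>
       0 \<le> w t \<and> s * preact D m i (UU t) \<le> w t \<and> (s * U (m + 1) i = 0 \<longrightarrow> w t = 0) \<and>
       (s * U (m + 1) i = s * preact D m i (UU 0) \<longrightarrow> w t = s * preact D m i (UU t)))"
  have "s \<noteq> 0" using s by auto
  have ss: "s * (s * x) = x" for x using s by (simp flip: mult.assoc)
  have scale: "(s * x - s * y) * (s * x) = (x - y) * x" "(s * x - y) * (s * x) = (x - s * y) * x" for x y
  proof -
    have "(s * x - s * y) * (s * x) = (s * s) * ((x - y) * x)" by (simp only: ac_simps left_diff_distrib right_diff_distrib)
    then show "(s * x - s * y) * (s * x) = (x - y) * x" by (simp only: s mult_1)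
    have "(s * x - y) * (s * x) = (s * s) * (x * x) - s * y * x" by (simp only: ac_simps left_diff_distrib right_diff_distrib)
    also have "\<dots> = (x - s * y) * x" by (simp only: s mult_1 left_diff_distrib)
    finally show "(s * x - y) * (s * x) = (x - s * y) * x" .
  qed
  have ex: "\<exists>w q. ?Q i w q" if i: "i < width D (m + 1)" for i
  proof -
    note f = feas[OF m i, unfolded feasible_neuron_def]
    have eq: "(s * U (m + 1) i - s * preact D m i (UU 0)) * (s * U (m + 1) i)
        + (\<Sum>j<n. (V j (m + 1) i - preact D m i (VV 0 j)) * V j (m + 1) i) = 0"
      unfolding init scale(1) using f by simp
    have pre: "C1_at0 (\<lambda>t. s * preact D m i (UU t))" "\<And>j. C1_at0 (\<lambda>t. preact D m i (VV t j))"
      by (intro C1_at0_mult C1_at0_const C1_at0_preact UU VV)+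
    have pre0: "s * preact D m i (UU 0) \<noteq> 0" "\<exists>j<n. preact D m i (VV 0 j) \<noteq> 0"
      using nz[OF m i] \<open>s \<noteq> 0\<close> by (simp_all add: init)
    have ge: "0 \<le> s * U (m + 1) i" "s * preact D m i (UU 0) \<le> s * U (m + 1) i"
      using f by (simp_all add: init)
    show ?thesis
      by (rule neuron_curve[OF pre pre0 ge eq, where c = "?c i"]) blast
  qed
  have "\<forall>i. \<exists>w q. i < width D (m + 1) \<longrightarrow> ?Q i w q" using ex by blast
  then obtain w where "\<forall>i. \<exists>q. i < width D (m + 1) \<longrightarrow> ?Q i (w i) q"
    by (rule choice[THEN exE])
  then obtain q where wq: "\<forall>i. i < width D (m + 1) \<longrightarrow> ?Q i (w i) (q i)"
    by (rule choice[THEN exE])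
  \<comment> \<open>Since \<open>s * s = 1\<close>, the factor \<open>s\<close> undoes the
    normalization used for a single neuron.\<close>
  define UU' where "UU' t k i = (if k = m + 1 \<and> i < width D (m + 1) then s * w i t else UU t k i)" for t k i
  define VV' where "VV' t j k i = (if k = m + 1 \<and> i < width D (m + 1) then q i j t else VV t j k i)" for t j k i
  have old: "UU' t k = UU t k" "VV' t j k = VV t j k" if "k \<noteq> m + 1" for t j k
    using that by (simp_all add: UU'_def VV'_def fun_eq_iff)
  have C1_UU: "\<forall>k i. C1_at0 (\<lambda>t. UU' t k i)"
  proof (intro allI)
    fix k i
    have "(\<lambda>t. UU' t k i) = (if k = m + 1 \<and> i < width D (m + 1) then (\<lambda>t. s * w i t) else (\<lambda>t. UU t k i))"
      by (auto simp: UU'_def)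
    then show "C1_at0 (\<lambda>t. UU' t k i)" using wq UU C1_at0_mult[OF C1_at0_const, of "w i" s] by (auto split: if_splits)
  qed
  have C1_VV: "\<forall>j k i. C1_at0 (\<lambda>t. VV' t j k i)"
  proof (intro allI)
    fix j k i
    have "(\<lambda>t. VV' t j k i) = (if k = m + 1 \<and> i < width D (m + 1) then q i j else (\<lambda>t. VV t j k i))"
      by (auto simp: VV'_def)
    then show "C1_at0 (\<lambda>t. VV' t j k i)" using wq VV by (auto split: if_splits)
  qed
  have at_0: "UU' 0 = U" "VV' 0 = V"
    using wq init s by (auto simp: UU'_def VV'_def fun_eq_iff simp flip: mult.assoc)
  have out: "\<forall>t k i. \<not> (k \<in> {1..depth D} \<and> i < width D k) \<longrightarrow> UU' t k i = U k i \<and> (\<forall>j. VV' t j k i = V j k i)"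
  proof (intro allI impI)
    fix t k i
    assume "\<not> (k \<in> {1..depth D} \<and> i < width D k)"
    then show "UU' t k i = U k i \<and> (\<forall>j. VV' t j k i = V j k i)"
      using outside[of k i t] m by (auto simp: UU'_def VV'_def)
  qed
  have fst1: "\<forall>t. UU' t 1 = U 1" using first(1) old m by simp
  have fst2: "\<forall>\<^sub>F t in nhds 0. (\<Sum>j<n. \<Sum>i<width D 1. (VV' t j 1 i)\<^sup>2) + t * (\<Sum>i<width D 1. (v 1 i)\<^sup>2)
        = (\<Sum>j<n. \<Sum>i<width D 1. (V j 1 i)\<^sup>2)"
    using first(2) old m by simp
  have step: "\<forall>\<^sub>F t in nhds 0.
        feasible_neuron D n s (UU' t) (VV' t) (t * ((v (k + 1) i - preact D k i v) * v (k + 1) i)) k i \<and>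
        keeps_active D U (UU' t) k i"
    if k: "k \<in> {1..<Suc m}" and i: "i < width D (k + 1)" for k i
  proof (cases "k = m")
    case False
    \<comment> \<open>For \<open>k < m\<close> a neuron involves only layers \<open>k\<close> and
      \<open>k + 1\<close>, and neither is overwritten in this step.\<close>
    then have k': "k \<in> {1..<m}" using k by auto
    have "feasible_neuron D n s (UU' t) (VV' t) e k i = feasible_neuron D n s (UU t) (VV t) e k i" for t e
      by (rule feasible_neuron_cong) (use k' old in auto)
    moreover have "keeps_active D U (UU' t) k i = keeps_active D U (UU t) k i" for t
      by (rule keeps_active_cong) (use k' old in auto)
    ultimately show ?thesis using prev[OF k' i] by simp
  next
    case True
    then have i': "i < width D (m + 1)" using i by simp
    have pre: "preact D m i (UU' t) = preact D m i (UU t)" "preact D m i (VV' t j) = preact D m i (VV t j)" for t j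
      using old by (auto intro!: preact_cong)
    from wq i' have "\<forall>\<^sub>F t in nhds 0. (w i t - s * preact D m i (UU t)) * w i t
        + (\<Sum>j<n. (q i j t - preact D m i (VV t j)) * q i j t) + t * ?c i = 0 \<and>
       0 \<le> w i t \<and> s * preact D m i (UU t) \<le> w i t \<and> (s * U (m + 1) i = 0 \<longrightarrow> w i t = 0) \<and>
       (s * U (m + 1) i = s * preact D m i (UU 0) \<longrightarrow> w i t = s * preact D m i (UU t))"
      by blast
    then show ?thesis unfolding True
    proof eventually_elim
      case (elim t)
      have val: "UU' t (m + 1) i = s * w i t" "VV' t j (m + 1) i = q i j t" for j
        using i' by (simp_all add: UU'_def VV'_def)
      have "feasible_neuron D n s (UU' t) (VV' t) (t * ?c i) m i"
        unfolding feasible_neuron_def val pre scale(2) ss using elim by simp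
      moreover have "keeps_active D U (UU' t) m i"
        unfolding keeps_active_def val pre using elim ss[of "preact D m i (UU t)"] by (auto simp: init)
      ultimately show ?case ..
    qed
  qed
  show ?case
    by (rule exI[of _ UU'], rule exI[of _ VV'], intro conjI,
        (rule C1_UU C1_VV at_0 out fst1 fst2)+, intro ballI allI impI step)
qed

section \<open>The Lagrangian as a bilinear form on columns\<close>

definition lin_form :: "((nat \<Rightarrow> nat \<Rightarrow> real) \<Rightarrow> real) \<Rightarrow> bool" where
  "lin_form a \<longleftrightarrow> (\<forall>x y s. a (\<lambda>k i. x k i + s * y k i) = a x + s * a y)"

definition bilin_form :: "((nat \<Rightarrow> nat \<Rightarrow> real) \<Rightarrow> (nat \<Rightarrow> nat \<Rightarrow> real) \<Rightarrow> real) \<Rightarrow> bool" where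
  "bilin_form b \<longleftrightarrow> (\<forall>x. lin_form (b x)) \<and> (\<forall>x. lin_form (\<lambda>d. b d x))"

text \<open>The forms below need not be symmetric, so the derivative of \<open>b x x\<close> in the
  direction \<open>d\<close> is this sum of two terms.\<close>

definition polar ::
  "((nat \<Rightarrow> nat \<Rightarrow> real) \<Rightarrow> (nat \<Rightarrow> nat \<Rightarrow> real) \<Rightarrow> real) \<Rightarrow> (nat \<Rightarrow> nat \<Rightarrow> real) \<Rightarrow> (nat \<Rightarrow> nat \<Rightarrow> real) \<Rightarrow> real" where
  "polar b x d = b x d + b d x"

definition unit_col :: "nat \<Rightarrow> nat \<Rightarrow> nat \<Rightarrow> nat \<Rightarrow> real" where
  "unit_col k i = (\<lambda>k' i'. if k' = k \<and> i' = i then 1 else 0)"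

lemma lin_form_coord: "lin_form (\<lambda>w. w k i)"
  by (simp add: lin_form_def)

lemma lin_form_add: "lin_form a \<Longrightarrow> lin_form b \<Longrightarrow> lin_form (\<lambda>w. a w + b w)"
  by (simp add: lin_form_def algebra_simps)

lemma lin_form_diff: "lin_form a \<Longrightarrow> lin_form b \<Longrightarrow> lin_form (\<lambda>w. a w - b w)"
  by (simp add: lin_form_def algebra_simps)

lemma lin_form_scale: "lin_form a \<Longrightarrow> lin_form (\<lambda>w. c * a w)"
  by (simp add: lin_form_def algebra_simps)

lemma lin_form_scale_right: "lin_form a \<Longrightarrow> lin_form (\<lambda>w. a w * c)"
  by (simp add: lin_form_def algebra_simps)

lemma lin_form_sum: "(\<And>i. i \<in> A \<Longrightarrow> lin_form (a i)) \<Longrightarrow> lin_form (\<lambda>w. \<Sum>i\<in>A. a i w)"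
  by (simp add: lin_form_def sum.distrib sum_distrib_left)

lemma lin_form_at_zero: "lin_form a \<Longrightarrow> a (\<lambda>_ _. 0) = 0"
  unfolding lin_form_def by (drule spec[of _ "\<lambda>_ _. 0"], drule spec[of _ "\<lambda>_ _. 0"], drule spec[of _ 1]) simp

text \<open>Columns are functions on all pairs of naturals, where the unit columns do not span;
  finite support makes the expansion valid.\<close>

lemma lin_form_expand:
  assumes "lin_form a" "finite A" "\<And>k i. (k, i) \<notin> A \<Longrightarrow> d k i = 0"
  shows "a d = (\<Sum>(k, i)\<in>A. d k i * a (unit_col k i))"
  using assms(2,3)
proof (induction A arbitrary: d rule: finite_induct)
  case empty
  then have "d = (\<lambda>_ _. 0)" by (auto simp: fun_eq_iff)
  then show ?case using lin_form_at_zero[OF assms(1)] by simp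
next
  case (insert p A)
  obtain k i where p: "p = (k, i)" by (cases p)
  define e where "e = (\<lambda>k' i'. if (k', i') = p then 0 else d k' i')"
  have d: "d = (\<lambda>k' i'. e k' i' + d k i * unit_col k i k' i')"
    by (auto simp: e_def unit_col_def p fun_eq_iff)
  have "a d = a e + d k i * a (unit_col k i)"
    using assms(1) by (subst d) (simp only: lin_form_def)
  also have "a e = (\<Sum>(k, i)\<in>A. e k i * a (unit_col k i))"
    by (rule insert.IH) (use insert.prems in \<open>auto simp: e_def\<close>)
  also have "\<dots> = (\<Sum>(k, i)\<in>A. d k i * a (unit_col k i))"
    using insert.hyps by (intro sum.cong) (auto simp: e_def)
  finally show ?case using insert.hyps by (simp add: p)
qed

lemma bilin_form_mult: "lin_form a \<Longrightarrow> lin_form b \<Longrightarrow> bilin_form (\<lambda>x d. a x * b d)"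
  by (simp add: bilin_form_def lin_form_scale lin_form_scale_right)

lemma bilin_form_add: "bilin_form a \<Longrightarrow> bilin_form b \<Longrightarrow> bilin_form (\<lambda>x d. a x d + b x d)"
  by (simp add: bilin_form_def lin_form_add)

lemma bilin_form_scale: "bilin_form a \<Longrightarrow> bilin_form (\<lambda>x d. c * a x d)"
  by (simp add: bilin_form_def lin_form_scale)

lemma bilin_form_sum: "(\<And>i. i \<in> A \<Longrightarrow> bilin_form (a i)) \<Longrightarrow> bilin_form (\<lambda>x d. \<Sum>i\<in>A. a i x d)"
  by (simp add: bilin_form_def lin_form_sum)

lemma lin_form_polar: "bilin_form b \<Longrightarrow> lin_form (polar b x)"
  by (simp add: bilin_form_def polar_def[abs_def] lin_form_add)

lemma bilin_form_shift:
  assumes "bilin_form b"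
  shows "b (\<lambda>k i. x k i + s * d k i) (\<lambda>k i. x k i + s * d k i) = b x x + s * polar b x d + s\<^sup>2 * b d d"
  using assms by (simp add: bilin_form_def lin_form_def polar_def power2_eq_square algebra_simps)

lemma lin_form_preact: "lin_form (preact D k i)"
  unfolding preact_def by (intro lin_form_add lin_form_sum lin_form_scale lin_form_coord)

section \<open>Columns of a point, and functions that are quadratic in them\<close>

fun ucol :: "bm_data \<Rightarrow> bm_point \<Rightarrow> nat \<Rightarrow> nat \<Rightarrow> real" where
  "ucol D (u0, u, V) = (\<lambda>k i. if k = 0 then (if i = 0 then u0 else 0)
     else if k \<le> depth D \<and> i < width D k then u k $ i else 0)"

fun vcol :: "bm_data \<Rightarrow> nat \<Rightarrow> bm_point \<Rightarrow> nat \<Rightarrow> nat \<Rightarrow> real" where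
  "vcol D j (u0, u, V) = (\<lambda>k i. if k \<in> {1..depth D} \<and> i < width D k then V k $$ (i, j) else 0)"

text \<open>These are the columns that encode vectors of length \<open>n + 1\<close>, block 0 being
  the scalar one.\<close>

definition col_supported :: "bm_data \<Rightarrow> (nat \<Rightarrow> nat \<Rightarrow> real) \<Rightarrow> bool" where
  "col_supported D d \<longleftrightarrow> (\<forall>k i. d k i \<noteq> 0 \<longrightarrow> k \<le> depth D \<and> i < block_size D k)"

text \<open>The constant and the form do not depend on \<open>r\<close>. This makes a point of
  (BM-r) comparable with one of the lifted problem, which merely has one more summand.\<close>

definition quad_rep ::
  "bm_data \<Rightarrow> (bm_point \<Rightarrow> real) \<Rightarrow> real \<Rightarrow> ((nat \<Rightarrow> nat \<Rightarrow> real) \<Rightarrow> (nat \<Rightarrow> nat \<Rightarrow> real) \<Rightarrow> real) \<Rightarrow> bool" where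
  "quad_rep D F c b \<longleftrightarrow> bilin_form b \<and> (\<forall>r. \<forall>x\<in>bm_points D r.
     F x = c + b (ucol D x) (ucol D x) + (\<Sum>j<r - 1. b (vcol D j x) (vcol D j x)))"

lemma quad_rep_add:
  "quad_rep D F c a \<Longrightarrow> quad_rep D G e b \<Longrightarrow> quad_rep D (\<lambda>x. F x + G x) (c + e) (\<lambda>x d. a x d + b x d)"
  by (auto simp: quad_rep_def bilin_form_add sum.distrib)

lemma quad_rep_scale: "quad_rep D F c a \<Longrightarrow> quad_rep D (\<lambda>x. s * F x) (s * c) (\<lambda>x d. s * a x d)"
  by (auto simp: quad_rep_def bilin_form_scale sum_distrib_left distrib_left)

lemma quad_rep_sum:
  assumes "\<And>i. i \<in> A \<Longrightarrow> quad_rep D (F i) (c i) (a i)"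
  shows "quad_rep D (\<lambda>x. \<Sum>i\<in>A. F i x) (\<Sum>i\<in>A. c i) (\<lambda>x d. \<Sum>i\<in>A. a i x d)"
  unfolding quad_rep_def
proof (intro conjI allI ballI)
  show "bilin_form (\<lambda>x d. \<Sum>i\<in>A. a i x d)"
    using assms by (intro bilin_form_sum) (simp add: quad_rep_def)
  fix r x assume "x \<in> bm_points D r"
  then have "(\<Sum>i\<in>A. F i x)
    = (\<Sum>i\<in>A. c i + a i (ucol D x) (ucol D x) + (\<Sum>j<r - 1. a i (vcol D j x) (vcol D j x)))"
    using assms by (intro sum.cong refl) (auto simp: quad_rep_def)
  then show "(\<Sum>i\<in>A. F i x) = (\<Sum>i\<in>A. c i) + (\<Sum>i\<in>A. a i (ucol D x) (ucol D x)) +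
      (\<Sum>j<r - 1. \<Sum>i\<in>A. a i (vcol D j x) (vcol D j x))"
    by (simp add: sum.distrib) (rule sum.swap)
qed

text \<open>Each function of the problem becomes a product, or a sum of products, of linear forms,
  from which bilinearity is immediate. The forms with a factor \<open>x 0 0\<close> vanish on the
  columns of \<open>V\<close>, as they must for \<open>f\<close>, \<open>g1\<close>,
  \<open>g2\<close> and \<open>h0\<close>; those of \<open>g0\<close> and \<open>hk\<close> lack
  this factor and do see \<open>V\<close>.\<close>

definition obj_form :: "bm_data \<Rightarrow> (nat \<Rightarrow> nat \<Rightarrow> real) \<Rightarrow> (nat \<Rightarrow> nat \<Rightarrow> real) \<Rightarrow> real" where
  "obj_form D x d = x 0 0 * (\<Sum>i<width D (depth D). out_weight D $ i * d (depth D) i)"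

definition g0_form :: "bm_data \<Rightarrow> (nat \<Rightarrow> nat \<Rightarrow> real) \<Rightarrow> (nat \<Rightarrow> nat \<Rightarrow> real) \<Rightarrow> real" where
  "g0_form D x d = (\<Sum>i<width D 1. (x 1 i - center D $ i * x 0 0) * (d 1 i - center D $ i * d 0 0))"

definition g1_form :: "nat \<Rightarrow> nat \<Rightarrow> (nat \<Rightarrow> nat \<Rightarrow> real) \<Rightarrow> (nat \<Rightarrow> nat \<Rightarrow> real) \<Rightarrow> real" where
  "g1_form k i x d = x 0 0 * (- 1 * d (k + 1) i)"

definition g2_form :: "bm_data \<Rightarrow> nat \<Rightarrow> nat \<Rightarrow> (nat \<Rightarrow> nat \<Rightarrow> real) \<Rightarrow> (nat \<Rightarrow> nat \<Rightarrow> real) \<Rightarrow> real" where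
  "g2_form D k i x d = x 0 0 * (preact D k i d - d (k + 1) i)"

definition h0_form :: "(nat \<Rightarrow> nat \<Rightarrow> real) \<Rightarrow> (nat \<Rightarrow> nat \<Rightarrow> real) \<Rightarrow> real" where
  "h0_form x d = x 0 0 * (- 1 * d 0 0)"

definition hk_form :: "bm_data \<Rightarrow> nat \<Rightarrow> nat \<Rightarrow> (nat \<Rightarrow> nat \<Rightarrow> real) \<Rightarrow> (nat \<Rightarrow> nat \<Rightarrow> real) \<Rightarrow> real" where
  "hk_form D k i x d = (x (k + 1) i - preact D k i x) * d (k + 1) i"

lemma vnorm_sq: "(vnorm v)\<^sup>2 = (\<Sum>i<dim_vec v. (v $ i)\<^sup>2)"
  unfolding vnorm_def scalar_prod_def
  by (subst real_sqrt_pow2) (auto intro!: sum_nonneg sum.cong simp: power2_eq_square)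

lemma fnorm_sq: "(fnorm A)\<^sup>2 = (\<Sum>i<dim_row A. \<Sum>j<dim_col A. (A $$ (i, j))\<^sup>2)"
  unfolding fnorm_def by (subst real_sqrt_pow2) (auto intro!: sum_nonneg)

context
  fixes D :: bm_data
  assumes D: "valid_data D"
begin

lemma dims:
  "depth D \<noteq> 0" "out_weight D \<in> carrier_vec (width D (depth D))" "center D \<in> carrier_vec (width D 1)"
  "k \<in> {1..<depth D} \<Longrightarrow> weight D k \<in> carrier_mat (width D (k + 1)) (width D k)"
  "k \<in> {1..<depth D} \<Longrightarrow> bias D k \<in> carrier_vec (width D (k + 1))"
  using D by (auto simp: valid_data_def)

lemma preact_ucol:
  assumes "(u0, u, V) \<in> bm_points D r" "k \<in> {1..<depth D}" "i < width D (k + 1)"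
  shows "preact D k i (ucol D (u0, u, V)) = (weight D k *\<^sub>v u k + u0 \<cdot>\<^sub>v bias D k) $ i"
proof -
  have u: "u k \<in> carrier_vec (width D k)" using assms by (auto simp: bm_points_def)
  show ?thesis
    using assms u dims(4,5)[OF assms(2)]
    by (auto simp: preact_def scalar_prod_def mult.commute lessThan_atLeast0 intro!: sum.cong)
qed

lemma preact_vcol:
  assumes "(u0, u, V) \<in> bm_points D r" "k \<in> {1..<depth D}" "i < width D (k + 1)" "j < r - 1"
  shows "preact D k i (vcol D j (u0, u, V)) = (weight D k * V k) $$ (i, j)"
proof -
  have "V k \<in> carrier_mat (width D k) (r - 1)" using assms by (auto simp: bm_points_def)
  then show ?thesis
    using assms dims(4,5)[OF assms(2)]
    by (auto simp: preact_def scalar_prod_def lessThan_atLeast0 intro!: sum.cong)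
qed

lemma obj_rep: "quad_rep D (obj D) 0 (obj_form D)"
  unfolding quad_rep_def
proof (intro conjI allI ballI)
  show "bilin_form (obj_form D)"
    unfolding obj_form_def by (intro bilin_form_mult lin_form_sum lin_form_scale lin_form_coord)
  fix r x assume x: "x \<in> bm_points D r"
  obtain u0 u V where xeq: "x = (u0, u, V)" by (cases x)
  have "u (depth D) \<in> carrier_vec (width D (depth D))"
    using x dims(1) by (auto simp: xeq bm_points_def)
  then show "obj D x = 0 + obj_form D (ucol D x) (ucol D x) + (\<Sum>j<r - 1. obj_form D (vcol D j x) (vcol D j x))"
    using dims(1) by (auto simp: xeq obj_form_def scalar_prod_def lessThan_atLeast0 intro!: sum.cong)
qed

lemma g0_rep: "quad_rep D (g0 D) (- (radius D)\<^sup>2) (g0_form D)"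
  unfolding quad_rep_def
proof (intro conjI allI ballI)
  show "bilin_form (g0_form D)"
    unfolding g0_form_def
    by (intro bilin_form_sum bilin_form_mult lin_form_diff lin_form_scale lin_form_coord)
  fix r x assume x: "x \<in> bm_points D r"
  obtain u0 u V where xeq: "x = (u0, u, V)" by (cases x)
  have d: "1 \<le> depth D" using dims(1) by simp
  have uV: "u 1 \<in> carrier_vec (width D 1)" "V 1 \<in> carrier_mat (width D 1) (r - 1)"
    using x d by (auto simp: xeq bm_points_def)
  have 1: "(vnorm (u 1 - u0 \<cdot>\<^sub>v center D))\<^sup>2 = g0_form D (ucol D x) (ucol D x)"
    unfolding vnorm_sq g0_form_def xeq using uV dims(3) d
    by (auto simp: power2_eq_square mult.commute intro!: sum.cong)
  have 2: "(fnorm (V 1))\<^sup>2 = (\<Sum>j<r - 1. g0_form D (vcol D j x) (vcol D j x))"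
    unfolding fnorm_sq g0_form_def xeq by (subst sum.swap) (use uV d in \<open>simp add: power2_eq_square\<close>)
  show "g0 D x = - (radius D)\<^sup>2 + g0_form D (ucol D x) (ucol D x) + (\<Sum>j<r - 1. g0_form D (vcol D j x) (vcol D j x))"
    using 1 2 by (simp add: xeq)
qed

lemma g1_rep:
  assumes "k \<in> {1..<depth D}" "i < width D (k + 1)"
  shows "quad_rep D (\<lambda>x. g1 D k x $ i) 0 (g1_form k i)"
  unfolding quad_rep_def
proof (intro conjI allI ballI)
  show "bilin_form (g1_form k i)"
    unfolding g1_form_def by (intro bilin_form_mult lin_form_scale lin_form_coord)
  fix r x assume x: "x \<in> bm_points D r"
  obtain u0 u V where xeq: "x = (u0, u, V)" by (cases x)
  have "u (k + 1) \<in> carrier_vec (width D (k + 1))" using x assms by (auto simp: xeq bm_points_def)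
  then show "g1 D k x $ i = 0 + g1_form k i (ucol D x) (ucol D x) + (\<Sum>j<r - 1. g1_form k i (vcol D j x) (vcol D j x))"
    using assms by (simp add: xeq g1_form_def)
qed

lemma g2_rep:
  assumes "k \<in> {1..<depth D}" "i < width D (k + 1)"
  shows "quad_rep D (\<lambda>x. g2 D k x $ i) 0 (g2_form D k i)"
  unfolding quad_rep_def
proof (intro conjI allI ballI)
  show "bilin_form (g2_form D k i)"
    unfolding g2_form_def by (intro bilin_form_mult lin_form_diff lin_form_preact lin_form_coord)
  fix r x assume x: "x \<in> bm_points D r"
  obtain u0 u V where xeq: "x = (u0, u, V)" by (cases x)
  have "u (k + 1) \<in> carrier_vec (width D (k + 1))" using x assms by (auto simp: xeq bm_points_def)
  then show "g2 D k x $ i = 0 + g2_form D k i (ucol D x) (ucol D x) + (\<Sum>j<r - 1. g2_form D k i (vcol D j x) (vcol D j x))"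
    using assms dims(4,5)[OF assms(1)] preact_ucol[OF x[unfolded xeq] assms]
    by (simp add: xeq g2_form_def)
qed

lemma h0_rep: "quad_rep D h0 1 h0_form"
  unfolding quad_rep_def
proof (intro conjI allI ballI)
  show "bilin_form h0_form"
    unfolding h0_form_def by (intro bilin_form_mult lin_form_scale lin_form_coord)
  fix r x assume x: "x \<in> bm_points D r"
  obtain u0 u V where xeq: "x = (u0, u, V)" by (cases x)
  show "h0 x = 1 + h0_form (ucol D x) (ucol D x) + (\<Sum>j<r - 1. h0_form (vcol D j x) (vcol D j x))"
    by (simp add: xeq h0_form_def power2_eq_square)
qed

lemma hk_rep:
  assumes "k \<in> {1..<depth D}" "i < width D (k + 1)"
  shows "quad_rep D (\<lambda>x. hk D k x $ i) 0 (hk_form D k i)"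
  unfolding quad_rep_def
proof (intro conjI allI ballI)
  show "bilin_form (hk_form D k i)"
    unfolding hk_form_def by (intro bilin_form_mult lin_form_diff lin_form_preact lin_form_coord)
  fix r x assume x: "x \<in> bm_points D r"
  obtain u0 u V where xeq: "x = (u0, u, V)" by (cases x)
  have uV: "u (k + 1) \<in> carrier_vec (width D (k + 1))" "u k \<in> carrier_vec (width D k)"
    "V (k + 1) \<in> carrier_mat (width D (k + 1)) (r - 1)" "V k \<in> carrier_mat (width D k) (r - 1)"
    using x assms by (auto simp: xeq bm_points_def)
  note W = dims(4,5)[OF assms(1)]
  have "hk D k x $ i = (u (k + 1) $ i - (weight D k *\<^sub>v u k + u0 \<cdot>\<^sub>v bias D k) $ i) * u (k + 1) $ i
      + (\<Sum>j<r - 1. (V (k + 1) $$ (i, j) - (weight D k * V k) $$ (i, j)) * V (k + 1) $$ (i, j))"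
    using uV W assms(2)
    by (simp add: xeq diag_of_mat_def outer_def scalar_prod_def lessThan_atLeast0)
  also have "\<dots> = hk_form D k i (ucol D x) (ucol D x) + (\<Sum>j<r - 1. hk_form D k i (vcol D j x) (vcol D j x))"
  proof (intro arg_cong2[where f = "(+)"] sum.cong refl)
    show "(u (k + 1) $ i - (weight D k *\<^sub>v u k + u0 \<cdot>\<^sub>v bias D k) $ i) * u (k + 1) $ i
        = hk_form D k i (ucol D x) (ucol D x)"
      unfolding hk_form_def xeq preact_ucol[OF x[unfolded xeq] assms] using assms by simp
    fix j assume "j \<in> {..<r - 1}"
    then have j: "j < r - 1" by simp
    show "(V (k + 1) $$ (i, j) - (weight D k * V k) $$ (i, j)) * V (k + 1) $$ (i, j)
        = hk_form D k i (vcol D j x) (vcol D j x)"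
      unfolding hk_form_def xeq preact_vcol[OF x[unfolded xeq] assms j] using assms by simp
  qed
  finally show "hk D k x $ i = 0 + hk_form D k i (ucol D x) (ucol D x) + (\<Sum>j<r - 1. hk_form D k i (vcol D j x) (vcol D j x))"
    by simp
qed


text \<open>Columns along which the coordinates of a point vary; a coordinate of \<open>V\<close> belongs to its own column.\<close>

fun coord_col :: "bm_point \<Rightarrow> coord \<Rightarrow> nat \<Rightarrow> nat \<Rightarrow> real" where
  "coord_col x (CV k i j) = vcol D j x"
| "coord_col x _ = ucol D x"

fun coord_unit :: "coord \<Rightarrow> nat \<Rightarrow> nat \<Rightarrow> real" where
  "coord_unit C0 = unit_col 0 0"
| "coord_unit (CU k i) = unit_col k i"
| "coord_unit (CV k i j) = unit_col k i"

text \<open>A coordinate belongs to exactly one column, so a single summand of the representation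
  changes, and by bilinearity the change is an exact quadratic polynomial in
  \<open>s\<close>.\<close>

lemma quad_rep_nudge:
  assumes F: "quad_rep D F c b" and x: "x \<in> bm_points D r" and a: "a \<in> coords D r"
  shows "F (nudge x a s) = F x + s * polar b (coord_col x a) (coord_unit a) + s\<^sup>2 * b (coord_unit a) (coord_unit a)"
proof -
  obtain u0 u V where xeq: "x = (u0, u, V)" by (cases x)
  have b: "bilin_form b" using F by (simp add: quad_rep_def)
  have rep: "F x = c + b (ucol D x) (ucol D x) + (\<Sum>j<r - 1. b (vcol D j x) (vcol D j x))"
    if "x \<in> bm_points D r" for x using F that by (simp add: quad_rep_def)
  have u: "u k \<in> carrier_vec (width D k)" and V: "V k \<in> carrier_mat (width D k) (r - 1)"
    if "k \<in> {1..depth D}" for k using x that by (auto simp: xeq bm_points_def)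
  show ?thesis
  proof (cases a)
    case C0
    have n: "nudge x a s \<in> bm_points D r" using x by (simp add: C0 xeq bm_points_def)
    have "ucol D (nudge x a s) = (\<lambda>k i. ucol D x k i + s * unit_col 0 0 k i)"
      by (auto simp: C0 xeq unit_col_def fun_eq_iff)
    moreover have "vcol D j (nudge x a s) = vcol D j x" for j by (simp add: C0 xeq)
    ultimately show ?thesis
      unfolding rep[OF n] rep[OF x] by (simp add: bilin_form_shift[OF b] C0)
  next
    case (CU k i)
    then have ki: "k \<in> {1..depth D}" "i < width D k" using a by (auto simp: coords_def)
    have "u k + s \<cdot>\<^sub>v unit_vec (dim_vec (u k)) i \<in> carrier_vec (width D k)"
      using u[OF ki(1)] by (intro carrier_vecI) simp
    then have n: "nudge x a s \<in> bm_points D r" using x ki by (auto simp: CU xeq bm_points_def)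
    have "ucol D (nudge x a s) = (\<lambda>k' i'. ucol D x k' i' + s * unit_col k i k' i')"
      using ki u[OF ki(1)] by (auto simp: CU xeq unit_col_def fun_eq_iff)
    moreover have "vcol D j (nudge x a s) = vcol D j x" for j by (simp add: CU xeq)
    ultimately show ?thesis
      unfolding rep[OF n] rep[OF x] by (simp add: bilin_form_shift[OF b] CU)
  next
    case (CV k i j)
    then have ki: "k \<in> {1..depth D}" "i < width D k" "j < r - 1" using a by (auto simp: coords_def)
    have "V k + mat (dim_row (V k)) (dim_col (V k)) (\<lambda>(a, b). if a = i \<and> b = j then s else 0)
        \<in> carrier_mat (width D k) (r - 1)"
      using V[OF ki(1)] by (intro carrier_matI) simp_all
    then have n: "nudge x a s \<in> bm_points D r" using x ki by (auto simp: CV xeq bm_points_def)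
    have u_same: "ucol D (nudge x a s) = ucol D x" by (simp add: CV xeq)
    have same: "vcol D l (nudge x a s) = vcol D l x" if "l < r - 1" "l \<noteq> j" for l
      using ki V[OF ki(1)] that by (auto simp: CV xeq fun_eq_iff)
    have shift: "vcol D j (nudge x a s) = (\<lambda>k' i'. vcol D j x k' i' + s * unit_col k i k' i')"
      using ki V[OF ki(1)] by (auto simp: CV xeq unit_col_def fun_eq_iff)
    have "(\<Sum>l<r - 1. b (vcol D l (nudge x a s)) (vcol D l (nudge x a s)))
      = b (vcol D j (nudge x a s)) (vcol D j (nudge x a s)) + (\<Sum>l\<in>{..<r - 1} - {j}. b (vcol D l x) (vcol D l x))"
      using ki(3) same by (subst sum.remove[of _ j]) (auto intro!: sum.cong)
    moreover have "(\<Sum>l<r - 1. b (vcol D l x) (vcol D l x))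
      = b (vcol D j x) (vcol D j x) + (\<Sum>l\<in>{..<r - 1} - {j}. b (vcol D l x) (vcol D l x))"
      using ki(3) by (subst sum.remove[of _ j]) auto
    ultimately show ?thesis
      unfolding rep[OF n] rep[OF x] u_same shift by (simp add: bilin_form_shift[OF b] CV)
  qed
qed

lemma partial_quad_rep:
  assumes "quad_rep D F c b" "x \<in> bm_points D r" "a \<in> coords D r"
  shows "partial F x a = polar b (coord_col x a) (coord_unit a)"
  unfolding partial_def quad_rep_nudge[OF assms]
  by (rule DERIV_imp_deriv) (auto intro!: derivative_eq_intros)

section \<open>The Lagrangian, its gradient and stationarity\<close>

fun lagrangian :: "ineq_mult \<Rightarrow> eq_mult \<Rightarrow> bm_point \<Rightarrow> real" where
  "lagrangian (y0, y1, y2) (z0, zs) x =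
     obj D x
     + (y0 * g0 D x
        + (\<Sum>k=1..<depth D. \<Sum>i<width D (k + 1). y1 k $ i * g1 D k x $ i + y2 k $ i * g2 D k x $ i))
     + (z0 * h0 x + (\<Sum>k=1..<depth D. \<Sum>i<width D (k + 1). zs k $ i * hk D k x $ i))"

fun lagrangian_form :: "ineq_mult \<Rightarrow> eq_mult \<Rightarrow> (nat \<Rightarrow> nat \<Rightarrow> real) \<Rightarrow> (nat \<Rightarrow> nat \<Rightarrow> real) \<Rightarrow> real" where
  "lagrangian_form (y0, y1, y2) (z0, zs) x d =
     obj_form D x d
     + (y0 * g0_form D x d
        + (\<Sum>k=1..<depth D. \<Sum>i<width D (k + 1). y1 k $ i * g1_form k i x d + y2 k $ i * g2_form D k i x d))
     + (z0 * h0_form x d + (\<Sum>k=1..<depth D. \<Sum>i<width D (k + 1). zs k $ i * hk_form D k i x d))"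

text \<open>The constant, which collects the contributions of \<open>radius\<close> and
  \<open>z0\<close>, is left existential because it cancels in increments.\<close>

lemma lagrangian_rep: "\<exists>c. quad_rep D (lagrangian y z) c (lagrangian_form y z)"
proof -
  obtain y0 y1 y2 z0 zs where yz: "y = (y0, y1, y2)" "z = (z0, zs)" by (metis prod.exhaust)
  have "quad_rep D (\<lambda>x. y1 k $ i * g1 D k x $ i + y2 k $ i * g2 D k x $ i) (y1 k $ i * 0 + y2 k $ i * 0)
      (\<lambda>x d. y1 k $ i * g1_form k i x d + y2 k $ i * g2_form D k i x d)"
    if "k \<in> {1..<depth D}" "i \<in> {..<width D (k + 1)}" for k i
    using that by (intro quad_rep_add quad_rep_scale g1_rep g2_rep) simp_all
  note g = quad_rep_sum[OF quad_rep_sum[OF this]]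
  have "quad_rep D (\<lambda>x. zs k $ i * hk D k x $ i) (zs k $ i * 0) (\<lambda>x d. zs k $ i * hk_form D k i x d)"
    if "k \<in> {1..<depth D}" "i \<in> {..<width D (k + 1)}" for k i
    using that by (intro quad_rep_scale hk_rep) simp_all
  note h = quad_rep_sum[OF quad_rep_sum[OF this]]
  show ?thesis
    unfolding yz lagrangian.simps[abs_def] lagrangian_form.simps[abs_def]
    by (rule exI, rule quad_rep_add[OF quad_rep_add[OF obj_rep quad_rep_add[OF quad_rep_scale[OF g0_rep] g]]
          quad_rep_add[OF quad_rep_scale[OF h0_rep] h]])
qed

lemma grad_lagrangian:
  assumes "x \<in> bm_points D r" "a \<in> coords D r"
  shows "grad_f_gy_hz D y z x a = polar (lagrangian_form y z) (coord_col x a) (coord_unit a)"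
proof -
  obtain y0 y1 y2 z0 zs where yz: "y = (y0, y1, y2)" "z = (z0, zs)" by (metis prod.exhaust)
  note p = partial_quad_rep[OF _ assms]
  have g12: "(\<Sum>k=1..<depth D. \<Sum>i<width D (k + 1).
             partial (\<lambda>x. g1 D k x $ i) x a * y1 k $ i + partial (\<lambda>x. g2 D k x $ i) x a * y2 k $ i)
      = (\<Sum>k=1..<depth D. \<Sum>i<width D (k + 1).
           y1 k $ i * polar (g1_form k i) (coord_col x a) (coord_unit a)
         + y2 k $ i * polar (g2_form D k i) (coord_col x a) (coord_unit a))"
    by (intro sum.cong refl) (simp add: p[OF g1_rep] p[OF g2_rep] mult.commute)
  have h: "(\<Sum>k=1..<depth D. \<Sum>i<width D (k + 1). partial (\<lambda>x. hk D k x $ i) x a * zs k $ i)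
      = (\<Sum>k=1..<depth D. \<Sum>i<width D (k + 1). zs k $ i * polar (hk_form D k i) (coord_col x a) (coord_unit a))"
    by (intro sum.cong refl) (simp add: p[OF hk_rep] mult.commute)
  show ?thesis
    unfolding yz grad_f_gy_hz.simps g12 h p[OF obj_rep] p[OF g0_rep] p[OF h0_rep]
    by (simp add: polar_def sum.distrib algebra_simps)
qed

text \<open>Partial derivatives are the values of a linear form on unit columns, and supported
  columns are finite combinations of these. A column of \<open>V\<close> has no coordinate in block
  0, so for it stationarity is available only in directions with zeroth entry 0.\<close>

lemma stationary:
  assumes x: "x \<in> bm_points D r" and grad: "\<forall>a\<in>coords D r. grad_f_gy_hz D y z x a = 0"
    and d: "col_supported D d"
  shows "polar (lagrangian_form y z) (ucol D x) d = 0"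
    and "d 0 0 = 0 \<Longrightarrow> j < r - 1 \<Longrightarrow> polar (lagrangian_form y z) (vcol D j x) d = 0"
proof -
  have lin: "lin_form (polar (lagrangian_form y z) w)" for w
    using lagrangian_rep[of y z] by (auto simp: quad_rep_def lin_form_polar)
  have z: "polar (lagrangian_form y z) (coord_col x a) (coord_unit a) = 0" if "a \<in> coords D r" for a
    using grad grad_lagrangian[OF x that, of y z] that by simp
  define A where "A = (SIGMA k:{..depth D}. {..<block_size D k})"
  have A: "finite A" "d k i = 0" if "(k, i) \<notin> A" for k i
    using that d by (auto simp: A_def col_supported_def)
  have finA: "finite A" by (simp add: A_def)
  have in_A: "k = 0 \<and> i = 0 \<or> k \<in> {1..depth D} \<and> i < width D k" if "(k, i) \<in> A" for k i
    using that by (auto simp: A_def block_size_def split: if_splits)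
  have "polar (lagrangian_form y z) (ucol D x) (unit_col k i) = 0" if "(k, i) \<in> A" for k i
    using in_A[OF that] z[of C0] z[of "CU k i"] by (auto simp: coords_def)
  then show "polar (lagrangian_form y z) (ucol D x) d = 0"
    by (subst lin_form_expand[OF lin finA A(2)]) (auto intro!: sum.neutral)
  assume d0: "d 0 0 = 0" and j: "j < r - 1"
  have "d k i * polar (lagrangian_form y z) (vcol D j x) (unit_col k i) = 0" if "(k, i) \<in> A" for k i
    using in_A[OF that] d0 j z[of "CV k i j"] by (auto simp: coords_def)
  then show "polar (lagrangian_form y z) (vcol D j x) d = 0"
    by (subst lin_form_expand[OF lin finA A(2)]) (auto intro!: sum.neutral)
qed

end

section \<open>The slack matrix\<close>

lemma sum_lessThan_add_nat: "(\<Sum>i<a + b. f i) = (\<Sum>i<a. f i) + (\<Sum>i<b. f (a + i))" for a b :: nat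
  by (induction b) (simp_all add: add.assoc)

lemma sum_block_start: "(\<Sum>i<block_start d m. f i) = (\<Sum>k<m. \<Sum>i<d k. f (block_start d k + i))"
proof (induction m)
  case 0
  then show ?case by (simp add: block_start_def)
next
  case (Suc m)
  then show ?case by (simp add: block_start_Suc sum_lessThan_add_nat)
qed

lemma block_quadratic_form:
  "block_vec d m v \<bullet> ((c \<cdot>\<^sub>m block_mat d m B) *\<^sub>v block_vec d m v)
    = c * (\<Sum>k<m. \<Sum>l<m. \<Sum>i<d k. \<Sum>j<d l. v k $ i * B k l $$ (i, j) * v l $ j)"
proof -
  let ?n = "block_start d m"
  have "block_vec d m v \<bullet> ((c \<cdot>\<^sub>m block_mat d m B) *\<^sub>v block_vec d m v)
      = (\<Sum>p<?n. \<Sum>q<?n. c * (block_vec d m v $ p * block_mat d m B $$ (p, q) * block_vec d m v $ q))"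
    by (simp add: scalar_prod_def block_vec_def[of d m v] block_mat_def lessThan_atLeast0 sum_distrib_left mult_ac
        row_def)
  also have "\<dots> = (\<Sum>k<m. \<Sum>i<d k. \<Sum>l<m. \<Sum>j<d l. c * (v k $ i * B k l $$ (i, j) * v l $ j))"
    unfolding sum_block_start by (intro sum.cong refl) (simp add: block_vec_index block_mat_index)
  also have "\<dots> = (\<Sum>k<m. \<Sum>l<m. \<Sum>i<d k. \<Sum>j<d l. c * (v k $ i * B k l $$ (i, j) * v l $ j))"
    by (intro sum.cong refl sum.swap)
  finally show ?thesis by (simp add: sum_distrib_left)
qed

text \<open>This is the sparsity pattern of the slack matrix: a full first row and column, and a
  tridiagonal rest. A new last block meets only block 0, its predecessor and itself.\<close>

lemma sum_arrow_tridiagonal: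
  fixes T :: "nat \<Rightarrow> nat \<Rightarrow> real"
  assumes "\<And>k l. 1 \<le> k \<Longrightarrow> k + 1 < l \<Longrightarrow> l \<le> L \<Longrightarrow> T k l = 0 \<and> T l k = 0" "1 \<le> L"
  shows "(\<Sum>k<L + 1. \<Sum>l<L + 1. T k l)
    = T 0 0 + (\<Sum>k=1..L. T 0 k + T k 0 + T k k) + (\<Sum>k=1..<L. T k (k + 1) + T (k + 1) k)"
  using assms(2,1)
proof (induction L rule: nat_induct_at_least)
  case base
  then show ?case by (simp add: numeral_2_eq_2 lessThan_Suc)
next
  case (Suc L)
  have edge: "(\<Sum>k<L + 1. T k (Suc L) + T (Suc L) k)
      = (T 0 (Suc L) + T (Suc L) 0) + (T L (Suc L) + T (Suc L) L)"
  proof -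
    have "(\<Sum>k<L + 1. T k (Suc L) + T (Suc L) k) = (\<Sum>k\<in>{0, L}. T k (Suc L) + T (Suc L) k)"
    proof (rule sum.mono_neutral_right)
      show "\<forall>k\<in>{..<L + 1} - {0, L}. T k (Suc L) + T (Suc L) k = 0"
      proof
        fix k assume "k \<in> {..<L + 1} - {0, L}"
        then show "T k (Suc L) + T (Suc L) k = 0" using Suc.prems[of k "Suc L"] by auto
      qed
    qed auto
    \<comment> \<open>The two surviving indices 0 and \<open>L\<close> are distinct because
      \<open>1 \<le> L\<close>.\<close>
    then show ?thesis using Suc.hyps by simp
  qed
  have IH: "(\<Sum>k<L + 1. \<Sum>l<L + 1. T k l)
    = T 0 0 + (\<Sum>k=1..L. T 0 k + T k 0 + T k k) + (\<Sum>k=1..<L. T k (k + 1) + T (k + 1) k)"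
    using Suc.prems by (intro Suc.IH) auto
  have "(\<Sum>k<Suc L + 1. \<Sum>l<Suc L + 1. T k l)
    = (\<Sum>k<L + 1. \<Sum>l<L + 1. T k l) + (\<Sum>k<L + 1. T k (Suc L) + T (Suc L) k) + T (Suc L) (Suc L)"
    by (simp add: sum.distrib)
  then show ?case unfolding IH edge using Suc.hyps by (simp add: sum.distrib)
qed

text \<open>The quadratic part of a quadratic function is half its Hessian form, and
  \<open>slack_matrix\<close> is half the Hessian of the Lagrangian in \<open>(u0, u)\<close>. The
  proof compares coefficients after reducing both sides to the same sums over layers and neurons.
  \<open>V\<close> is arbitrary, since \<open>ucol\<close> does not read it.\<close>

lemma slack_quadratic_form:
  assumes D: "valid_data D" and mults: "valid_mults D y z"
    and \<xi>: "\<And>k. k \<in> {1..depth D} \<Longrightarrow> \<xi> k \<in> carrier_vec (width D k)"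
  shows "stack D \<xi>0 \<xi> \<bullet> (slack_matrix D y z *\<^sub>v stack D \<xi>0 \<xi>)
    = lagrangian_form D y z (ucol D (\<xi>0, \<xi>, V)) (ucol D (\<xi>0, \<xi>, V))"
proof -
  note One_nat_def [simp del]
  obtain y0 y1 y2 z0 zs where yz: "y = (y0, y1, y2)" "z = (z0, zs)" by (metis prod.exhaust)
  define L where "L = depth D"
  have L: "2 \<le> L" using D by (simp add: valid_data_def L_def)
  note W = dims(4)[OF D, folded L_def] and b = dims(5)[OF D, folded L_def]
  have mu: "y1 k \<in> carrier_vec (width D (k + 1))" "y2 k \<in> carrier_vec (width D (k + 1))"
    "zs k \<in> carrier_vec (width D (k + 1))" if "k \<in> {1..<L}" for k
    using mults that by (auto simp: yz L_def)
  define w where "w = ucol D (\<xi>0, \<xi>, V)"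
  define A where "A k i = (\<Sum>j<width D k. weight D k $$ (i, j) * w k j)" for k i
  have w00: "w 0 0 = \<xi>0" by (simp add: w_def)
  have wk: "\<xi> k $ i = w k i" if "k \<in> {1..L}" "i < width D k" for k i
    using that by (simp add: w_def L_def)
  define v where "v k = (if k = 0 then vec 1 (\<lambda>_. \<xi>0) else \<xi> k)" for k
  define T where "T k l = (\<Sum>i<block_size D k. \<Sum>j<block_size D l.
      v k $ i * slack_block D y z k l $$ (i, j) * v l $ j)" for k l
  have bs: "block_size D 0 = 1" "\<And>k. k \<noteq> 0 \<Longrightarrow> block_size D k = width D k"
    by (simp_all add: block_size_def)
  have lhs: "stack D \<xi>0 \<xi> \<bullet> (slack_matrix D y z *\<^sub>v stack D \<xi>0 \<xi>) = 1 / 2 * (\<Sum>k<L + 1. \<Sum>l<L + 1. T k l)"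
    unfolding stack_def slack_matrix_def block_quadratic_form T_def v_def L_def ..
  have "T k l = 0 \<and> T l k = 0" if "1 \<le> k" "k + 1 < l" "l \<le> L" for k l
    using that by (simp add: T_def bs slack_block_def)
  note arrow = sum_arrow_tridiagonal[of L T, OF this]
  define S where "S k = (\<Sum>i<width D k. slack_s D y z k $ i * w k i)" for k
  have T00: "T 0 0 = slack_s0 D y z * \<xi>0\<^sup>2"
    by (simp add: T_def bs v_def slack_block_def power2_eq_square)
  have s_dim: "dim_vec (slack_s D y z k) = width D k" if "k \<in> {1..L}" for k
  proof (cases "k = 1")
    case True
    then show ?thesis using dims(3)[OF D] by (simp add: yz)
  next
    case False
    then have "k - 1 \<in> {1..<L}" "k - 1 + 1 = k" using that by auto
    then show ?thesis using mu[of "k - 1"] False by (simp add: yz)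
  qed
  have T0k: "T 0 k = \<xi>0 * S k" "T k 0 = \<xi>0 * S k" if k: "k \<in> {1..L}" for k
  proof -
    have k0: "k \<noteq> 0" using k by auto
    show "T 0 k = \<xi>0 * S k"
      unfolding T_def bs(1) bs(2)[OF k0] S_def sum_distrib_left
      using k k0 s_dim[OF k] wk[OF k]
      by (simp add: slack_block_def v_def col_mat_def mat_of_cols_def mult_ac)
    show "T k 0 = \<xi>0 * S k"
      unfolding T_def bs(1) bs(2)[OF k0] S_def sum_distrib_left
      using k k0 s_dim[OF k] wk[OF k]
      by (simp add: slack_block_def v_def col_mat_def mat_of_cols_def mult_ac)
  qed
  have diag_sum: "(\<Sum>i<m. \<Sum>j<m. a i * (if i = j then c j else 0) * a j) = (\<Sum>i<m. c i * (a i)\<^sup>2)"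
    for a c :: "nat \<Rightarrow> real" and m :: nat
  proof (rule sum.cong[OF refl])
    fix i assume i: "i \<in> {..<m}"
    have "(\<Sum>j<m. a i * (if i = j then c j else 0) * a j) = (\<Sum>j<m. if i = j then c j * (a j)\<^sup>2 else 0)"
      by (intro sum.cong refl) (simp add: power2_eq_square)
    then show "(\<Sum>j<m. a i * (if i = j then c j else 0) * a j) = c i * (a i)\<^sup>2" using i by simp
  qed
  have T11: "T 1 1 = 2 * y0 * (\<Sum>i<width D 1. (w 1 i)\<^sup>2)"
  proof -
    have "T 1 1 = (\<Sum>i<width D 1. \<Sum>j<width D 1. w 1 i * (if i = j then 2 * y0 else 0) * w 1 j)"
      unfolding T_def using L wk[of 1]
      by (intro sum.cong) (auto simp: bs slack_block_def v_def yz)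
    then show ?thesis by (simp add: diag_sum sum_distrib_left)
  qed
  have Tkk: "T (k + 1) (k + 1) = 2 * (\<Sum>i<width D (k + 1). zs k $ i * (w (k + 1) i)\<^sup>2)" if k: "k \<in> {1..<L}" for k
  proof -
    have "T (k + 1) (k + 1) = (\<Sum>i<width D (k + 1). \<Sum>j<width D (k + 1).
        w (k + 1) i * (if i = j then 2 * zs k $ j else 0) * w (k + 1) j)"
      unfolding T_def using k wk[of "k + 1"] mu[OF k]
      by (intro sum.cong) (auto simp: bs slack_block_def v_def yz diag_of_vec_def mat_diag_def)
    then show ?thesis unfolding diag_sum by (simp add: sum_distrib_left mult.assoc)
  qed
  have off: "slack_off D y z k $$ (j, i) = - (weight D k $$ (i, j) * zs k $ i)"
    if k: "k \<in> {1..<L}" and "i < width D (k + 1)" "j < width D k" for k i j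
  proof -
    have "(transpose_mat (weight D k) * diag_of_vec (zs k)) $$ (j, i)
      = (\<Sum>l<width D (k + 1). weight D k $$ (l, j) * (if l = i then zs k $ i else 0))"
      using that W[OF k] mu[OF k]
      by (simp add: scalar_prod_def diag_of_vec_def mat_diag_def lessThan_atLeast0)
    also have "\<dots> = (\<Sum>l<width D (k + 1). if l = i then weight D k $$ (l, j) * zs k $ i else 0)"
      by (intro sum.cong refl) simp
    also have "\<dots> = weight D k $$ (i, j) * zs k $ i" using that by simp
    finally show ?thesis using that W[OF k] mu[OF k] by (simp add: yz diag_of_vec_def mat_diag_def)
  qed
  have off_dim: "dim_row (slack_off D y z k) = width D k" "dim_col (slack_off D y z k) = width D (k + 1)"
    if "k \<in> {1..<L}" for k
    using that W[OF that] mu[OF that] by (auto simp: yz diag_of_vec_def mat_diag_def)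
  have Toff: "T k (k + 1) = - (\<Sum>i<width D (k + 1). zs k $ i * A k i * w (k + 1) i)"
    "T (k + 1) k = - (\<Sum>i<width D (k + 1). zs k $ i * A k i * w (k + 1) i)" if k: "k \<in> {1..<L}" for k
  proof -
    have k': "k \<in> {1..L}" "k + 1 \<in> {1..L}" "k \<noteq> 0" using k by auto
    have eq: "(\<Sum>i<width D (k + 1). \<Sum>j<width D k. - (w k j * (weight D k $$ (i, j) * zs k $ i) * w (k + 1) i))
        = - (\<Sum>i<width D (k + 1). zs k $ i * A k i * w (k + 1) i)"
      unfolding sum_negf[symmetric] A_def sum_distrib_left sum_distrib_right
      by (intro sum.cong refl) (simp add: mult_ac sum_negf)
    have "T k (k + 1) = (\<Sum>j<width D k. \<Sum>i<width D (k + 1).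
        - (w k j * (weight D k $$ (i, j) * zs k $ i) * w (k + 1) i))"
      unfolding T_def using k' wk[OF k'(1)] wk[OF k'(2)] off[OF k]
      by (intro sum.cong) (auto simp: bs slack_block_def v_def)
    also have "\<dots> = - (\<Sum>i<width D (k + 1). zs k $ i * A k i * w (k + 1) i)"
      by (subst sum.swap) (rule eq)
    finally show "T k (k + 1) = - (\<Sum>i<width D (k + 1). zs k $ i * A k i * w (k + 1) i)" .
    have "T (k + 1) k = (\<Sum>i<width D (k + 1). \<Sum>j<width D k.
        - (w k j * (weight D k $$ (i, j) * zs k $ i) * w (k + 1) i))"
      unfolding T_def using k' wk[OF k'(1)] wk[OF k'(2)] off[OF k] off_dim[OF k]
      by (intro sum.cong) (auto simp: bs slack_block_def v_def)
    with eq show "T (k + 1) k = - (\<Sum>i<width D (k + 1). zs k $ i * A k i * w (k + 1) i)" by simp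
  qed
  define C where "C = (\<Sum>i<width D 1. center D $ i * w 1 i)"
  define O' where "O' = (\<Sum>i<width D L. out_weight D $ i * w L i)"
  \<comment> \<open>Among the terms with a factor \<open>\<xi>0\<close>, \<open>P k\<close> comes
    from the input layer \<open>k\<close> of the constraints of level \<open>k\<close>, and
    \<open>Q k\<close> from their output layer \<open>k + 1\<close>.\<close>
  define P where "P k = (\<Sum>i<width D (k + 1). y2 k $ i * A k i)" for k
  define Q where "Q k = (\<Sum>i<width D (k + 1). (zs k $ i * bias D k $ i + y1 k $ i + y2 k $ i) * w (k + 1) i)" for k
  have trans: "(\<Sum>j<width D k. (transpose_mat (weight D k) *\<^sub>v y2 k) $ j * w k j) = P k" if k: "k \<in> {1..<L}" for k
  proof -
    have "(\<Sum>j<width D k. (transpose_mat (weight D k) *\<^sub>v y2 k) $ j * w k j)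
        = (\<Sum>j<width D k. \<Sum>i<width D (k + 1). y2 k $ i * (weight D k $$ (i, j) * w k j))"
      using W[OF k] mu[OF k]
      by (intro sum.cong refl) (simp add: scalar_prod_def lessThan_atLeast0 sum_distrib_right sum_distrib_left mult_ac)
    also have "\<dots> = P k" unfolding P_def A_def sum_distrib_left by (rule sum.swap)
    finally show ?thesis .
  qed
  \<comment> \<open>Layer \<open>k\<close> is the output of level \<open>k - 1\<close> and the input
    of level \<open>k\<close>; at the two ends the missing neighbour is replaced by
    \<open>center\<close> and \<open>out_weight\<close>.\<close>
  have S_eq: "S k = (if k = 1 then - 2 * y0 * C else - Q (k - 1)) + (if k < L then P k else O')" if k: "k \<in> {1..L}" for k
  proof (cases "k = 1")
    case True
    then have k1: "1 \<in> {1..<L}" using L by auto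
    have "S 1 = (\<Sum>j<width D 1. (transpose_mat (weight D 1) *\<^sub>v y2 1) $ j * w 1 j - 2 * y0 * (center D $ j * w 1 j))"
      unfolding S_def using W[OF k1] mu[OF k1] dims(3)[OF D]
      by (intro sum.cong refl) (simp add: yz algebra_simps)
    then show ?thesis using True L k1
      by (simp add: sum_subtractf trans[OF k1] C_def sum_distrib_left sum_negf)
  next
    case False
    then have k1: "k - 1 \<in> {1..<L}" and kk: "k - 1 + 1 = k" using k by auto
    let ?V = "if k < L then transpose_mat (weight D k) *\<^sub>v y2 k else out_weight D"
    have dV: "dim_vec ?V = width D k"
      using k W[of k] dims(2)[OF D] by (auto simp: L_def)
    have "S k = (\<Sum>i<width D k. ?V $ i * w k i - (zs (k - 1) $ i * bias D (k - 1) $ i + y1 (k - 1) $ i + y2 (k - 1) $ i) * w k i)"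
      unfolding S_def
    proof (intro sum.cong refl)
      fix i assume "i \<in> {..<width D k}"
      then have i: "i < width D k" by simp
      have "(diag_of_vec (zs (k - 1)) *\<^sub>v bias D (k - 1)) $ i 
          = (\<Sum>j<width D k. (if i = j then zs (k - 1) $ j else 0) * bias D (k - 1) $ j)"
        using i mu[OF k1] b[OF k1] kk
        by (simp add: diag_of_vec_def mat_diag_def scalar_prod_def lessThan_atLeast0)
      also have "\<dots> = (\<Sum>j<width D k. if i = j then zs (k - 1) $ j * bias D (k - 1) $ j else 0)"
        by (intro sum.cong refl) simp
      also have "\<dots> = zs (k - 1) $ i * bias D (k - 1) $ i" using i by simp
      finally have dg: "(diag_of_vec (zs (k - 1)) *\<^sub>v bias D (k - 1)) $ i = zs (k - 1) $ i * bias D (k - 1) $ i" .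
      have "slack_s D y z k = ?V - (diag_of_vec (zs (k - 1)) *\<^sub>v bias D (k - 1) + y1 (k - 1) + y2 (k - 1))"
        using False by (simp add: yz L_def)
      then have "slack_s D y z k $ i = ?V $ i - ((diag_of_vec (zs (k - 1)) *\<^sub>v bias D (k - 1)) $ i + y1 (k - 1) $ i + y2 (k - 1) $ i)"
        using i mu[OF k1] kk by (simp add: diag_of_vec_def mat_diag_def del: index_mult_mat_vec)
      then show "slack_s D y z k $ i * w k i
        = ?V $ i * w k i - (zs (k - 1) $ i * bias D (k - 1) $ i + y1 (k - 1) $ i + y2 (k - 1) $ i) * w k i"
        unfolding dg by (simp add: left_diff_distrib distrib_right)
    qed
    then have "S k = (\<Sum>i<width D k. ?V $ i * w k i) - Q (k - 1)"
      by (simp add: sum_subtractf Q_def kk)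
    moreover have "(\<Sum>i<width D k. ?V $ i * w k i) = (if k < L then P k else O')"
      using trans[of k] k by (auto simp: O'_def)
    ultimately show ?thesis using False by simp
  qed
  \<comment> \<open>Reindexes by output layer, so that \<open>Q (k - 1)\<close> and the diagonal
    blocks run over the same levels as the constraints.\<close>
  have shift: "(\<Sum>k=1..L. f k) = f 1 + (\<Sum>k=1..<L. f (k + 1))" for f :: "nat \<Rightarrow> real"
  proof -
    have "(\<Sum>k=1..L. f k) = f 1 + (\<Sum>k=Suc 1..<Suc L. f k)"
      using L by (simp add: sum.atLeast_Suc_atMost atLeastLessThanSuc_atLeastAtMost)
    then show ?thesis using sum.shift_bounds_Suc_ivl[of f 1 L] by (simp only: Suc_eq_plus1)
  qed
  have top: "(\<Sum>k=1..L. f k) = (\<Sum>k=1..<L. f k) + f L" for f :: "nat \<Rightarrow> real"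
    using L by (simp flip: atLeastLessThanSuc_atLeastAtMost)
  have sumS: "(\<Sum>k=1..L. S k) = - 2 * y0 * C - (\<Sum>k=1..<L. Q k) + (\<Sum>k=1..<L. P k) + O'"
  proof -
    have "(\<Sum>k=1..L. S k) = (\<Sum>k=1..L. if k = 1 then - 2 * y0 * C else - Q (k - 1)) + (\<Sum>k=1..L. if k < L then P k else O')"
      unfolding sum.distrib[symmetric] by (intro sum.cong refl S_eq)
    moreover have "(\<Sum>k=1..L. if k = 1 then - 2 * y0 * C else - Q (k - 1)) = - 2 * y0 * C - (\<Sum>k=1..<L. Q k)"
      unfolding shift by (simp add: sum_negf)
    moreover have "(\<Sum>k=1..L. if k < L then P k else O') = (\<Sum>k=1..<L. P k) + O'"
      unfolding top by simp
    ultimately show ?thesis by simp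
  qed
  have s0: "slack_s0 D y z = 2 * (y0 * (\<Sum>i<width D 1. (center D $ i)\<^sup>2)
      + (\<Sum>k=1..<L. \<Sum>i<width D (k + 1). bias D k $ i * y2 k $ i) - z0)"
  proof -
    have "(\<Sum>k=1..<L. bias D k \<bullet> y2 k) = (\<Sum>k=1..<L. \<Sum>i<width D (k + 1). bias D k $ i * y2 k $ i)"
      by (intro sum.cong refl) (simp add: scalar_prod_def lessThan_atLeast0 carrier_vecD[OF mu(2)])
    then show ?thesis using dims(3)[OF D] by (simp add: yz vnorm_sq L_def)
  qed
  have pre: "preact D k i w = A k i + bias D k $ i * \<xi>0" for k i
    by (simp add: preact_def A_def w00)
  have g0f: "g0_form D w w = (\<Sum>i<width D 1. (w 1 i)\<^sup>2) - 2 * \<xi>0 * C + (\<Sum>i<width D 1. (center D $ i)\<^sup>2) * \<xi>0\<^sup>2"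
    unfolding g0_form_def C_def sum_distrib_left sum_distrib_right sum_subtractf[symmetric] sum.distrib[symmetric]
    by (intro sum.cong refl) (simp add: w00 power2_eq_square algebra_simps)
  \<comment> \<open>The bias enters in two places: with \<open>\<xi>0^2\<close> through
    \<open>g2\<close>, and linearly in \<open>\<xi>0\<close> through \<open>hk\<close>, where
    \<open>Q\<close> contains it.\<close>
  have layers: "(\<Sum>k=1..<L. \<Sum>i<width D (k + 1). y1 k $ i * g1_form k i w w + y2 k $ i * g2_form D k i w w)
      + (\<Sum>k=1..<L. \<Sum>i<width D (k + 1). zs k $ i * hk_form D k i w w)
    = - \<xi>0 * (\<Sum>k=1..<L. Q k) + \<xi>0 * (\<Sum>k=1..<L. P k)
      + \<xi>0\<^sup>2 * (\<Sum>k=1..<L. \<Sum>i<width D (k + 1). bias D k $ i * y2 k $ i)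
      + (\<Sum>k=1..<L. \<Sum>i<width D (k + 1). zs k $ i * (w (k + 1) i)\<^sup>2)
      - (\<Sum>k=1..<L. \<Sum>i<width D (k + 1). zs k $ i * A k i * w (k + 1) i)"
    unfolding P_def Q_def sum_distrib_left sum_subtractf[symmetric] sum.distrib[symmetric]
    by (intro sum.cong refl)
      (simp add: g1_form_def g2_form_def hk_form_def pre w00 power2_eq_square algebra_simps)
  have rhs: "lagrangian_form D y z w w = \<xi>0 * O' + y0 * g0_form D w w - z0 * \<xi>0\<^sup>2
      + ((\<Sum>k=1..<L. \<Sum>i<width D (k + 1). y1 k $ i * g1_form k i w w + y2 k $ i * g2_form D k i w w)
        + (\<Sum>k=1..<L. \<Sum>i<width D (k + 1). zs k $ i * hk_form D k i w w))"
    unfolding yz lagrangian_form.simps[OF D] by (simp add: obj_form_def h0_form_def O'_def w00 power2_eq_square L_def)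
  have "(\<Sum>k<L + 1. \<Sum>l<L + 1. T k l) = T 0 0 + (\<Sum>k=1..L. T 0 k + T k 0 + T k k)
      + (\<Sum>k=1..<L. T k (k + 1) + T (k + 1) k)"
    using arrow L by simp
  also have "(\<Sum>k=1..L. T 0 k + T k 0 + T k k) = (\<Sum>k=1..L. 2 * \<xi>0 * S k) + (\<Sum>k=1..L. T k k)"
    unfolding sum.distrib[symmetric] by (intro sum.cong refl) (simp add: T0k)
  also have "(\<Sum>k=1..L. 2 * \<xi>0 * S k) = 2 * \<xi>0 * (\<Sum>k=1..L. S k)"
    by (simp add: sum_distrib_left)
  also have "(\<Sum>k=1..L. T k k) = 2 * y0 * (\<Sum>i<width D 1. (w 1 i)\<^sup>2)
      + 2 * (\<Sum>k=1..<L. \<Sum>i<width D (k + 1). zs k $ i * (w (k + 1) i)\<^sup>2)"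
    unfolding shift T11 using Tkk by (simp add: sum_distrib_left)
  also have "(\<Sum>k=1..<L. T k (k + 1) + T (k + 1) k)
      = - 2 * (\<Sum>k=1..<L. \<Sum>i<width D (k + 1). zs k $ i * A k i * w (k + 1) i)"
    by (subst sum_distrib_left) (intro sum.cong refl, simp add: Toff)
  \<comment> \<open>Every term carries a factor 2, from a symmetric pair of blocks or from the
    diagonal ones, which cancels the \<open>1 / 2\<close> of \<open>slack_matrix\<close>.\<close>
  finally show ?thesis
    unfolding lhs w_def[symmetric] rhs layers g0f T00 s0 sumS by (simp add: algebra_simps)
qed

section \<open>Second-order expansion along a lifted curve\<close>

lemma lin_form_scaled:
  assumes "lin_form a"
  shows "a (\<lambda>k i. s * x k i) = s * a x"
  using assms[unfolded lin_form_def, rule_format, of "\<lambda>_ _. 0" s x] lin_form_at_zero[OF assms] by simp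

lemma bilin_form_scaled: "bilin_form b \<Longrightarrow> b (\<lambda>k i. s * x k i) (\<lambda>k i. s * x k i) = s\<^sup>2 * b x x"
  using lin_form_scaled[of "b (\<lambda>k i. s * x k i)" s x] lin_form_scaled[of "\<lambda>d. b d x" s x]
  by (simp add: bilin_form_def power2_eq_square)

lemma quad_repD:
  "quad_rep D F c b \<Longrightarrow> x \<in> bm_points D r \<Longrightarrow>
    F x = c + b (ucol D x) (ucol D x) + (\<Sum>j<r - 1. b (vcol D j x) (vcol D j x))"
  by (simp add: quad_rep_def)

lemma bilin_form_expand:
  assumes b: "bilin_form b" and A: "finite A" "\<And>k i. (k, i) \<notin> A \<Longrightarrow> d k i = 0"
  shows "b d d = (\<Sum>p\<in>A. \<Sum>q\<in>A. d (fst p) (snd p) * (d (fst q) (snd q)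
           * b (unit_col (fst p) (snd p)) (unit_col (fst q) (snd q))))"
proof -
  have "b d d = (\<Sum>p\<in>A. d (fst p) (snd p) * b (unit_col (fst p) (snd p)) d)"
    using lin_form_expand[of "\<lambda>x. b x d", OF _ A] b by (simp add: bilin_form_def case_prod_unfold)
  also have "\<dots> = (\<Sum>p\<in>A. d (fst p) (snd p) * (\<Sum>q\<in>A. d (fst q) (snd q)
           * b (unit_col (fst p) (snd p)) (unit_col (fst q) (snd q))))"
    using lin_form_expand[of "b x" for x, OF _ A] b by (simp add: bilin_form_def case_prod_unfold)
  finally show ?thesis by (simp add: sum_distrib_left)
qed

text \<open>A displacement that starts at 0 is \<open>O(t)\<close> in each entry, and finite support
  turns the form into finitely many products of two such entries.\<close>

lemma bilin_form_curve:
  assumes b: "bilin_form b" and A: "finite A" "\<And>t k i. (k, i) \<notin> A \<Longrightarrow> d t k i = 0"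
    and d: "\<And>k i. C1_at0 (\<lambda>t. d t k i)" "\<And>k i. d 0 k i = 0"
  shows "C1_at0 (\<lambda>t. b (d t) (d t))" "(\<lambda>t. b (d t) (d t)) \<in> O[nhds 0](\<lambda>t. t\<^sup>2)"
proof -
  have eq: "(\<lambda>t. b (d t) (d t)) = (\<lambda>t. \<Sum>p\<in>A. \<Sum>q\<in>A. d t (fst p) (snd p) * (d t (fst q) (snd q)
           * b (unit_col (fst p) (snd p)) (unit_col (fst q) (snd q))))"
    using bilin_form_expand[OF b A(1)] A(2) by blast
  show "C1_at0 (\<lambda>t. b (d t) (d t))"
    unfolding eq by (intro C1_at0_sum C1_at0_mult C1_at0_const d)
  have O: "(\<lambda>t. d t k i) \<in> O[nhds 0](\<lambda>t. t)" for k i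
    using C1_at0_bigo[OF d(1)[of k i]] d(2) by simp
  have "(\<lambda>t. d t k i * (d t l j * c)) \<in> O[nhds 0](\<lambda>t. t * t)" for k i l j c
  proof (rule landau_o.big.mult[OF O])
    show "(\<lambda>t. d t l j * c) \<in> O[nhds 0](\<lambda>t. t)"
      by (cases "c = 0") (simp_all add: O)
  qed
  then show "(\<lambda>t. b (d t) (d t)) \<in> O[nhds 0](\<lambda>t. t\<^sup>2)"
    unfolding eq power2_eq_square by (intro big_sum_in_bigo)
qed

section \<open>Landau estimates of norms from entrywise ones\<close>

lemma vnorm_le_sum_abs: "vnorm v \<le> (\<Sum>i<dim_vec v. \<bar>v $ i\<bar>)"
proof -
  have "vnorm v = L2_set (\<lambda>i. v $ i) {..<dim_vec v}"
    by (simp add: vnorm_def scalar_prod_def L2_set_def power2_eq_square lessThan_atLeast0)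
  then show ?thesis using L2_set_le_sum_abs by simp
qed

lemma fnorm_le_sum_abs: "fnorm A \<le> (\<Sum>i<dim_row A. \<Sum>j<dim_col A. \<bar>A $$ (i, j)\<bar>)"
proof -
  have "fnorm A = L2_set (\<lambda>p. A $$ p) ({..<dim_row A} \<times> {..<dim_col A})"
    by (simp add: fnorm_def L2_set_def sum.cartesian_product case_prod_unfold)
  also have "\<dots> \<le> (\<Sum>p\<in>{..<dim_row A} \<times> {..<dim_col A}. \<bar>A $$ p\<bar>)"
    by (rule L2_set_le_sum_abs)
  also have "\<dots> = (\<Sum>i<dim_row A. \<Sum>j<dim_col A. \<bar>A $$ (i, j)\<bar>)"
    by (simp add: sum.cartesian_product case_prod_unfold)
  finally show ?thesis .
qed

lemma vnorm_bigo:
  assumes "\<And>t. dim_vec (v t) = n" "\<And>i. i < n \<Longrightarrow> (\<lambda>t. v t $ i) \<in> O[F](g)"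
  shows "(\<lambda>t. vnorm (v t)) \<in> O[F](g)"
proof -
  have "vnorm x \<ge> 0" for x by (simp add: vnorm_def scalar_prod_def sum_nonneg)
  then have "(\<lambda>t. vnorm (v t)) \<in> O[F](\<lambda>t. \<Sum>i<n. \<bar>v t $ i\<bar>)"
    using vnorm_le_sum_abs[of "v t" for t] assms(1)
    by (intro landau_o.bigI[where c = 1]) (auto intro!: always_eventually simp: sum_nonneg)
  also have "(\<lambda>t. \<Sum>i<n. \<bar>v t $ i\<bar>) \<in> O[F](g)"
    using assms(2) by (intro big_sum_in_bigo) simp
  finally show ?thesis .
qed

lemma fnorm_bigo:
  assumes "\<And>t. A t \<in> carrier_mat n m" "\<And>i j. i < n \<Longrightarrow> j < m \<Longrightarrow> (\<lambda>t. A t $$ (i, j)) \<in> O[F](g)"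
  shows "(\<lambda>t. fnorm (A t)) \<in> O[F](g)"
proof -
  have "fnorm x \<ge> 0" for x by (simp add: fnorm_def sum_nonneg)
  moreover have "dim_row (A t) = n" "dim_col (A t) = m" for t using assms(1)[of t] by auto
  ultimately have "(\<lambda>t. fnorm (A t)) \<in> O[F](\<lambda>t. \<Sum>i<n. \<Sum>j<m. \<bar>A t $$ (i, j)\<bar>)"
    using fnorm_le_sum_abs[of "A t" for t]
    by (intro landau_o.bigI[where c = 1]) (auto intro!: always_eventually simp: sum_nonneg)
  also have "(\<lambda>t. \<Sum>i<n. \<Sum>j<m. \<bar>A t $$ (i, j)\<bar>) \<in> O[F](g)"
    using assms(2) by (intro big_sum_in_bigo) simp
  finally show ?thesis .
qed

text \<open>Lets the neighbourhoods on which the single coordinates of the path are differentiable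
  be intersected.\<close>

lemma finite_coords: "finite (coords D r)"
proof -
  let ?A = "SIGMA k:{1..depth D}. {..<width D k}"
  have "coords D r \<subseteq> {C0} \<union> (\<lambda>p. CU (fst p) (snd p)) ` ?A
      \<union> (\<lambda>p. CV (fst (fst p)) (snd (fst p)) (snd p)) ` (?A \<times> {..<r - 1})"
  proof
    fix c assume c: "c \<in> coords D r"
    show "c \<in> {C0} \<union> (\<lambda>p. CU (fst p) (snd p)) ` ?A
      \<union> (\<lambda>p. CV (fst (fst p)) (snd (fst p)) (snd p)) ` (?A \<times> {..<r - 1})"
    proof (cases c)
      case (CU k i)
      then have "(k, i) \<in> ?A" using c by (auto simp: coords_def)
      from imageI[OF this, of "\<lambda>p. CU (fst p) (snd p)"] show ?thesis by (simp add: CU)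
    next
      case (CV k i j)
      then have "((k, i), j) \<in> ?A \<times> {..<r - 1}" using c by (auto simp: coords_def)
      from imageI[OF this, of "\<lambda>p. CV (fst (fst p)) (snd (fst p)) (snd p)"] show ?thesis by (simp add: CV)
    qed simp
  qed
  then show ?thesis by (rule finite_subset) auto
qed

section \<open>The added column, and points assembled from columns\<close>

lemma feasible_neuron_last_column:
  "feasible_neuron D (Suc n) s w V e k i =
   feasible_neuron D n s w V (e + (V n (k + 1) i - preact D k i (V n)) * V n (k + 1) i) k i"
  by (simp add: feasible_neuron_def add_ac)

lemma feasible_neuron_cong_columns:
  "(\<And>j. j < n \<Longrightarrow> V j = V' j) \<Longrightarrow> feasible_neuron D n s w V e k i = feasible_neuron D n s w V' e k i"
  by (simp add: feasible_neuron_def)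

text \<open>Inverse to \<open>ucol\<close> and \<open>vcol\<close> on supported columns with the
  right zeroth entries; it allows a curve to be built column by column.\<close>

definition col_point ::
  "bm_data \<Rightarrow> nat \<Rightarrow> real \<Rightarrow> (nat \<Rightarrow> nat \<Rightarrow> real) \<Rightarrow> (nat \<Rightarrow> nat \<Rightarrow> nat \<Rightarrow> real) \<Rightarrow> bm_point" where
  "col_point D r u0 U V =
     (u0, \<lambda>k. vec (width D k) (U k), \<lambda>k. mat (width D k) (r - 1) (\<lambda>(i, j). V j k i))"

lemma col_point_in_bm_points: "col_point D r u0 U V \<in> bm_points D r"
  by (simp add: col_point_def bm_points_def)

lemma ucol_col_point: "col_supported D U \<Longrightarrow> U 0 0 = u0 \<Longrightarrow> ucol D (col_point D r u0 U V) = U"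
  by (fastforce simp: col_point_def col_supported_def block_size_def fun_eq_iff)

lemma vcol_col_point:
  assumes V: "col_supported D (V j)" "V j 0 0 = 0" and "j < r - 1"
  shows "vcol D j (col_point D r u0 U V) = V j"
proof (intro ext)
  fix k i
  show "vcol D j (col_point D r u0 U V) k i = V j k i"
  proof (cases "k \<in> {1..depth D} \<and> i < width D k")
    case True
    then show ?thesis using \<open>j < r - 1\<close> by (simp add: col_point_def)
  next
    case False
    have "V j k i = 0"
    proof (rule ccontr)
      assume nz: "V j k i \<noteq> 0"
      then have "k \<le> depth D" "i < block_size D k" using V(1) unfolding col_supported_def by blast+
      then have "k = 0" "i = 0" using False by (auto simp: block_size_def split: if_splits)
      then show False using nz V(2) by simp
    qed
    with False show ?thesis by (auto simp: col_point_def)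
  qed
qed

lemma ucol_supported: "col_supported D (ucol D x)"
  by (cases x) (auto simp: col_supported_def block_size_def)

lemma vcol_supported: "col_supported D (vcol D j x)" and vcol_0: "vcol D j x 0 i = 0"
  by (cases x; auto simp: col_supported_def block_size_def)+

lemma col_supported_shift:
  "col_supported D x \<Longrightarrow> col_supported D d \<Longrightarrow> col_supported D (\<lambda>k i. x k i - s * d k i)"
  unfolding col_supported_def by (metis diff_0_right mult_zero_right)

section \<open>Feasibility and the Lagrangian in terms of columns\<close>

context
  fixes D :: bm_data
  assumes D: "valid_data D"
begin

lemma bilin_lagrangian_form: "bilin_form (lagrangian_form D y z)"
  using lagrangian_rep[OF D, of y z] by (auto simp: quad_rep_def)

text \<open>The zeroth entry of each column of \<open>V\<close> is 0, which removes these columns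
  from the two inequalities but not from the equality.\<close>

lemma constraint_columns:
  assumes x: "(u0, u, V) \<in> bm_points D r" and ki: "k \<in> {1..<depth D}" "i < width D (k + 1)"
  shows "g1 D k (u0, u, V) $ i = - (u0 * ucol D (u0, u, V) (k + 1) i)"
    and "g2 D k (u0, u, V) $ i = u0 * (preact D k i (ucol D (u0, u, V)) - ucol D (u0, u, V) (k + 1) i)"
    and "hk D k (u0, u, V) $ i = (ucol D (u0, u, V) (k + 1) i - preact D k i (ucol D (u0, u, V))) * ucol D (u0, u, V) (k + 1) i
       + (\<Sum>j<r - 1. (vcol D j (u0, u, V) (k + 1) i - preact D k i (vcol D j (u0, u, V))) * vcol D j (u0, u, V) (k + 1) i)"
proof -
  let ?x = "(u0, u, V)"
  have u00: "ucol D ?x 0 0 = u0" by simp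
  note simps [simp del] = g1.simps g2.simps hk.simps ucol.simps vcol.simps
  show "g1 D k ?x $ i = - (u0 * ucol D ?x (k + 1) i)"
    using quad_repD[OF g1_rep[OF D ki] x] unfolding g1_form_def vcol_0 u00 by simp
  show "g2 D k ?x $ i = u0 * (preact D k i (ucol D ?x) - ucol D ?x (k + 1) i)"
    using quad_repD[OF g2_rep[OF D ki] x] unfolding g2_form_def vcol_0 u00 by simp
  show "hk D k ?x $ i = (ucol D ?x (k + 1) i - preact D k i (ucol D ?x)) * ucol D ?x (k + 1) i
       + (\<Sum>j<r - 1. (vcol D j ?x (k + 1) i - preact D k i (vcol D j ?x)) * vcol D j ?x (k + 1) i)"
    using quad_repD[OF hk_rep[OF D ki] x] unfolding hk_form_def by simp
qed

lemma feasible_iff: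
  assumes x: "(u0, u, V) \<in> bm_points D r"
  shows "feasible D (u0, u, V) \<longleftrightarrow> g0 D (u0, u, V) \<le> 0 \<and> u0 * u0 = 1 \<and>
    (\<forall>k\<in>{1..<depth D}. \<forall>i<width D (k + 1).
       feasible_neuron D (r - 1) u0 (ucol D (u0, u, V)) (\<lambda>j. vcol D j (u0, u, V)) 0 k i)"
proof -
  let ?x = "(u0, u, V)"
  have layer: "g1 D k ?x \<le> 0\<^sub>v (width D (k + 1)) \<and> g2 D k ?x \<le> 0\<^sub>v (width D (k + 1)) \<and> hk D k ?x = 0\<^sub>v (width D (k + 1))
    \<longleftrightarrow> (\<forall>i<width D (k + 1). feasible_neuron D (r - 1) u0 (ucol D ?x) (\<lambda>j. vcol D j ?x) 0 k i)"
    if k: "k \<in> {1..<depth D}" for k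
  proof -
    have uV: "u (k + 1) \<in> carrier_vec (width D (k + 1))" "V (k + 1) \<in> carrier_mat (width D (k + 1)) (r - 1)"
      using x k by (auto simp: bm_points_def)
    \<comment> \<open>Order and equality of vectors compare dimensions as well, so these are settled
      first.\<close>
    have d: "dim_vec (g1 D k ?x) = width D (k + 1)" "dim_vec (g2 D k ?x) = width D (k + 1)"
      "dim_vec (hk D k ?x) = width D (k + 1)"
      using uV dims(4,5)[OF D k] by (auto simp: diag_of_mat_def)
    have h: "hk D k ?x = 0\<^sub>v (width D (k + 1)) \<longleftrightarrow> (\<forall>i<width D (k + 1). hk D k ?x $ i = 0)"
      using d(3) by (metis eq_vecI index_zero_vec)
    have le: "g1 D k ?x \<le> 0\<^sub>v (width D (k + 1)) \<longleftrightarrow> (\<forall>i<width D (k + 1). g1 D k ?x $ i \<le> 0)"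
      "g2 D k ?x \<le> 0\<^sub>v (width D (k + 1)) \<longleftrightarrow> (\<forall>i<width D (k + 1). g2 D k ?x $ i \<le> 0)"
      using d by (auto simp: less_eq_vec_def)
    have "g1 D k ?x $ i \<le> 0 \<and> g2 D k ?x $ i \<le> 0 \<and> hk D k ?x $ i = 0
      \<longleftrightarrow> feasible_neuron D (r - 1) u0 (ucol D ?x) (\<lambda>j. vcol D j ?x) 0 k i" if "i < width D (k + 1)" for i
      unfolding constraint_columns[OF x k that] feasible_neuron_def right_diff_distrib by auto
    then show ?thesis unfolding h le by blast
  qed
  have "h0 ?x = 0 \<longleftrightarrow> u0 * u0 = 1" by (auto simp: power2_eq_square)
  with layer show ?thesis unfolding feasible_def by blast
qed

text \<open>Applied at the given point and along the curve with the same multipliers, it turns the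
  change of the objective into a change of the Lagrangian, where stationarity can act.\<close>

lemma lagrangian_eq_obj:
  assumes "feasible D x" "compl_slack D y x"
  shows "lagrangian D y z x = obj D x"
proof -
  obtain y0 y1 y2 z0 zs where yz: "y = (y0, y1, y2)" "z = (z0, zs)" by (metis prod.exhaust)
  have g: "(\<Sum>k=1..<depth D. \<Sum>i<width D (k + 1). y1 k $ i * g1 D k x $ i + y2 k $ i * g2 D k x $ i) = 0"
  proof (intro sum.neutral ballI)
    fix k i assume "k \<in> {1..<depth D}" "i \<in> {..<width D (k + 1)}"
    then have "y1 k $ i * g1 D k x $ i = 0" "y2 k $ i * g2 D k x $ i = 0"
      using assms(2) unfolding yz compl_slack.simps by blast+
    then show "y1 k $ i * g1 D k x $ i + y2 k $ i * g2 D k x $ i = 0" by (simp only: add.right_neutral)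
  qed
  have h: "(\<Sum>k=1..<depth D. \<Sum>i<width D (k + 1). zs k $ i * hk D k x $ i) = 0"
    using assms(1) unfolding feasible_def by (intro sum.neutral ballI) simp
  show ?thesis
    unfolding yz lagrangian.simps[OF D] g h using assms by (simp add: yz feasible_def)
qed

text \<open>There is no Taylor remainder, because the Lagrangian is quadratic in the columns.
  Stationarity annihilates the polar terms of the old columns, and the new column grows from 0, so
  it has none.\<close>

lemma lagrangian_increment:
  assumes x: "x \<in> bm_points D r" and x': "x' \<in> bm_points D (r + 1)" and r: "1 \<le> r"
    and grad: "\<forall>a\<in>coords D r. grad_f_gy_hz D y z x a = 0"
    and last: "vcol D (r - 1) x' = (\<lambda>k i. s * v k i)"
  defines "Q \<equiv> \<lambda>d. lagrangian_form D y z d d"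
  shows "lagrangian D y z x' = lagrangian D y z x + Q (\<lambda>k i. ucol D x' k i - ucol D x k i)
    + (\<Sum>j<r - 1. Q (\<lambda>k i. vcol D j x' k i - vcol D j x k i)) + s\<^sup>2 * Q v"
proof -
  note b = bilin_lagrangian_form[of y z]
  obtain c where c: "quad_rep D (lagrangian D y z) c (lagrangian_form D y z)"
    using lagrangian_rep[OF D] by blast
  have rep: "lagrangian D y z x = c + Q (ucol D x) + (\<Sum>j<r - 1. Q (vcol D j x))" if "x \<in> bm_points D r" for x r
    using c that unfolding quad_rep_def Q_def by auto
  have shift: "Q a' = Q a + Q (\<lambda>k i. a' k i - a k i)"
    if "polar (lagrangian_form D y z) a (\<lambda>k i. a' k i - a k i) = 0" for a a'
    using bilin_form_shift[OF b, of a 1 "\<lambda>k i. a' k i - a k i"] that by (simp add: Q_def)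
  note stat = stationary[OF D x grad]
  have "col_supported D (\<lambda>k i. ucol D x' k i - ucol D x k i)"
    using col_supported_shift[OF ucol_supported ucol_supported, of D x' 1 x] by simp
  then have U: "Q (ucol D x') = Q (ucol D x) + Q (\<lambda>k i. ucol D x' k i - ucol D x k i)"
    by (intro shift stat(1))
  have V: "Q (vcol D j x') = Q (vcol D j x) + Q (\<lambda>k i. vcol D j x' k i - vcol D j x k i)" if "j < r - 1" for j
  proof (rule shift, rule stat(2)[OF _ _ that])
    show "col_supported D (\<lambda>k i. vcol D j x' k i - vcol D j x k i)"
      using col_supported_shift[OF vcol_supported vcol_supported, of D j x' 1 j x] by simp
  qed (simp add: vcol_0)
  \<comment> \<open>The lifted problem has columns \<open>0, ..., r - 1\<close>, the last of which
    is new.\<close>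
  have cols: "(\<Sum>j<r + 1 - 1. Q (vcol D j x')) = (\<Sum>j<r - 1. Q (vcol D j x')) + Q (vcol D (r - 1) x')"
    using r by (cases r) simp_all
  have old: "(\<Sum>j<r - 1. Q (vcol D j x'))
      = (\<Sum>j<r - 1. Q (vcol D j x)) + (\<Sum>j<r - 1. Q (\<lambda>k i. vcol D j x' k i - vcol D j x k i))"
    unfolding sum.distrib[symmetric] by (intro sum.cong refl V) simp
  have new: "Q (vcol D (r - 1) x') = s\<^sup>2 * Q v"
    unfolding last Q_def by (rule bilin_form_scaled[OF b])
  show ?thesis
    using rep[OF x] rep[OF x'] U cols old new by linarith
qed

text \<open>Stationarity at \<open>(u0, u)\<close>, tested with \<open>d\<close> and with
  \<open>(u0, u)\<close> itself, removes every term but the one quadratic in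
  \<open>d\<close>.\<close>

lemma escape_direction_value:
  assumes x: "x \<in> bm_points D r" and grad: "\<forall>a\<in>coords D r. grad_f_gy_hz D y z x a = 0"
    and d: "col_supported D d"
  shows "lagrangian_form D y z (\<lambda>k i. c * ucol D x k i - d k i) (\<lambda>k i. c * ucol D x k i - d k i)
    = lagrangian_form D y z d d"
proof -
  note b = bilin_lagrangian_form[of y z]
  note stat = stationary(1)[OF D x grad]
  have "polar (lagrangian_form D y z) d (ucol D x) = 0"
    using stat[OF d] by (simp add: polar_def add.commute)
  moreover have "lagrangian_form D y z (ucol D x) (ucol D x) = 0"
    using stat[OF ucol_supported, of x] by (simp add: polar_def)
  moreover define e where "e = (\<lambda>k i. d k i + - c * ucol D x k i)"
  ultimately have e: "lagrangian_form D y z e e = lagrangian_form D y z d d"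
    using bilin_form_shift[OF b, of d "- c" "ucol D x"] by simp
  have "(\<lambda>k i. c * ucol D x k i - d k i) = (\<lambda>k i. - 1 * e k i)"
    by (simp add: e_def fun_eq_iff)
  then show ?thesis using bilin_form_scaled[OF b, of "- 1" e] e by simp
qed

lemma row_nonzero_preact:
  assumes x: "(u0, u, V) \<in> bm_points D r" and ki: "k \<in> {1..<depth D}" "i < width D (k + 1)"
    and row: "row (weight D k * V k) i \<noteq> 0\<^sub>v (r - 1)"
  shows "\<exists>j<r - 1. preact D k i (vcol D j (u0, u, V)) \<noteq> 0"
proof (rule ccontr)
  assume "\<not> ?thesis"
  then have zero: "(weight D k * V k) $$ (i, j) = 0" if "j < r - 1" for j
    using preact_vcol[OF D x ki that] that by simp
  have V: "V k \<in> carrier_mat (width D k) (r - 1)" using x ki by (auto simp: bm_points_def)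
  have "row (weight D k * V k) i = 0\<^sub>v (r - 1)"
  proof (rule eq_vecI)
    fix j assume "j < dim_vec (0\<^sub>v (r - 1) :: real vec)"
    then show "row (weight D k * V k) i $ j = 0\<^sub>v (r - 1) $ j"
      using zero[of j] V dims(4)[OF D ki(1)] ki by (simp add: row_def del: index_mult_mat(1))
  qed (use V in simp)
  with row show False by simp
qed

end

section \<open>The escape path\<close>

text \<open>The curve is delivered as germs of columns together with the reparametrization
  \<open>s\<close>. Its properties are asserted only near 0, since each of the finitely many neurons
  comes with its own neighbourhood.\<close>

lemma escape_curve:
  fixes D :: bm_data and r :: nat and u0 :: real and u :: "nat \<Rightarrow> real vec" and V :: "nat \<Rightarrow> real mat"
    and v :: "nat \<Rightarrow> nat \<Rightarrow> real"
  assumes D: "valid_data D" and r: "1 \<le> r"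
    and x: "(u0, u, V) \<in> bm_points D r" and feas: "feasible D (u0, u, V)"
    and grad: "\<forall>a\<in>coords D r. grad_f_gy_hz D y z (u0, u, V) a = 0"
    and slack: "compl_slack D y (u0, u, V)"
    and pre: "\<And>k i. k \<in> {1..<depth D} \<Longrightarrow> i < width D (k + 1) \<Longrightarrow>
           (weight D k *\<^sub>v u k + u0 \<cdot>\<^sub>v bias D k) $ i \<noteq> 0"
    and rows: "\<And>k i. k \<in> {1..<depth D} \<Longrightarrow> i < width D (k + 1) \<Longrightarrow>
           row (weight D k * V k) i \<noteq> 0\<^sub>v (r - 1)"
    and v: "col_supported D v" "v 0 0 = 0"
    and \<gamma>: "lagrangian_form D y z v v = - \<gamma>" "0 < \<gamma>"
  obtains s UU VV where "C1_at0 s" "s 0 = 0" "(\<lambda>t. s t - t) \<in> O[nhds 0](\<lambda>t. t\<^sup>2)"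
    "\<And>k i. C1_at0 (\<lambda>t. UU t k i)" "\<And>j k i. C1_at0 (\<lambda>t. VV t j k i)"
    "UU 0 = ucol D (u0, u, V)" "VV 0 = (\<lambda>j. vcol D j (u0, u, V))"
    "\<forall>\<^sub>F t in nhds 0.
       let x' = col_point D (r + 1) u0 (UU ((s t)\<^sup>2)) (\<lambda>j. if j < r - 1 then VV ((s t)\<^sup>2) j else (\<lambda>k i. s t * v k i))
       in feasible D x' \<and> obj D x' = obj D (u0, u, V) - t\<^sup>2 * \<gamma>"
proof -
  note simps [simp del] = One_nat_def ucol.simps vcol.simps obj.simps g0.simps g1.simps g2.simps hk.simps
  define x0 where "x0 = (u0, u, V)"
  define U where "U = ucol D x0"
  define VC where "VC j = vcol D j x0" for j
  have U00: "U 0 0 = u0" by (simp add: U_def x0_def ucol.simps)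
  have VC00: "VC j 0 0 = 0" for j by (simp add: VC_def vcol_0)
  note x = x[folded x0_def] and grad = grad[folded x0_def]
  have neuron: "feasible_neuron D (r - 1) u0 U VC 0 k i" if "k \<in> {1..<depth D}" "i < width D (k + 1)" for k i
    using feasible_iff[OF D x[unfolded x0_def]] feas that unfolding U_def VC_def x0_def by blast
  have u0: "u0 * u0 = 1" and g0_le: "g0 D x0 \<le> 0"
    using feasible_iff[OF D x[unfolded x0_def]] feas unfolding x0_def by blast+
  have nz1: "preact D k i U \<noteq> 0" if "k \<in> {1..<depth D}" "i < width D (k + 1)" for k i
    unfolding U_def x0_def preact_ucol[OF D x[unfolded x0_def] that] by (rule pre[OF that])
  have nz2: "\<exists>j<r - 1. preact D k i (VC j) \<noteq> 0" if "k \<in> {1..<depth D}" "i < width D (k + 1)" for k i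
    unfolding VC_def x0_def by (rule row_nonzero_preact[OF D x[unfolded x0_def] that rows[OF that]])
  have depth2: "2 \<le> depth D" and width_pos: "k \<in> {1..depth D} \<Longrightarrow> 0 < width D k" for k
    using D by (auto simp: valid_data_def)
  \<comment> \<open>If \<open>V 1\<close> were zero, all preactivations of the columns of
    \<open>V\<close> in layer 2 would vanish; \<open>depth\<close> at least 2 provides a neuron
    there that contradicts this.\<close>
  have V1: "0 < (\<Sum>j<r - 1. \<Sum>i<width D 1. (VC j 1 i)\<^sup>2)"
  proof -
    have "1 \<in> {1..<depth D}" "0 < width D (1 + 1)" using depth2 width_pos[of "1 + 1"] by auto
    from nz2[OF this] obtain j where j: "j < r - 1" "preact D 1 0 (VC j) \<noteq> 0" by blast
    have "\<exists>i<width D 1. VC j 1 i \<noteq> 0"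
    proof (rule ccontr)
      assume "\<not> ?thesis"
      then show False using j(2) by (simp add: preact_def VC00)
    qed
    then obtain i where "i < width D 1" "VC j 1 i \<noteq> 0" by blast
    then have pos: "0 < (\<Sum>i<width D 1. (VC j 1 i)\<^sup>2)" by (intro sum_pos2[where i = i]) auto
    show ?thesis by (rule sum_pos2[where i = j]) (use pos j(1) in \<open>auto intro: sum_nonneg\<close>)
  qed
  have "1 \<le> depth D" using depth2 by simp
  obtain UU VV where
    UU: "\<forall>k i. C1_at0 (\<lambda>t. UU t k i)" and VV: "\<forall>j k i. C1_at0 (\<lambda>t. VV t j k i)"
    and init: "UU 0 = U" "VV 0 = VC"
    and outside: "\<forall>t k i. \<not> (k \<in> {1..depth D} \<and> i < width D k) \<longrightarrow> UU t k i = U k i \<and> (\<forall>j. VV t j k i = VC j k i)"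
    and first: "\<forall>t. UU t 1 = U 1"
      "\<forall>\<^sub>F t in nhds 0. (\<Sum>j<r - 1. \<Sum>i<width D 1. (VV t j 1 i)\<^sup>2) + t * (\<Sum>i<width D 1. (v 1 i)\<^sup>2)
        = (\<Sum>j<r - 1. \<Sum>i<width D 1. (VC j 1 i)\<^sup>2)"
    and layers: "\<forall>k\<in>{1..<depth D}. \<forall>i<width D (k + 1). \<forall>\<^sub>F t in nhds 0.
        feasible_neuron D (r - 1) u0 (UU t) (VV t) (t * ((v (k + 1) i - preact D k i v) * v (k + 1) i)) k i \<and>
        keeps_active D U (UU t) k i"
    by (rule exE[OF network_curve[OF u0 nz1 nz2 neuron V1 \<open>1 \<le> depth D\<close> order_refl, of v]])
      (assumption+, elim exE conjE, rule that)
  note UU = UU[rule_format] and VV = VV[rule_format] and outside = outside[rule_format]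
    and first = first(1)[rule_format] first(2)
  have layers_ev: "\<forall>\<^sub>F t in nhds 0. \<forall>k\<in>{1..<depth D}. \<forall>i\<in>{..<width D (k + 1)}.
        feasible_neuron D (r - 1) u0 (UU t) (VV t) (t * ((v (k + 1) i - preact D k i v) * v (k + 1) i)) k i \<and>
        keeps_active D U (UU t) k i"
    using layers by (intro eventually_ball_finite ballI finite_atLeastLessThan finite_lessThan) simp
  have U_sup: "col_supported D U" and VC_sup: "col_supported D (VC j)" for j
    by (simp_all add: U_def VC_def ucol_supported vcol_supported)
  \<comment> \<open>A finite index set that supports all displacements of columns.\<close>
  define A where "A = (SIGMA k:{..depth D}. {..<block_size D k})"
  have finA: "finite A" by (simp add: A_def)
  have notA: "\<not> (k \<in> {1..depth D} \<and> i < width D k)" if "(k, i) \<notin> A" for k i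
    using that by (auto simp: A_def block_size_def split: if_splits)
  have sup: "col_supported D w"
    if "col_supported D w0" "\<And>k i. \<not> (k \<in> {1..depth D} \<and> i < width D k) \<Longrightarrow> w k i = w0 k i" for w w0
    unfolding col_supported_def
  proof (intro allI impI)
    fix k i
    assume nz: "w k i \<noteq> 0"
    show "k \<le> depth D \<and> i < block_size D k"
    proof (cases "k \<in> {1..depth D} \<and> i < width D k")
      case False
      then show ?thesis using nz that(1) that(2)[OF False] unfolding col_supported_def by simp
    qed (simp add: block_size_def)
  qed
  have UU_sup: "col_supported D (UU t)" and VV_sup: "col_supported D (VV t j)" for t j
    using sup[OF U_sup, of "UU t"] sup[OF VC_sup, of "VV t j" j] outside by blast+
  have zero00: "\<not> (0 \<in> {1..depth D} \<and> 0 < width D 0)" by simp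
  have UU00: "UU t 0 0 = u0" and VV00: "VV t j 0 0 = 0" for t j
    using outside[OF zero00, of t] U00 VC00 by simp_all
  define Q where "Q d = lagrangian_form D y z d d" for d
  \<comment> \<open>The part of the Lagrangian increment that is due to moving the old
    columns.\<close>
  define Rm where "Rm t = Q (\<lambda>k i. UU t k i - U k i) + (\<Sum>j<r - 1. Q (\<lambda>k i. VV t j k i - VC j k i))" for t
  note bil = bilin_lagrangian_form[OF D, of y z]
  have QU: "C1_at0 (\<lambda>t. Q (\<lambda>k i. UU t k i - U k i))" "(\<lambda>t. Q (\<lambda>k i. UU t k i - U k i)) \<in> O[nhds 0](\<lambda>t. t\<^sup>2)"
    unfolding Q_def
    by (rule bilin_form_curve[OF bil finA];
        use outside[OF notA] in \<open>simp add: init C1_at0_diff[OF UU C1_at0_const]\<close>)+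
  have QV: "C1_at0 (\<lambda>t. Q (\<lambda>k i. VV t j k i - VC j k i))" "(\<lambda>t. Q (\<lambda>k i. VV t j k i - VC j k i)) \<in> O[nhds 0](\<lambda>t. t\<^sup>2)" for j
    unfolding Q_def
    by (rule bilin_form_curve[OF bil finA];
        use outside[OF notA] in \<open>simp add: init C1_at0_diff[OF VV C1_at0_const]\<close>)+
  have R_C1: "C1_at0 Rm" unfolding Rm_def by (intro C1_at0_add C1_at0_sum QU QV)
  have R_O: "Rm \<in> O[nhds 0](\<lambda>t. t\<^sup>2)"
    unfolding Rm_def by (intro sum_in_bigo big_sum_in_bigo QU QV)
  have Q0: "Q (\<lambda>_ _. 0) = 0"
    using lin_form_at_zero[of "lagrangian_form D y z (\<lambda>_ _. 0)"] bil by (simp add: Q_def bilin_form_def)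
  have R0: "Rm 0 = 0" by (simp add: Rm_def init Q0)
  \<comment> \<open>Chosen so that the objective drops by \<open>\<gamma> * f (a^2)\<close> when the
    new column has coefficient \<open>a\<close>.\<close>
  define f where "f t = t - Rm t / \<gamma>" for t
  have "C1_at0 f" unfolding f_def by (intro C1_at0_diff C1_at0_ident C1_at0_divide_const R_C1)
  moreover have "f 0 = 0" by (simp add: f_def R0)
  moreover have "(\<lambda>t. f t - t) \<in> O[nhds 0](\<lambda>t. t\<^sup>2)"
    using R_O \<gamma>(2) by (simp add: f_def)
  ultimately obtain s where s: "C1_at0 s" "s 0 = 0" "\<forall>\<^sub>F t in nhds 0. f ((s t)\<^sup>2) = t\<^sup>2"
    "(\<lambda>t. s t - t) \<in> O[nhds 0](\<lambda>t. t\<^sup>2)"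
    by (rule C1_at0_sqrt_reparametrization)
  have lim: "filterlim (\<lambda>t. (s t)\<^sup>2) (nhds 0) (nhds 0)"
    using C1_at0_tendsto[OF C1_at0_power[OF s(1), of 2]] s(2) by simp
  \<comment> \<open>A statement about one fixed \<open>a\<close>, with the two eventual properties
    as premises; limits return only when \<open>a\<close> is replaced by \<open>s t\<close>.\<close>
  have main: "feasible D x' \<and> obj D x' = obj D x0 - \<gamma> * f (a\<^sup>2)"
    if x'_def: "x' = col_point D (r + 1) u0 (UU (a\<^sup>2)) (\<lambda>j. if j < r - 1 then VV (a\<^sup>2) j else (\<lambda>k i. a * v k i))"
      and fst_layer: "(\<Sum>j<r - 1. \<Sum>i<width D 1. (VV (a\<^sup>2) j 1 i)\<^sup>2) + a\<^sup>2 * (\<Sum>i<width D 1. (v 1 i)\<^sup>2)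
        = (\<Sum>j<r - 1. \<Sum>i<width D 1. (VC j 1 i)\<^sup>2)"
      and lay: "\<forall>k\<in>{1..<depth D}. \<forall>i\<in>{..<width D (k + 1)}.
        feasible_neuron D (r - 1) u0 (UU (a\<^sup>2)) (VV (a\<^sup>2)) (a\<^sup>2 * ((v (k + 1) i - preact D k i v) * v (k + 1) i)) k i \<and>
        keeps_active D U (UU (a\<^sup>2)) k i" for x' a
  proof -
    let ?W = "\<lambda>j. if j < r - 1 then VV (a\<^sup>2) j else (\<lambda>k i. a * v k i)"
    have x': "x' \<in> bm_points D (r + 1)" unfolding x'_def by (rule col_point_in_bm_points)
    obtain u' V' where tup: "x' = (u0, u', V')" by (simp add: x'_def col_point_def)
    have ux': "ucol D x' = UU (a\<^sup>2)"
      unfolding x'_def by (rule ucol_col_point[OF UU_sup UU00])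
    have av: "col_supported D (\<lambda>k i. a * v k i)" using v(1) unfolding col_supported_def by (metis mult_zero_right)
    have vx': "vcol D j x' = ?W j" if "j < r" for j
      unfolding x'_def by (rule vcol_col_point) (use that VV_sup av VV00 v(2) in auto)
    have vx'1: "vcol D j x' = VV (a\<^sup>2) j" if "j < r - 1" for j using vx'[of j] that by simp
    have vx'2: "vcol D (r - 1) x' = (\<lambda>k i. a * v k i)" using vx'[of "r - 1"] r by simp
    have r_split: "(\<Sum>j<r + 1 - 1. F j) = (\<Sum>j<r - 1. F j) + F (r - 1)" for F :: "nat \<Rightarrow> real"
    proof -
      have "r + 1 - 1 = Suc (r - 1)" using r by simp
      then show ?thesis by (simp only: sum.lessThan_Suc)
    qed
    have g0_col: "g0_form D w w = (\<Sum>i<width D 1. (w 1 i)\<^sup>2)" if "w 0 0 = 0" for w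
      using that by (simp add: g0_form_def power2_eq_square)
    \<comment> \<open>Neither \<open>u0\<close> nor the first layer of \<open>u\<close> moves, and
      the shrinking of \<open>V 1\<close> pays for the new column.\<close>
    have g0_same: "g0 D x' = g0 D x0"
    proof -
      have a_sq: "(\<Sum>i<width D 1. (a * v 1 i)\<^sup>2) = a\<^sup>2 * (\<Sum>i<width D 1. (v 1 i)\<^sup>2)"
        by (simp add: power_mult_distrib sum_distrib_left)
      have "g0 D x' = - (radius D)\<^sup>2 + g0_form D (UU (a\<^sup>2)) (UU (a\<^sup>2))
          + ((\<Sum>j<r - 1. \<Sum>i<width D 1. (VV (a\<^sup>2) j 1 i)\<^sup>2) + a\<^sup>2 * (\<Sum>i<width D 1. (v 1 i)\<^sup>2))"
        unfolding quad_repD[OF g0_rep[OF D] x'] r_split ux' vx'2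
        by (simp add: vx'1 g0_col VV00 v(2) a_sq)
      also have "g0_form D (UU (a\<^sup>2)) (UU (a\<^sup>2)) = g0_form D U U"
        by (simp add: g0_form_def first UU00 U00)
      also have "- (radius D)\<^sup>2 + g0_form D U U
          + ((\<Sum>j<r - 1. \<Sum>i<width D 1. (VV (a\<^sup>2) j 1 i)\<^sup>2) + a\<^sup>2 * (\<Sum>i<width D 1. (v 1 i)\<^sup>2)) = g0 D x0"
        unfolding fst_layer quad_repD[OF g0_rep[OF D] x] U_def[symmetric] VC_def[symmetric]
        by (simp add: g0_col VC00)
      finally show ?thesis .
    qed
    have pre_scaled: "preact D k i (\<lambda>k i. a * v k i) = a * preact D k i v" for k i
      by (rule lin_form_scaled[OF lin_form_preact])
    have neuron': "feasible_neuron D (r + 1 - 1) u0 (ucol D x') (\<lambda>j. vcol D j x') 0 k i"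
      if k: "k \<in> {1..<depth D}" and i: "i < width D (k + 1)" for k i
    proof -
      have "feasible_neuron D (Suc (r - 1)) u0 (UU (a\<^sup>2)) (\<lambda>j. vcol D j x') 0 k i
        = feasible_neuron D (r - 1) u0 (UU (a\<^sup>2)) (\<lambda>j. vcol D j x')
            (0 + (a * v (k + 1) i - a * preact D k i v) * (a * v (k + 1) i)) k i"
        unfolding feasible_neuron_last_column vx'2 pre_scaled ..
      also have "0 + (a * v (k + 1) i - a * preact D k i v) * (a * v (k + 1) i)
          = a\<^sup>2 * ((v (k + 1) i - preact D k i v) * v (k + 1) i)"
        by (simp add: power2_eq_square algebra_simps)
      also have "feasible_neuron D (r - 1) u0 (UU (a\<^sup>2)) (\<lambda>j. vcol D j x')
            (a\<^sup>2 * ((v (k + 1) i - preact D k i v) * v (k + 1) i)) k i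
        = feasible_neuron D (r - 1) u0 (UU (a\<^sup>2)) (VV (a\<^sup>2))
            (a\<^sup>2 * ((v (k + 1) i - preact D k i v) * v (k + 1) i)) k i"
        by (rule feasible_neuron_cong_columns) (rule vx'1)
      finally have "feasible_neuron D (Suc (r - 1)) u0 (UU (a\<^sup>2)) (\<lambda>j. vcol D j x') 0 k i"
        using lay k i by blast
      then show ?thesis using r by (simp add: ux')
    qed
    have feas': "feasible D x'"
      using feasible_iff[OF D x'[unfolded tup]] g0_le g0_same u0 neuron' unfolding tup by simp
    have slack': "compl_slack D y x'"
    proof -
      obtain y0 y1 y2 where y: "y = (y0, y1, y2)" by (cases y)
      have "y1 k $ i * g1 D k x' $ i = 0 \<and> y2 k $ i * g2 D k x' $ i = 0"
        if k: "k \<in> {1..<depth D}" and i: "i < width D (k + 1)" for k i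
      proof -
        \<comment> \<open>Each product vanishes through its multiplier or through an active
          constraint; in the second case the moved constraint is active again, since
          \<open>u0\<close> is nonzero.\<close>
        have old: "y1 k $ i = 0 \<or> g1 D k x0 $ i = 0" "y2 k $ i = 0 \<or> g2 D k x0 $ i = 0"
          using slack k i unfolding y compl_slack.simps x0_def[symmetric] mult_eq_0_iff by blast+
        note c = constraint_columns[OF D x[unfolded x0_def] k i, folded x0_def, folded U_def]
        note c' = constraint_columns[OF D x'[unfolded tup] k i, folded tup, unfolded ux']
        have "u0 \<noteq> 0" using u0 by auto
        have act: "keeps_active D U (UU (a\<^sup>2)) k i" using lay k i by blast
        show ?thesis
          using old act \<open>u0 \<noteq> 0\<close> unfolding c c' keeps_active_def by auto
      qed
      then show ?thesis using slack g0_same unfolding y compl_slack.simps x0_def[symmetric] by simp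
    qed
    have "obj D x' = lagrangian D y z x'" using lagrangian_eq_obj[OF D feas' slack'] by simp
    also have "\<dots> = lagrangian D y z x0 + Rm (a\<^sup>2) + a\<^sup>2 * Q v"
      unfolding lagrangian_increment[OF D x x' r grad vx'2] Rm_def Q_def
      by (simp add: ux' vx'1 U_def VC_def)
    also have "lagrangian D y z x0 = obj D x0"
      using lagrangian_eq_obj[OF D feas slack] by (simp add: x0_def)
    also have "obj D x0 + Rm (a\<^sup>2) + a\<^sup>2 * Q v = obj D x0 - \<gamma> * f (a\<^sup>2)"
      using \<gamma> by (simp add: f_def Q_def field_simps)
    finally show ?thesis using feas' by blast
  qed
  have "\<forall>\<^sub>F t in nhds 0.
       let x' = col_point D (r + 1) u0 (UU ((s t)\<^sup>2)) (\<lambda>j. if j < r - 1 then VV ((s t)\<^sup>2) j else (\<lambda>k i. s t * v k i))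
       in feasible D x' \<and> obj D x' = obj D (u0, u, V) - t\<^sup>2 * \<gamma>"
    using eventually_compose_filterlim[OF first(2) lim] eventually_compose_filterlim[OF layers_ev lim] s(3)
  proof eventually_elim
    case (elim t)
    show ?case using main[OF refl elim(1,2)] elim(3) by (simp add: Let_def x0_def mult.commute)
  qed
  then show ?thesis
    by (rule that[OF s(1,2,4) UU VV init[unfolded U_def VC_def[abs_def] x0_def]])
qed


theorem theorem4p4:
  fixes D :: bm_data and r :: nat and R :: real
    and u0 :: real and u :: "nat \<Rightarrow> real vec" and V :: "nat \<Rightarrow> real mat"
    and y :: ineq_mult and z :: eq_mult
    and \<gamma> :: real and \<xi>0 :: real and \<xi> :: "nat \<Rightarrow> real vec"
  assumes "valid_data D" and "1 \<le> r" and "0 < R"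
    and "cert_first_order_opt D r (u0, u, V) y z"
    and "\<gamma> = - lambda_min (slack_matrix D y z)" and "0 < \<gamma>"
    and "pnorm D (u0, u, V) < R"
    and "\<And>k i. k \<in> {1..<depth D} \<Longrightarrow> i < width D (k + 1) \<Longrightarrow>
           (weight D k *\<^sub>v u k + u0 \<cdot>\<^sub>v bias D k) $ i \<noteq> 0"
    and "\<And>k i. k \<in> {1..<depth D} \<Longrightarrow> i < width D (k + 1) \<Longrightarrow>
           row (weight D k * V k) i \<noteq> 0\<^sub>v (r - 1)"
    and "\<And>k. k \<in> {1..depth D} \<Longrightarrow> \<xi> k \<in> carrier_vec (width D k)"
    and "\<exists>\<mu>. eigenvector (slack_matrix D y z) (stack D \<xi>0 \<xi>) \<mu>"
    and "vnorm (stack D \<xi>0 \<xi>) = 1"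
    and "stack D \<xi>0 \<xi> \<bullet> (slack_matrix D y z *\<^sub>v stack D \<xi>0 \<xi>) = - \<gamma> * (vnorm (stack D \<xi>0 \<xi>))\<^sup>2"
  shows "\<exists>(uP :: real \<Rightarrow> nat \<Rightarrow> real vec) (VP :: real \<Rightarrow> nat \<Rightarrow> real mat) (\<epsilon> :: real).
    0 < \<epsilon> \<and>
    C1_path D (r + 1) \<epsilon> (\<lambda>t. (u0, uP t, VP t)) \<and>
    (\<forall>k\<in>{1..depth D}.
       uP 0 k = u k \<and>
       (\<lambda>t. vnorm (uP t k - u k)) \<in> O[at_right 0](\<lambda>t. t\<^sup>2) \<and>
       VP 0 k = hcat (V k) (0\<^sub>m (width D k) 1) \<and>
       (\<lambda>t. fnorm (VP t k -
               (hcat (V k) (0\<^sub>m (width D k) 1) +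
                t \<cdot>\<^sub>m hcat (0\<^sub>m (width D k) (r - 1)) (col_mat ((\<xi>0 / u0) \<cdot>\<^sub>v u k - \<xi> k)))))
         \<in> O[at_right 0](\<lambda>t. t\<^sup>2)) \<and>
    (\<forall>t\<in>{0..<\<epsilon>}.
       obj D (u0, uP t, VP t) = obj D (u0, u, V) - t\<^sup>2 * \<gamma> \<and>
       feasible D (u0, uP t, VP t) \<and>
       pnorm D (u0, uP t, VP t) \<le> R)"
proof -
  note D = assms(1) and r = assms(2)
  let ?x = "(u0, u, V)"
  have x: "?x \<in> bm_points D r" and mults: "valid_mults D y z" and feas: "feasible D ?x"
    and grad: "\<forall>a\<in>coords D r. grad_f_gy_hz D y z ?x a = 0" and slack: "compl_slack D y ?x"
    using assms(4) by (auto simp: cert_first_order_opt_def first_order_opt_def)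
  have "u0 * u0 = 1" using feasible_iff[OF D x] feas by blast
  then have u0: "u0 \<noteq> 0" by auto
  \<comment> \<open>The coefficient \<open>\<xi>0 / u0\<close> cancels the zeroth entry; on layer
    \<open>k\<close> this is the direction prescribed for the new column.\<close>
  define v where "v = (\<lambda>k i. \<xi>0 / u0 * ucol D ?x k i - ucol D (\<xi>0, \<xi>, V) k i)"
  have v_sup: "col_supported D v"
    using col_supported_shift[OF _ ucol_supported, of D "\<lambda>k i. \<xi>0 / u0 * ucol D ?x k i" 1 "(\<xi>0, \<xi>, V)"]
      ucol_supported[of D ?x]
    unfolding v_def col_supported_def by (metis mult_1 mult_zero_right)
  have v00: "v 0 0 = 0" using u0 by (simp add: v_def)
  have "lagrangian_form D y z v v = - \<gamma>"
    unfolding v_def escape_direction_value[OF D x grad ucol_supported]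
    using slack_quadratic_form[OF D mults assms(10)] assms(12,13) by simp
  note escape = escape_curve[OF D r x feas grad slack assms(8,9) v_sup v00 this assms(6)]
  obtain s UU VV where s: "C1_at0 s" "s 0 = 0" "(\<lambda>t. s t - t) \<in> O[nhds 0](\<lambda>t. t\<^sup>2)"
    and UU: "\<And>k i. C1_at0 (\<lambda>t. UU t k i)" and VV: "\<And>j k i. C1_at0 (\<lambda>t. VV t j k i)"
    and init: "UU 0 = ucol D ?x" "VV 0 = (\<lambda>j. vcol D j ?x)"
    and curve: "\<forall>\<^sub>F t in nhds 0.
       let x' = col_point D (r + 1) u0 (UU ((s t)\<^sup>2)) (\<lambda>j. if j < r - 1 then VV ((s t)\<^sup>2) j else (\<lambda>k i. s t * v k i))
       in feasible D x' \<and> obj D x' = obj D ?x - t\<^sup>2 * \<gamma>"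
    by (rule escape) (assumption | rule that)+
  define uP where "uP t k = vec (width D k) (UU ((s t)\<^sup>2) k)" for t k
  \<comment> \<open>Column \<open>r - 1\<close> is the new one, and the indices below it are the old
    columns.\<close>
  define W where "W t j = (if j < r - 1 then VV ((s t)\<^sup>2) j else (\<lambda>k i. s t * v k i))" for t j
  define VP where "VP t k = mat (width D k) r (\<lambda>(i, j). W t j k i)" for t k
  have point: "col_point D (r + 1) u0 (UU ((s t)\<^sup>2)) (\<lambda>j. if j < r - 1 then VV ((s t)\<^sup>2) j else (\<lambda>k i. s t * v k i))
      = (u0, uP t, VP t)" for t
    unfolding col_point_def uP_def[abs_def] VP_def[abs_def] W_def by simp
  note s2 = C1_at0_power[OF s(1), of 2]
  have lim: "filterlim (\<lambda>t. (s t)\<^sup>2) (nhds 0) (nhds 0)"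
    using C1_at0_tendsto[OF s2] s(2) by simp
  have UU_s: "C1_at0 (\<lambda>t. UU ((s t)\<^sup>2) k i)" and VV_s: "C1_at0 (\<lambda>t. VV ((s t)\<^sup>2) j k i)" for j k i
    using C1_at0_compose[OF UU s2] C1_at0_compose[OF VV s2] s(2) by simp_all
  have W: "C1_at0 (\<lambda>t. W t j k i)" for j k i
    unfolding W_def by (cases "j < r - 1") (simp_all add: VV_s C1_at0_mult[OF s(1) C1_at0_const])
  have W0: "W 0 j k i = (if j < r - 1 then vcol D j ?x k i else 0)" for j k i
    by (simp add: W_def init s(2))
  have uV: "u k \<in> carrier_vec (width D k)" "V k \<in> carrier_mat (width D k) (r - 1)" if "k \<in> {1..depth D}" for k
    using x that by (auto simp: bm_points_def)
  have dim: "dim_vec (u k) = width D k" "dim_row (V k) = width D k" "dim_col (V k) = r - 1" if "k \<in> {1..depth D}" for k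
    using uV[OF that] by auto
  have s2_O: "(\<lambda>t. (s t)\<^sup>2) \<in> O[nhds 0](\<lambda>t. t\<^sup>2)"
    using landau_o.big_power[OF C1_at0_bigo[OF s(1)], of 2] s(2) by simp
  \<comment> \<open>A C1 germ evaluated at \<open>(s t)^2\<close> moves by \<open>O(t^2)\<close>,
    which settles all entries except those of the new column.\<close>
  have square_O: "(\<lambda>t. g ((s t)\<^sup>2) - g 0) \<in> O[nhds 0](\<lambda>t. t\<^sup>2)" if "C1_at0 g" for g
    using landau_o.big.compose[OF C1_at0_bigo[OF that] lim] s2_O by (rule landau_o.big_trans)
  have right: "g \<in> O[at_right 0](\<lambda>t. t\<^sup>2)" if "g \<in> O[nhds 0](\<lambda>t. t\<^sup>2)" for g :: "real \<Rightarrow> real"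
    using that by (rule landau_o.big.filter_mono[rotated]) (simp add: at_within_def)
  have P1: "\<forall>\<^sub>F t in nhds 0. feasible D (u0, uP t, VP t) \<and> obj D (u0, uP t, VP t) = obj D ?x - t\<^sup>2 * \<gamma>"
    using curve unfolding point Let_def .
  \<comment> \<open>At 0 the new column vanishes and the norm bound is strict; continuity keeps it
    strict nearby.\<close>
  have P2: "\<forall>\<^sub>F t in nhds 0. pnorm D (u0, uP t, VP t) < R"
  proof -
    define N where "N t = u0\<^sup>2 + (\<Sum>k=1..depth D. \<Sum>i<width D k. (UU ((s t)\<^sup>2) k i)\<^sup>2)
        + (\<Sum>k=1..depth D. \<Sum>i<width D k. \<Sum>j<r. (W t j k i)\<^sup>2)" for t
    have N: "pnorm D (u0, uP t, VP t) = sqrt (N t)" for t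
      by (simp add: N_def vnorm_sq fnorm_sq uP_def VP_def)
    have rr: "{..<r} = insert (r - 1) {..<r - 1}" using r by auto
    have last: "(\<Sum>j<r. (W 0 j k i)\<^sup>2) = (\<Sum>j<r - 1. (W 0 j k i)\<^sup>2)" for k i
      unfolding rr by (simp add: W0)
    have "N 0 = u0\<^sup>2 + (\<Sum>k=1..depth D. (vnorm (u k))\<^sup>2) + (\<Sum>k=1..depth D. (fnorm (V k))\<^sup>2)"
      unfolding N_def vnorm_sq fnorm_sq last
      by (intro arg_cong2[where f = "(+)"] sum.cong refl) (auto simp: s(2) init W0 dim)
    then have "sqrt (N 0) < R" using assms(7) by simp
    have "C1_at0 N"
      unfolding N_def by (intro C1_at0_add C1_at0_sum C1_at0_power C1_at0_const UU_s W)
    from tendsto_real_sqrt[OF C1_at0_tendsto[OF this]] \<open>sqrt (N 0) < R\<close>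
    show ?thesis unfolding N by (rule order_tendstoD(2))
  qed
  have "\<forall>c\<in>coords D (r + 1). \<exists>p'.
      (\<forall>\<^sub>F t in nhds 0. ((\<lambda>t. coord_val (u0, uP t, VP t) c) has_real_derivative p' t) (at t)) \<and>
      (\<forall>\<^sub>F t in nhds 0. isCont p' t)"
  proof
    fix c assume c: "c \<in> coords D (r + 1)"
    have "C1_at0 (\<lambda>t. coord_val (u0, uP t, VP t) c)"
    proof (cases c)
      case C0
      then show ?thesis by (simp add: C1_at0_const)
    next
      case (CU k i)
      then have "i < width D k" using c by (auto simp: coords_def)
      then show ?thesis by (simp add: CU uP_def UU_s)
    next
      case (CV k i j)
      then have "i < width D k" "j < r" using c by (auto simp: coords_def)
      then show ?thesis by (simp add: CV VP_def W)
    qed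
    then show "\<exists>p'. (\<forall>\<^sub>F t in nhds 0. ((\<lambda>t. coord_val (u0, uP t, VP t) c) has_real_derivative p' t) (at t)) \<and>
      (\<forall>\<^sub>F t in nhds 0. isCont p' t)"
      unfolding C1_at0_def .
  qed
  \<comment> \<open>Derivatives are fixed for all coordinates before the interval is shrunk, so that
    one \<epsilon> serves them all.\<close>
  from bchoice[OF this] obtain p' where p': "\<forall>c\<in>coords D (r + 1).
      (\<forall>\<^sub>F t in nhds 0. ((\<lambda>t. coord_val (u0, uP t, VP t) c) has_real_derivative p' c t) (at t)) \<and>
      (\<forall>\<^sub>F t in nhds 0. isCont (p' c) t)"
    by (rule exE)
  have P3: "\<forall>\<^sub>F t in nhds 0. \<forall>c\<in>coords D (r + 1).
      ((\<lambda>t. coord_val (u0, uP t, VP t) c) has_real_derivative p' c t) (at t) \<and> isCont (p' c) t"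
    by (intro eventually_ball_finite finite_coords ballI eventually_conj)
      (rule p'[rule_format, THEN conjunct1] p'[rule_format, THEN conjunct2], assumption)+
  from eventually_conj[OF P1 eventually_conj[OF P2 P3]] obtain \<epsilon> where "0 < \<epsilon>" and \<epsilon>:
    "\<And>t. dist t 0 < \<epsilon> \<Longrightarrow>
      (feasible D (u0, uP t, VP t) \<and> obj D (u0, uP t, VP t) = obj D ?x - t\<^sup>2 * \<gamma>) \<and>
      pnorm D (u0, uP t, VP t) < R \<and>
      (\<forall>c\<in>coords D (r + 1). ((\<lambda>t. coord_val (u0, uP t, VP t) c) has_real_derivative p' c t) (at t) \<and> isCont (p' c) t)"
    unfolding eventually_nhds_metric by blast
  note P = \<epsilon>[THEN conjunct2, THEN conjunct2, rule_format]
  show ?thesis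
  proof (rule exI[of _ uP], rule exI[of _ VP], rule exI[of _ \<epsilon>], intro conjI ballI)
    show "0 < \<epsilon>" by fact
    show "C1_path D (r + 1) \<epsilon> (\<lambda>t. (u0, uP t, VP t))"
      unfolding C1_path_def
    proof (intro conjI ballI)
      fix t show "(u0, uP t, VP t) \<in> bm_points D (r + 1)"
        unfolding point[symmetric] by (rule col_point_in_bm_points)
    next
      fix c assume c: "c \<in> coords D (r + 1)"
      show "\<exists>q. (\<forall>t\<in>{0..<\<epsilon>}. ((\<lambda>s. coord_val (u0, uP s, VP s) c) has_real_derivative q t) (at t within {0..<\<epsilon>})) \<and>
          continuous_on {0..<\<epsilon>} q"
      proof (rule exI[of _ "p' c"], intro conjI ballI)
        fix t assume "t \<in> {0..<\<epsilon>}"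
        then have "dist t 0 < \<epsilon>" by simp
        from P[OF this c] have "((\<lambda>s. coord_val (u0, uP s, VP s) c) has_real_derivative p' c t) (at t)"
          by (rule conjunct1)
        then show "((\<lambda>s. coord_val (u0, uP s, VP s) c) has_real_derivative p' c t) (at t within {0..<\<epsilon>})"
          by (rule has_field_derivative_at_within)
      next
        show "continuous_on {0..<\<epsilon>} (p' c)"
        proof (rule continuous_at_imp_continuous_on, rule ballI)
          fix t assume "t \<in> {0..<\<epsilon>}"
          then have "dist t 0 < \<epsilon>" by simp
          from P[OF this c] show "isCont (p' c) t" by (rule conjunct2)
        qed
      qed
    qed
  next
    fix k assume k: "k \<in> {1..depth D}"
    have u_val: "ucol D ?x k i = u k $ i" if "i < width D k" for i using k that by simp
    show "uP 0 k = u k"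
      using uV(1)[OF k] u_val by (intro eq_vecI) (simp_all add: uP_def s(2) init)
    show "(\<lambda>t. vnorm (uP t k - u k)) \<in> O[at_right 0](\<lambda>t. t\<^sup>2)"
    proof (rule vnorm_bigo[where n = "width D k"])
      show "dim_vec (uP t k - u k) = width D k" for t using uV(1)[OF k] by simp
      fix i assume i: "i < width D k"
      have "(\<lambda>t. (uP t k - u k) $ i) = (\<lambda>t. UU ((s t)\<^sup>2) k i - UU 0 k i)"
        using uV(1)[OF k] u_val[OF i] i by (simp add: uP_def init del: ucol.simps)
      then show "(\<lambda>t. (uP t k - u k) $ i) \<in> O[at_right 0](\<lambda>t. t\<^sup>2)"
        using right[OF square_O[OF UU]] by simp
    qed
    have V_val: "vcol D j ?x k i = V k $$ (i, j)" if "i < width D k" for i j using k that by simp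
    show "VP 0 k = hcat (V k) (0\<^sub>m (width D k) 1)"
      using uV(2)[OF k] r V_val by (intro eq_matI) (auto simp: VP_def hcat_def W0 simp del: vcol.simps)
    show "(\<lambda>t. fnorm (VP t k - (hcat (V k) (0\<^sub>m (width D k) 1) +
                t \<cdot>\<^sub>m hcat (0\<^sub>m (width D k) (r - 1)) (col_mat ((\<xi>0 / u0) \<cdot>\<^sub>v u k - \<xi> k)))))
         \<in> O[at_right 0](\<lambda>t. t\<^sup>2)" (is "(\<lambda>t. fnorm (?M t)) \<in> _")
    proof (rule fnorm_bigo[where n = "width D k" and m = r])
      have xk: "\<xi> k \<in> carrier_vec (width D k)" using assms(10)[OF k] .
      show "?M t \<in> carrier_mat (width D k) r" for t
        using uV[OF k] xk r by (intro carrier_matI) (simp_all add: hcat_def col_mat_def)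
      fix i j assume i: "i < width D k" and j: "j < r"
      have v_val: "v k i = ((\<xi>0 / u0) \<cdot>\<^sub>v u k - \<xi> k) $ i"
        using k i uV(1)[OF k] xk by (simp add: v_def)
      show "(\<lambda>t. ?M t $$ (i, j)) \<in> O[at_right 0](\<lambda>t. t\<^sup>2)"
      proof (cases "j < r - 1")
        case True
        then have "(\<lambda>t. ?M t $$ (i, j)) = (\<lambda>t. VV ((s t)\<^sup>2) j k i - VV 0 j k i)"
          using uV[OF k] xk r i j V_val[OF i, of j]
          by (simp add: VP_def W_def hcat_def col_mat_def init del: vcol.simps)
        then show ?thesis using right[OF square_O[OF VV]] by simp
      next
        case False
        \<comment> \<open>In the new column the prescribed linear term is \<open>t * v k i\<close>,
          so the error is \<open>v k i * (s t - t)\<close>.\<close>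
        then have "j = r - 1" using j by simp
        then have "(\<lambda>t. ?M t $$ (i, j)) = (\<lambda>t. v k i * (s t - t))"
          using uV[OF k] xk r i
          by (simp add: VP_def W_def hcat_def col_mat_def mat_of_cols_def v_val algebra_simps diff_divide_distrib)
        moreover have "(\<lambda>t. v k i * (s t - t)) \<in> O[nhds 0](\<lambda>t. t\<^sup>2)"
          using s(3) by (cases "v k i = 0") simp_all
        ultimately show ?thesis using right by (simp only:)
      qed
    qed
  next
    fix t assume "t \<in> {0..<\<epsilon>}"
    then have "dist t 0 < \<epsilon>" by simp
    note e = \<epsilon>[OF this]
    show "obj D (u0, uP t, VP t) = obj D (u0, u, V) - t\<^sup>2 * \<gamma>"
      by (rule e[THEN conjunct1, THEN conjunct2])
    show "feasible D (u0, uP t, VP t)"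
      by (rule e[THEN conjunct1, THEN conjunct1])
    show "pnorm D (u0, uP t, VP t) \<le> R"
      by (rule less_imp_le[OF e[THEN conjunct2, THEN conjunct1]])
  qed
qed

end
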